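(* Let $U$ be an open subset of $\mathbb C$. Let $A$ and $B$ be unital complex Banach algebras, and let $\pi:U\to\mathcal B(A,B)$ be an analytic map whose values are surjective unit-preserving homomorphisms $A\to B$. Suppose that for each $\lambda\in U$ the spectrum (in $A$) of each element of $\operatorname{Ker}\pi(\lambda)$ is $\{0\}$. Let $b(\cdot):U\to E_p(B)\ (\subset B)$ be an analytic map. Then there exists an analytic map $a(\cdot):U\to E_p(A)\ (\subset A)$ such that $$\pi(\lambda)a(\lambda)=b(\lambda)\quad\text{for each }\lambda\in U.$$
   Context: All Banach algebras have a unit of norm $1$. Fix an integer $n\ge2$, distinct $\lambda_1,\dots,\lambda_n\in\mathbb C$, and let $p(\lambda)=\prod_{i=1}^n(\lambda-\lambda_i)$. For a unital complex Banach algebra $A$, $E_p(A)=\{a\in A\mid p(a)=0\}$. $\mathcal B(A,B)$ is the Banach space of all bounded linear operators $A\to B$. A map into $E_p(A)$ is analytic if it is analytic as a map into $A$. Homomorphism means Banach algebra homomorphism. *)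

theory Defs
  imports "HOL-Analysis.Analysis" "HOL-Computational_Algebra.Polynomial"
begin

text \<open>
  The complex structure is an extension of the library's real one: complex scalar multiplication
  restricts to the real scalar multiplication already present.
\<close>

class complex_normed_vector = real_normed_vector +
  fixes scaleC :: "complex \<Rightarrow> 'a \<Rightarrow> 'a" (infixr "*\<^sub>C" 75)
  assumes scaleC_of_real: "complex_of_real r *\<^sub>C x = r *\<^sub>R x"
    and scaleC_add_right: "c *\<^sub>C (x + y) = c *\<^sub>C x + c *\<^sub>C y"
    and scaleC_add_left: "(c + d) *\<^sub>C x = c *\<^sub>C x + d *\<^sub>C x"
    and scaleC_scaleC: "c *\<^sub>C (d *\<^sub>C x) = (c * d) *\<^sub>C x"
    and norm_scaleC: "norm (c *\<^sub>C x) = norm c * norm x"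

text \<open>
  The class \<open>real_normed_algebra_1\<close> supplies associativity, a submultiplicative norm and a unit
  with \<open>norm 1 = 1\<close>; \<open>banach\<close> supplies completeness.
\<close>

class complex_banach_algebra_1 = complex_normed_vector + real_normed_algebra_1 + banach +
  assumes mult_scaleC_left: "(c *\<^sub>C x) * y = c *\<^sub>C (x * y)"
    and mult_scaleC_right: "x * (c *\<^sub>C y) = c *\<^sub>C (x * y)"

instantiation complex :: complex_banach_algebra_1
begin

definition scaleC_complex :: "complex \<Rightarrow> complex \<Rightarrow> complex" where
  "scaleC_complex c x = c * x"

instance
  by standard (simp_all add: scaleC_complex_def scaleR_conv_of_real norm_mult algebra_simps)

end

lemma bounded_linear_scaleC: "bounded_linear (\<lambda>x. c *\<^sub>C (x :: 'a::complex_normed_vector))"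
proof (rule bounded_linear_intro[where K = "norm c"])
  fix r and x :: 'a
  have "c *\<^sub>C (complex_of_real r *\<^sub>C x) = complex_of_real r *\<^sub>C (c *\<^sub>C x)"
    by (simp add: scaleC_scaleC mult.commute)
  then show "c *\<^sub>C (r *\<^sub>R x) = r *\<^sub>R (c *\<^sub>C x)"
    by (simp add: scaleC_of_real)
qed (simp_all add: scaleC_add_right norm_scaleC mult.commute)

text \<open>
  Elements of the library's type \<open>'a \<Rightarrow>\<^sub>L 'b\<close> are only real-linear. For complex \<open>'a\<close> and \<open>'b\<close> the
  bounded complex-linear operators form a closed complex subspace of it, with the same operator
  norm. Hence a map with complex-linear values is analytic into that subspace iff it is analytic
  into \<open>'a \<Rightarrow>\<^sub>L 'b\<close>.
\<close>

instantiation blinfun :: (real_normed_vector, complex_normed_vector) complex_normed_vector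
begin

lift_definition scaleC_blinfun :: "complex \<Rightarrow> 'a \<Rightarrow>\<^sub>L 'b \<Rightarrow> 'a \<Rightarrow>\<^sub>L 'b"
  is "\<lambda>c f x. c *\<^sub>C f x"
  by (rule bounded_linear_compose[OF bounded_linear_scaleC])

instance
proof
  fix r :: real and c d :: complex and f g :: "'a \<Rightarrow>\<^sub>L 'b"
  show "complex_of_real r *\<^sub>C f = r *\<^sub>R f"
    by transfer (simp add: scaleC_of_real)
  show "c *\<^sub>C (f + g) = c *\<^sub>C f + c *\<^sub>C g"
    by transfer (simp add: scaleC_add_right)
  show "(c + d) *\<^sub>C f = c *\<^sub>C f + d *\<^sub>C f"
    by transfer (simp add: scaleC_add_left)
  show "c *\<^sub>C (d *\<^sub>C f) = (c * d) *\<^sub>C f"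
    by transfer (simp add: scaleC_scaleC)
  have "onorm (\<lambda>x. c *\<^sub>C blinfun_apply f x) = onorm (\<lambda>x. norm c *\<^sub>R blinfun_apply f x)"
    by (simp add: onorm_def norm_scaleC)
  also have "\<dots> = norm c * norm f"
    by (simp add: onorm_scaleR blinfun.bounded_linear_right norm_blinfun.rep_eq)
  finally show "norm (c *\<^sub>C f) = norm c * norm f"
    by (simp add: norm_blinfun.rep_eq scaleC_blinfun.rep_eq)
qed

end

text \<open>
  Analyticity in the sense of local power series expansions; the library's \<open>analytic_on\<close> is
  restricted to complex-valued maps.
\<close>

definition banach_analytic_on ::
    "(complex \<Rightarrow> 'a::complex_normed_vector) \<Rightarrow> complex set \<Rightarrow> bool" where
  "banach_analytic_on f S \<longleftrightarrow>
     (\<forall>z\<in>S. \<exists>r>0. \<exists>c :: nat \<Rightarrow> 'a. \<forall>w\<in>ball z r. (\<lambda>k. (w - z) ^ k *\<^sub>C c k) sums f w)"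

definition algebra_spectrum :: "'a::complex_banach_algebra_1 \<Rightarrow> complex set" where
  "algebra_spectrum a = {z. \<not> (\<exists>x. x * (z *\<^sub>C 1 - a) = 1 \<and> (z *\<^sub>C 1 - a) * x = 1)}"

text \<open>Boundedness is part of the type \<open>'a \<Rightarrow>\<^sub>L 'b\<close>; preservation of the unit is not included.\<close>

definition algebra_hom ::
    "('a::complex_banach_algebra_1 \<Rightarrow>\<^sub>L 'b::complex_banach_algebra_1) \<Rightarrow> bool" where
  "algebra_hom f \<longleftrightarrow>
     (\<forall>c x. blinfun_apply f (c *\<^sub>C x) = c *\<^sub>C blinfun_apply f x) \<and>
     (\<forall>x y. blinfun_apply f (x * y) = blinfun_apply f x * blinfun_apply f y)"

definition blinfun_kernel :: "('a::real_normed_vector \<Rightarrow>\<^sub>L 'b::real_normed_vector) \<Rightarrow> 'a set" where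
  "blinfun_kernel f = {x. blinfun_apply f x = 0}"

definition poly_eval :: "complex poly \<Rightarrow> 'a::complex_banach_algebra_1 \<Rightarrow> 'a" where
  "poly_eval p a = (\<Sum>i\<le>degree p. coeff p i *\<^sub>C a ^ i)"

definition root_poly :: "nat \<Rightarrow> (nat \<Rightarrow> complex) \<Rightarrow> complex poly" where
  "root_poly n \<alpha> = (\<Prod>i=1..n. [:- \<alpha> i, 1:])"

definition algebraic_elements :: "complex poly \<Rightarrow> 'a::complex_banach_algebra_1 set" where
  "algebraic_elements p = {a. poly_eval p a = 0}"

end

theory Submission
  imports Defs "HOL-Complex_Analysis.Complex_Analysis" "HOL-Probability.Discrete_Topology"
begin

text \<open>
  The proof lifts \<open>b\<close> first as a map between Banach spaces and then corrects the lift algebraically.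

  \<^emph>\<open>Linear lifting\<close> (\<open>global_lift\<close>). Let \<open>\<pi>\<close> be an analytic family of surjective operators on an open
  set \<open>U\<close>. Near each point an analytic map into the target has an analytic lift, because the Taylor
  coefficients of the lift can be found one after the other with bounds from the open mapping theorem
  (\<open>local_lift\<close>). Local lifts differ by maps with values in the kernels, so their globalization is an
  additive Cousin problem for the kernel bundle. Since the kernels need not be complemented, the
  bundle is handled through \<open>\<pi>\<close> alone, in two steps.

  The first step is approximation (\<open>simultaneous_approximation\<close>): for compact sets \<open>K \<subseteq> K'\<close>, where \<open>K\<close> has
  no holes that are filled in \<open>K'\<close>, a lift of \<open>h\<close> near \<open>K\<close> is approximated on \<open>K\<close> by maps \<open>g\<close> analytic
  near \<open>K'\<close> with \<open>\<pi> g\<close> close to \<open>h\<close> on \<open>K'\<close>. In a Banach space of bounded families let \<open>Y\<close> be the closure of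
  the pairs \<open>(g, \<pi> g)\<close>. Dividing the given pair by \<open>z - \<mu>\<close>, after subtraction of a suitable constant, gives
  a map of \<open>\<mu>\<close> that is well defined and entire modulo \<open>Y\<close> and vanishes at infinity. By Liouville's
  theorem modulo \<open>Y\<close> (\<open>liouville_mod_subspace\<close>) it has values in \<open>Y\<close>, and its behaviour at infinity
  recovers the pair. As \<open>\<mu>\<close> only enters through local lifts, no global lift is presupposed.

  The second step is a bound (\<open>bounded_solution\<close>): maps of norm at most one near a compact set have
  exact lifts on a smaller set with a common bound. Cauchy's formula over the boundary of a union of
  small squares (\<open>grid_cauchy_formula\<close>) reduces this to local lifts along the edges and to a remainder
  that is approximated by the first step. All maps are treated at once, as coordinates of one map into
  a space of bounded families; this turns qualitative statements into uniform ones.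

  Approximation together with the bound yields lifts on an exhaustion of \<open>U\<close> that differ by less and
  less, and the Mittag-Leffler argument gives a global lift \<open>c\<close> of \<open>b\<close>.

  \<^emph>\<open>Algebraic correction\<close> (\<open>lift_of_algebraic_element\<close>). The element \<open>b(z)\<close> is a combination of the
  orthogonal idempotents that the Lagrange polynomials of the roots give at \<open>b(z)\<close>. The same
  polynomials at \<open>c(z)\<close> give elements \<open>x\<close> for which \<open>x\<^sup>2 - x\<close> lies in the kernel of \<open>\<pi>(z)\<close> and therefore is
  quasinilpotent: all its powers are small (\<open>quasinilpotent_power_bound\<close>). Hence
  \<open>1/2 + (x - 1/2) (1 + 4 (x\<^sup>2 - x))\<^sup>-\<^sup>1\<^sup>/\<^sup>2\<close>, with the root given by the binomial series, is an idempotent with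
  the same image as \<open>x\<close>, and it depends analytically on \<open>z\<close> (\<open>holo_idem\<close>). These idempotents commute. An
  idempotent with spectrum \<open>{0}\<close> is \<open>0\<close>; applied to products of two of them and to the defect of their
  sum, this shows that they are orthogonal with sum \<open>1\<close>. So the combination of them with the roots as
  coefficients is annihilated by the polynomial, and it is the required lift.
\<close>

section \<open>Complex scalar multiplication\<close>

lemma bounded_bilinear_scaleC:
  "bounded_bilinear (scaleC :: complex \<Rightarrow> 'a::complex_normed_vector \<Rightarrow> 'a)"
proof
  fix a a' :: complex and b b' :: 'a and r :: real
  show "(a + a') *\<^sub>C b = a *\<^sub>C b + a' *\<^sub>C b" by (rule scaleC_add_left)
  show "a *\<^sub>C (b + b') = a *\<^sub>C b + a *\<^sub>C b'" by (rule scaleC_add_right)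
  have "(r *\<^sub>R a) *\<^sub>C b = complex_of_real r *\<^sub>C (a *\<^sub>C b)"
    by (simp add: scaleC_scaleC scaleR_conv_of_real)
  then show "(r *\<^sub>R a) *\<^sub>C b = r *\<^sub>R (a *\<^sub>C b)" by (simp add: scaleC_of_real)
  show "a *\<^sub>C (r *\<^sub>R b) = r *\<^sub>R (a *\<^sub>C b)"
    by (rule linear_cmul[OF bounded_linear.linear[OF bounded_linear_scaleC]])
  show "\<exists>K. \<forall>a (b::'a). norm (a *\<^sub>C b) \<le> norm a * norm b * K"
    by (rule exI[of _ 1]) (simp add: norm_scaleC)
qed

interpretation scaleC: bounded_bilinear "scaleC :: complex \<Rightarrow> 'a::complex_normed_vector \<Rightarrow> 'a"
  by (rule bounded_bilinear_scaleC)

lemma scaleC_one [simp]: "1 *\<^sub>C (x::'a::complex_normed_vector) = x"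
  using scaleC_of_real[of 1 x] by simp

declare scaleC.zero_left [simp] scaleC.zero_right [simp]

lemma complex_scaleC [simp]: "c *\<^sub>C (x::complex) = c * x"
  by (simp add: scaleC_complex_def)

lemmas continuous_on_scaleC [continuous_intros] = scaleC.continuous_on

section \<open>Continuously complex differentiable maps\<close>

abbreviation has_cderiv ::
    "(complex \<Rightarrow> 'a::complex_normed_vector) \<Rightarrow> 'a \<Rightarrow> complex \<Rightarrow> bool" where
  "has_cderiv f d z \<equiv> (f has_derivative (\<lambda>h. h *\<^sub>C d)) (at z)"

definition cderiv :: "(complex \<Rightarrow> 'a::complex_normed_vector) \<Rightarrow> complex \<Rightarrow> 'a" where
  "cderiv f z = frechet_derivative f (at z) 1"

text \<open>
  On open sets this is the same as analyticity (\<open>banach_analytic_on_imp_holo\<close>,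
  \<open>holo_imp_banach_analytic_on\<close>), but it is stable under the algebraic operations by the rules for
  derivatives. Continuity of the derivative is part of the notion because Cauchy's formula is
  proved by differentiation under the integral sign.
\<close>

definition holo :: "(complex \<Rightarrow> 'a::complex_normed_vector) \<Rightarrow> complex set \<Rightarrow> bool" where
  "holo f S \<longleftrightarrow> open S \<and> continuous_on S (cderiv f) \<and> (\<forall>z\<in>S. has_cderiv f (cderiv f z) z)"

lemma cderiv_eq: "has_cderiv f d z \<Longrightarrow> cderiv f z = d"
  unfolding cderiv_def using frechet_derivative_at[of f "\<lambda>h. h *\<^sub>C d" z] by (metis scaleC_one)

lemma holoI:
  assumes "open S" "\<And>z. z \<in> S \<Longrightarrow> has_cderiv f (f' z) z" "continuous_on S f'"
  shows "holo f S"
proof -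
  have "cderiv f z = f' z" if "z \<in> S" for z using cderiv_eq assms(2)[OF that] .
  then show ?thesis unfolding holo_def using assms by (auto cong: continuous_on_cong_simp)
qed

lemma holoD:
  assumes "holo f S"
  shows "open S" "continuous_on S (cderiv f)" "\<And>z. z \<in> S \<Longrightarrow> has_cderiv f (cderiv f z) z"
  using assms unfolding holo_def by auto

lemma holo_continuous_on: "holo f S \<Longrightarrow> continuous_on S f"
  by (meson continuous_at_imp_continuous_on has_derivative_continuous holoD(3))

lemma holo_subset: "holo f S \<Longrightarrow> T \<subseteq> S \<Longrightarrow> open T \<Longrightarrow> holo f T"
  unfolding holo_def using continuous_on_subset by blast

lemma holo_local:
  assumes "\<And>z. z \<in> S \<Longrightarrow> \<exists>T. z \<in> T \<and> T \<subseteq> S \<and> holo f T"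
  shows "holo f S"
proof -
  have o: "open S" unfolding openI using assms holoD(1)
    by (subst open_subopen) blast
  have "isCont (cderiv f) z" if "z \<in> S" for z
    using assms[OF that] unfolding holo_def by (meson continuous_on_eq_continuous_at)
  then have "continuous_on S (cderiv f)" by (simp add: continuous_at_imp_continuous_on)
  moreover have "has_cderiv f (cderiv f z) z" if "z \<in> S" for z
    using assms[OF that] unfolding holo_def by blast
  ultimately show ?thesis using o unfolding holo_def by blast
qed

lemma holo_cong:
  assumes "holo f S" "\<And>z. z \<in> S \<Longrightarrow> g z = f z"
  shows "holo g S"
proof (rule holoI[where f' = "cderiv f"])
  show "open S" "continuous_on S (cderiv f)" using holoD[OF assms(1)] by auto
  show "has_cderiv g (cderiv f z) z" if "z \<in> S" for z
    using has_derivative_transform_within_open[OF holoD(3)[OF assms(1) that] holoD(1)[OF assms(1)] that]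
      assms(2) by metis
qed

lemma holo_const: "open S \<Longrightarrow> holo (\<lambda>z. c) S"
  by (rule holoI[where f' = "\<lambda>z. 0"]) auto

lemma holo_ident: "open S \<Longrightarrow> holo (\<lambda>z. z) S"
  by (rule holoI[where f' = "\<lambda>z. 1"]) auto

lemma holo_add: "holo f S \<Longrightarrow> holo g S \<Longrightarrow> holo (\<lambda>z. f z + g z) S"
  by (rule holoI[where f' = "\<lambda>z. cderiv f z + cderiv g z"])
    (auto simp: holo_def scaleC.add_right intro!: derivative_eq_intros continuous_intros)

lemma holo_diff: "holo f S \<Longrightarrow> holo g S \<Longrightarrow> holo (\<lambda>z. f z - g z) S"
  by (rule holoI[where f' = "\<lambda>z. cderiv f z - cderiv g z"])
    (auto simp: holo_def scaleC.diff_right intro!: derivative_eq_intros continuous_intros)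

lemma holo_sum: "open S \<Longrightarrow> (\<And>i. i \<in> I \<Longrightarrow> holo (f i) S) \<Longrightarrow> holo (\<lambda>z. \<Sum>i\<in>I. f i z) S"
  by (induction I rule: infinite_finite_induct) (auto intro: holo_const holo_add)

lemma holo_linear:
  assumes "bounded_linear L" "\<And>c x. L (c *\<^sub>C x) = c *\<^sub>C L x" "holo f S"
  shows "holo (\<lambda>z. L (f z)) S"
proof (rule holoI[where f' = "\<lambda>z. L (cderiv f z)"])
  show "open S" using holoD[OF assms(3)] by auto
  show "continuous_on S (\<lambda>z. L (cderiv f z))"
    using bounded_linear.continuous_on[OF assms(1)] holoD(2)[OF assms(3)] by blast
  show "has_cderiv (\<lambda>z. L (f z)) (L (cderiv f z)) z" if "z \<in> S" for z
    using bounded_linear.has_derivative[OF assms(1) holoD(3)[OF assms(3) that]] by (simp add: assms(2))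
qed

lemma holo_bilinear:
  assumes "bounded_bilinear B" "holo f S" "holo g S"
    and "\<And>c x y. B (c *\<^sub>C x) y = c *\<^sub>C B x y"
    and "\<And>z c y. z \<in> S \<Longrightarrow> B (f z) (c *\<^sub>C y) = c *\<^sub>C B (f z) y"
  shows "holo (\<lambda>z. B (f z) (g z)) S"
proof -
  interpret bounded_bilinear B by fact
  show ?thesis
  proof (rule holoI[where f' = "\<lambda>z. B (f z) (cderiv g z) + B (cderiv f z) (g z)"])
    show "open S" using holoD[OF assms(2)] by auto
    show "continuous_on S (\<lambda>z. B (f z) (cderiv g z) + B (cderiv f z) (g z))"
      using holoD(2)[OF assms(2)] holoD(2)[OF assms(3)]
        holo_continuous_on[OF assms(2)] holo_continuous_on[OF assms(3)]
      by (intro continuous_on_add continuous_on)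
    show "has_cderiv (\<lambda>z. B (f z) (g z)) (B (f z) (cderiv g z) + B (cderiv f z) (g z)) z"
      if "z \<in> S" for z
      using FDERIV[OF holoD(3)[OF assms(2) that] holoD(3)[OF assms(3) that]] assms(4,5) that
      by (simp add: scaleC_add_right)
  qed
qed

lemma holo_scaleC: "holo u S \<Longrightarrow> holo g S \<Longrightarrow> holo (\<lambda>z. u z *\<^sub>C g z) S"
  by (rule holo_bilinear[OF bounded_bilinear_scaleC])
    (auto simp: scaleC_scaleC mult.commute)

lemma holo_mult:
  fixes f g :: "complex \<Rightarrow> 'a::complex_banach_algebra_1"
  shows "holo f S \<Longrightarrow> holo g S \<Longrightarrow> holo (\<lambda>z. f z * g z) S"
  by (rule holo_bilinear[OF bounded_bilinear_mult]) (auto simp: mult_scaleC_left mult_scaleC_right)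

lemma holo_power:
  fixes f :: "complex \<Rightarrow> 'a::complex_banach_algebra_1"
  shows "holo f S \<Longrightarrow> holo (\<lambda>z. f z ^ n) S"
  by (induction n) (auto intro: holo_mult holo_const holoD)

lemma scaleC_blinfun_apply [simp]: "blinfun_apply (c *\<^sub>C P) x = c *\<^sub>C blinfun_apply P x"
  by transfer simp

lemma holo_blinfun_apply:
  fixes P :: "complex \<Rightarrow> 'a::complex_normed_vector \<Rightarrow>\<^sub>L 'b::complex_normed_vector"
  assumes "holo P S" "holo g S"
    and "\<And>z c y. z \<in> S \<Longrightarrow> blinfun_apply (P z) (c *\<^sub>C y) = c *\<^sub>C blinfun_apply (P z) y"
  shows "holo (\<lambda>z. blinfun_apply (P z) (g z)) S"
  by (rule holo_bilinear[OF bounded_bilinear_blinfun_apply assms(1,2)]) (auto simp: assms(3))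

lemma holo_complex_iff:
  fixes f :: "complex \<Rightarrow> complex"
  assumes "open S" "f holomorphic_on S"
  shows "holo f S"
proof (rule holoI[where f' = "deriv f"])
  show "has_cderiv f (deriv f z) z" if "z \<in> S" for z
    using holomorphic_derivI[OF assms(2,1) that] unfolding has_field_derivative_def
    by (simp add: mult_commute_abs)
  show "continuous_on S (deriv f)"
    using holomorphic_deriv[OF assms(2,1)] holomorphic_on_imp_continuous_on by blast
qed (rule assms)

lemma holo_inverse:
  assumes "open S" "a \<notin> S"
  shows "holo (\<lambda>z. 1 / (z - a)) S" "holo (\<lambda>z. 1 / (a - z)) S"
  using assms by (auto intro!: holo_complex_iff holomorphic_intros)

lemma power_series_coeff_bound:
  fixes c :: "nat \<Rightarrow> 'a::complex_normed_vector"
  assumes "summable (\<lambda>k. w ^ k *\<^sub>C c k)"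
  obtains M where "M > 0" "\<And>k. norm (c k) * norm w ^ k \<le> M"
proof -
  have "Bseq (\<lambda>k. w ^ k *\<^sub>C c k)"
    using assms summable_LIMSEQ_zero convergentI convergent_imp_Bseq by blast
  then obtain M where "M > 0" "\<And>k. norm (w ^ k *\<^sub>C c k) \<le> M" by (rule BseqE) blast
  then show ?thesis using that by (simp add: norm_scaleC norm_power mult.commute)
qed

text \<open>
  Differentiation term by term. Between a point and the circle of convergence there is room for two
  radii \<open>r' < s\<close>: the terms are bounded at radius \<open>s\<close>, hence the differentiated series is
  dominated on the disc of radius \<open>r'\<close> by \<open>\<Sum>k (r'/s)^(k-1)\<close> up to a factor.
\<close>

lemma power_series_holo:
  fixes f :: "complex \<Rightarrow> 'a::{complex_normed_vector,banach}"
  assumes f: "\<And>w. w \<in> ball z r \<Longrightarrow> (\<lambda>k. (w - z) ^ k *\<^sub>C c k) sums f w"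
  shows "holo f (ball z r)"
proof (rule holo_local)
  fix x assume x: "x \<in> ball z r"
  define r' where "r' = (dist z x + r) / 2"
  define s where "s = (r' + r) / 2"
  have r': "dist z x < r'" "0 < r'" "r' < s" "s < r" "0 < s"
    using x zero_le_dist[of z x] by (auto simp: r'_def s_def field_simps simp del: zero_le_dist)
  have "(\<lambda>k. (complex_of_real s) ^ k *\<^sub>C c k) sums f (z + of_real s)"
    using f[of "z + of_real s"] r' by (simp add: dist_norm)
  then obtain M where M: "M > 0" "\<And>k. norm (c k) * s ^ k \<le> M"
    using power_series_coeff_bound[of "of_real s" c] r' by (auto simp: sums_iff)
  define D where "D i x = (of_nat i * (x - z) ^ (i - 1)) *\<^sub>C c i" for i x
  define m where "m i = real i * (r' / s) ^ (i - 1) * (M / s)" for i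
  have "summable (\<lambda>n. real (Suc n) * (r' / s) ^ n)"
    using geometric_deriv_sums[of "r' / s"] r' by (auto simp: sums_iff)
  then have "summable (\<lambda>n. m (Suc n))" unfolding m_def by (intro summable_mult2) simp
  then have sm: "summable m" by (simp only: summable_Suc_iff)
  have Dm: "norm (D i x) \<le> m i" if "x \<in> ball z r'" for i x
  proof (cases i)
    case 0 then show ?thesis by (simp add: D_def m_def)
  next
    case (Suc j)
    have "norm (D i x) = real i * norm (x - z) ^ j * norm (c i)"
      by (simp add: D_def norm_scaleC norm_mult norm_power Suc del: of_nat_Suc)
    also have "\<dots> \<le> real i * r' ^ j * (M / s ^ i)"
      using M(2)[of i] r' that
      by (intro mult_mono power_mono) (auto simp: field_simps dist_norm norm_minus_commute)
    also have "\<dots> = m i" using r' by (simp add: m_def Suc field_simps power_divide)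
    finally show ?thesis .
  qed
  have ul: "uniform_limit (ball z r') (\<lambda>n x. \<Sum>i<n. D i x) (\<lambda>x. suminf (\<lambda>i. D i x)) sequentially"
    by (rule Weierstrass_m_test[OF Dm sm])
  have cont: "continuous_on (ball z r') (\<lambda>x. suminf (\<lambda>i. D i x))"
    by (rule uniform_limit_theorem[OF _ ul]) (auto simp: D_def intro!: always_eventually continuous_intros)
  have "\<exists>g. \<forall>x\<in>ball z r'. (\<lambda>n. (x - z) ^ n *\<^sub>C c n) sums (g x) \<and>
      (g has_derivative (\<lambda>h. h *\<^sub>C suminf (\<lambda>i. D i x))) (at x within ball z r')"
  proof (rule has_derivative_series[where x = z])
    fix n x assume "x \<in> ball z r'"
    have "((\<lambda>x. (x - z) ^ n) has_field_derivative of_nat n * (x - z) ^ (n - 1)) (at x within ball z r')"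
      by (auto intro!: derivative_eq_intros)
    then have "((\<lambda>x. (x - z) ^ n) has_derivative (\<lambda>h. h * (of_nat n * (x - z) ^ (n - 1))))
        (at x within ball z r')"
      unfolding has_field_derivative_def by (simp add: mult_commute_abs)
    from scaleC.FDERIV[OF this has_derivative_const]
    show "((\<lambda>x. (x - z) ^ n *\<^sub>C c n) has_derivative (\<lambda>h. h *\<^sub>C D n x)) (at x within ball z r')"
      by (simp add: D_def scaleC_scaleC)
  next
    fix e :: real assume "e > 0"
    from uniform_limitD[OF ul this]
    show "\<forall>\<^sub>F n in sequentially. \<forall>x\<in>ball z r'. \<forall>h.
        norm ((\<Sum>i<n. h *\<^sub>C D i x) - h *\<^sub>C suminf (\<lambda>i. D i x)) \<le> e * norm h"
    proof (eventually_elim, intro ballI allI)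
      fix n x h assume "\<forall>x\<in>ball z r'. dist (\<Sum>i<n. D i x) (suminf (\<lambda>i. D i x)) < e" "x \<in> ball z r'"
      then have "norm ((\<Sum>i<n. D i x) - suminf (\<lambda>i. D i x)) \<le> e" by (auto simp: dist_norm less_imp_le)
      then show "norm ((\<Sum>i<n. h *\<^sub>C D i x) - h *\<^sub>C suminf (\<lambda>i. D i x)) \<le> e * norm h"
        by (simp add: scaleC.sum_right[symmetric] scaleC.diff_right[symmetric] norm_scaleC
            mult.commute[of e] mult_left_mono)
    qed
  next
    show "(\<lambda>n. (z - z) ^ n *\<^sub>C c n) sums f z" using f[of z] r' by simp
  qed (use r' in auto)
  then obtain g where g: "\<And>x. x \<in> ball z r' \<Longrightarrow> (\<lambda>n. (x - z) ^ n *\<^sub>C c n) sums (g x)"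
    "\<And>x. x \<in> ball z r' \<Longrightarrow> (g has_derivative (\<lambda>h. h *\<^sub>C suminf (\<lambda>i. D i x))) (at x within ball z r')"
    by blast
  have "holo g (ball z r')"
    by (rule holoI[OF _ _ cont]) (use g(2) in \<open>auto simp: at_within_open[OF _ open_ball]\<close>)
  then have "holo f (ball z r')"
  proof (rule holo_cong)
    show "f x = g x" if "x \<in> ball z r'" for x
      using sums_unique2[OF f g(1)[OF that]] that r' by auto
  qed
  then show "\<exists>T. x \<in> T \<and> T \<subseteq> ball z r \<and> holo f T" using r' by (intro exI[of _ "ball z r'"]) auto
qed

lemma banach_analytic_on_imp_holo:
  fixes f :: "complex \<Rightarrow> 'a::{complex_normed_vector,banach}"
  assumes "banach_analytic_on f S" "open S"
  shows "holo f S"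
proof (rule holo_local)
  fix z assume z: "z \<in> S"
  obtain r c where r: "r > 0" "\<And>w. w \<in> ball z r \<Longrightarrow> (\<lambda>k. (w - z) ^ k *\<^sub>C c k) sums f w"
    using assms(1) z unfolding banach_analytic_on_def by metis
  obtain e where "e > 0" "ball z e \<subseteq> S" using assms(2) z by (meson open_contains_ball)
  moreover have "holo f (ball z r)" by (rule power_series_holo[OF r(2)])
  ultimately have "holo f (ball z (min e r))" "ball z (min e r) \<subseteq> S"
    by (auto elim: holo_subset)
  then show "\<exists>T. z \<in> T \<and> T \<subseteq> S \<and> holo f T"
    using r(1) \<open>e > 0\<close> by (intro exI[of _ "ball z (min e r)"]) auto
qed

section \<open>Integrals over segments and Cauchy's formula for squares\<close>

definition segint :: "complex \<Rightarrow> complex \<Rightarrow> (complex \<Rightarrow> 'a::{complex_normed_vector,banach}) \<Rightarrow> 'a" where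
  "segint a b g = integral {0..1} (\<lambda>t. (b - a) *\<^sub>C g (linepath a b t))"

lemma segint_integrable:
  fixes g :: "complex \<Rightarrow> 'a::{complex_normed_vector,banach}"
  assumes "continuous_on (closed_segment a b) g"
  shows "(\<lambda>t. (b - a) *\<^sub>C g (linepath a b t)) integrable_on {0..1}"
proof (intro integrable_continuous_interval continuous_intros)
  show "continuous_on {0..1} (\<lambda>t. g (linepath a b t))"
    by (rule continuous_on_compose2[OF assms]) (auto simp: linepath_in_path)
qed

lemma segint_cong:
  assumes "\<And>\<zeta>. \<zeta> \<in> closed_segment a b \<Longrightarrow> f \<zeta> = g \<zeta>"
  shows "segint a b f = segint a b g"
  unfolding segint_def
  by (intro integral_cong arg_cong2[of _ _ _ _ scaleC] refl assms linepath_in_path)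

lemma segint_add:
  assumes "continuous_on (closed_segment a b) f" "continuous_on (closed_segment a b) g"
  shows "segint a b (\<lambda>\<zeta>. f \<zeta> + g \<zeta>) = segint a b f + segint a b g"
  unfolding segint_def scaleC_add_right by (intro integral_add segint_integrable assms)

lemma segint_linear:
  fixes L :: "'a::{complex_normed_vector,banach} \<Rightarrow> 'b::{complex_normed_vector,banach}"
  assumes "bounded_linear L" "\<And>c x. L (c *\<^sub>C x) = c *\<^sub>C L x" "continuous_on (closed_segment a b) g"
  shows "segint a b (\<lambda>\<zeta>. L (g \<zeta>)) = L (segint a b g)"
  using integral_linear[OF segint_integrable[OF assms(3)] assms(1)]
  unfolding segint_def by (simp add: o_def assms(2))

lemma segint_scaleC:
  assumes "continuous_on (closed_segment a b) g"
  shows "segint a b (\<lambda>\<zeta>. c *\<^sub>C g \<zeta>) = c *\<^sub>C segint a b g"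
  by (rule segint_linear[OF bounded_linear_scaleC _ assms]) (simp add: scaleC_scaleC mult.commute)

lemma segint_sum:
  assumes "\<And>i. i \<in> I \<Longrightarrow> continuous_on (closed_segment a b) (f i)"
  shows "segint a b (\<lambda>\<zeta>. \<Sum>i\<in>I. f i \<zeta>) = (\<Sum>i\<in>I. segint a b (f i))"
proof (cases "finite I")
  case True
  then show ?thesis unfolding segint_def scaleC.sum_right
    by (intro integral_sum segint_integrable assms)
qed (simp add: segint_def)

lemma segint_bound:
  assumes "continuous_on (closed_segment a b) g" "\<And>\<zeta>. \<zeta> \<in> closed_segment a b \<Longrightarrow> norm (g \<zeta>) \<le> M"
  shows "norm (segint a b g) \<le> norm (b - a) * M"
proof -
  have "norm (segint a b g) \<le> (norm (b - a) * M) * (1 - 0)"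
    unfolding segint_def
  proof (rule integral_bound)
    show "continuous_on {0..1} (\<lambda>t. (b - a) *\<^sub>C g (linepath a b t))"
      by (intro continuous_intros continuous_on_compose2[OF assms(1)]) (auto simp: linepath_in_path)
    show "norm ((b - a) *\<^sub>C g (linepath a b t)) \<le> norm (b - a) * M" if "t \<in> {0..1}" for t
      using that assms(2)[OF linepath_in_path[OF that]]
      by (auto simp: norm_scaleC intro!: mult_left_mono)
  qed simp
  then show ?thesis by simp
qed

lemma segint_reverse:
  assumes "continuous_on (closed_segment a b) g"
  shows "segint b a g = - segint a b g"
proof -
  have "((\<lambda>t. (b - a) *\<^sub>C g (linepath a b t)) has_integral segint a b g) (cbox 0 1)"
    unfolding segint_def using segint_integrable[OF assms] by (simp add: integrable_integral)
  moreover have "(\<lambda>x. 1 - x) ` {0..1} = {0..1::real}"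
    by (auto simp: image_iff intro: bexI[where x = "1 - x" for x])
  ultimately
  have "((\<lambda>t. (b - a) *\<^sub>C g (linepath a b (1 - t))) has_integral segint a b g) {0..1}"
    using has_integral_affinity[of "\<lambda>t. (b - a) *\<^sub>C g (linepath a b t)" "segint a b g" 0 1 "-1" 1]
    by (simp add: algebra_simps)
  from has_integral_neg[OF this]
  have "((\<lambda>t. (a - b) *\<^sub>C g (linepath b a t)) has_integral - segint a b g) {0..1}"
    by (simp add: scaleC.minus_left[symmetric] linepath_def algebra_simps)
  then show ?thesis unfolding segint_def[of b a] by (rule integral_unique)
qed

text \<open>
  Contract \<open>f\<close> towards \<open>w\<close> by the homothety with ratio \<open>s\<close>. The factor \<open>\<zeta> - w\<close> from the chain
  rule cancels the Cauchy kernel, so the derivative with respect to \<open>s\<close> is the integral of an exact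
  differential and only depends on the endpoints.
\<close>

lemma segment_cauchy_derivative:
  fixes f :: "complex \<Rightarrow> 'a::{complex_normed_vector,banach}"
  assumes f: "holo f S" "convex S" and xy: "x \<in> S" "y \<in> S" "w \<in> S" "w \<notin> closed_segment x y"
    and s: "s \<in> {0..1}"
  defines "E \<equiv> \<lambda>s. segint x y (\<lambda>\<zeta>. cderiv f (w + of_real s * (\<zeta> - w)))"
  shows "((\<lambda>s. segint x y (\<lambda>\<zeta>. (1 / (\<zeta> - w)) *\<^sub>C f (w + of_real s * (\<zeta> - w))))
            has_vector_derivative E s) (at s within {0..1})"
    and "s *\<^sub>R E s = f (w + of_real s * (y - w)) - f (w + of_real s * (x - w))"
proof -
  define p where "p s t = w + complex_of_real s * (linepath x y t - w)" for s t
  have pS: "p s t \<in> S" if "s \<in> {0..1}" "t \<in> {0..1}" for s t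
  proof -
    have "linepath x y t \<in> S"
      using linepath_in_path[OF that(2)] closed_segment_subset[OF xy(1,2) f(2)] by blast
    then have "(1 - s) *\<^sub>R w + s *\<^sub>R linepath x y t \<in> S"
      using f(2) xy(3) that(1) by (intro convexD) auto
    moreover have "(1 - s) *\<^sub>R w + s *\<^sub>R linepath x y t = p s t"
      by (simp add: p_def scaleR_conv_of_real algebra_simps)
    ultimately show ?thesis by simp
  qed
  have nz: "linepath x y t - w \<noteq> 0" if "t \<in> {0..1}" for t
    using linepath_in_path[OF that] xy(4) by auto
  have cp: "continuous_on ({0..1} \<times> {0..1}) (\<lambda>(s, t). p s t)"
    unfolding p_def linepath_def by (auto simp: case_prod_beta intro!: continuous_intros)
  have cont: "continuous_on ({0..1} \<times> {0..1}) (\<lambda>(s, t). g (p s t))" if "continuous_on S g" for g :: "complex \<Rightarrow> 'a"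
    using continuous_on_compose2[OF that cp] pS by (force simp: case_prod_beta)
  have cont1: "continuous_on {0..1} (\<lambda>t. g (p s t))" if "continuous_on S g" "s \<in> {0..1}" for s and g :: "complex \<Rightarrow> 'a"
    by (rule continuous_on_compose2[OF that(1)])
      (use pS that(2) in \<open>auto simp: p_def linepath_def intro!: continuous_intros\<close>)
  have "((\<lambda>s. integral (cbox 0 1) (\<lambda>t. (y - x) *\<^sub>C (1 / (linepath x y t - w)) *\<^sub>C f (p s t)))
     has_vector_derivative integral (cbox 0 1) (\<lambda>t. (y - x) *\<^sub>C cderiv f (p s t))) (at s within {0..1})"
  proof (rule leibniz_rule_vector_derivative)
    fix s t :: real assume st: "s \<in> {0..1}" "t \<in> cbox 0 1"
    let ?l = "linepath x y t - w"
    have "((\<lambda>s. p s t) has_derivative (\<lambda>h. complex_of_real h * ?l)) (at s within {0..1})"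
      unfolding p_def by (auto intro!: derivative_eq_intros)
    from diff_chain_within[OF this, of f "\<lambda>h. h *\<^sub>C cderiv f (p s t)"]
    have "((\<lambda>s. f (p s t)) has_derivative (\<lambda>h. (complex_of_real h * ?l) *\<^sub>C cderiv f (p s t))) (at s within {0..1})"
      using holoD(3)[OF f(1)] pS[of s t] st by (auto simp: o_def intro: has_derivative_at_withinI)
    from bounded_linear.has_derivative[OF bounded_linear_scaleC this]
    have "((\<lambda>s. ((y - x) / ?l) *\<^sub>C f (p s t)) has_derivative
       (\<lambda>h. ((y - x) / ?l) *\<^sub>C (complex_of_real h * ?l) *\<^sub>C cderiv f (p s t))) (at s within {0..1})" .
    moreover have "((y - x) / ?l) *\<^sub>C (complex_of_real h * ?l) *\<^sub>C cderiv f (p s t)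
        = h *\<^sub>R (y - x) *\<^sub>C cderiv f (p s t)" for h
      using nz[of t] st by (simp add: scaleC_scaleC scaleC_of_real[symmetric] mult.commute)
    ultimately show "((\<lambda>s. (y - x) *\<^sub>C (1 / ?l) *\<^sub>C f (p s t))
        has_vector_derivative (y - x) *\<^sub>C cderiv f (p s t)) (at s within {0..1})"
      unfolding has_vector_derivative_def by (simp add: scaleC_scaleC)
  next
    show "continuous_on ({0..1} \<times> cbox 0 1) (\<lambda>(s, t). (y - x) *\<^sub>C cderiv f (p s t))"
      using cont[OF holoD(2)[OF f(1)]] by (auto simp: case_prod_beta intro!: continuous_intros)
  next
    fix s :: real assume "s \<in> {0..1}"
    then show "(\<lambda>t. (y - x) *\<^sub>C (1 / (linepath x y t - w)) *\<^sub>C f (p s t)) integrable_on cbox 0 1"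
      unfolding box_real using nz
      by (intro integrable_continuous_interval continuous_intros cont1 holo_continuous_on[OF f(1)])
        (auto simp: linepath_def[abs_def] intro!: continuous_intros)
  qed (use s in auto)
  then show "((\<lambda>s. segint x y (\<lambda>\<zeta>. (1 / (\<zeta> - w)) *\<^sub>C f (w + of_real s * (\<zeta> - w))))
            has_vector_derivative E s) (at s within {0..1})"
    unfolding segint_def E_def p_def by simp
  have "((\<lambda>t. s *\<^sub>R (y - x) *\<^sub>C cderiv f (p s t)) has_integral f (p s 1) - f (p s 0)) {0..1}"
  proof (rule fundamental_theorem_of_calculus)
    fix t :: real assume t: "t \<in> {0..1}"
    have "((\<lambda>t. p s t) has_derivative (\<lambda>h. complex_of_real s * (h *\<^sub>R (y - x)))) (at t within {0..1})"
      unfolding p_def linepath_def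
      by (auto intro!: derivative_eq_intros simp: algebra_simps)
    from diff_chain_within[OF this, of f "\<lambda>h. h *\<^sub>C cderiv f (p s t)"]
    have "((\<lambda>t. f (p s t)) has_derivative (\<lambda>h. (complex_of_real s * (h *\<^sub>R (y - x))) *\<^sub>C cderiv f (p s t))) (at t within {0..1})"
      using holoD(3)[OF f(1)] pS[of s t] s t by (auto simp: o_def intro: has_derivative_at_withinI)
    moreover have "(complex_of_real s * (h *\<^sub>R (y - x))) *\<^sub>C cderiv f (p s t) = h *\<^sub>R s *\<^sub>R (y - x) *\<^sub>C cderiv f (p s t)" for h
      by (simp add: scaleC_scaleC scaleC_of_real[symmetric] scaleR_conv_of_real mult_ac)
    ultimately show "((\<lambda>t. f (p s t)) has_vector_derivative s *\<^sub>R (y - x) *\<^sub>C cderiv f (p s t)) (at t within {0..1})"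
      unfolding has_vector_derivative_def by simp
  qed simp
  moreover have "((\<lambda>t. s *\<^sub>R (y - x) *\<^sub>C cderiv f (p s t)) has_integral s *\<^sub>R E s) {0..1}"
    unfolding E_def segint_def p_def[symmetric] using s
    by (intro has_integral_cmul integrable_integral integrable_continuous_interval
        continuous_intros cont1 holoD(2)[OF f(1)])
  ultimately have "s *\<^sub>R E s = f (p s 1) - f (p s 0)" by (rule has_integral_unique[rotated])
  then show "s *\<^sub>R E s = f (w + of_real s * (y - w)) - f (w + of_real s * (x - w))"
    by (simp add: p_def linepath_def)
qed

definition sqint :: "complex \<Rightarrow> real \<Rightarrow> (complex \<Rightarrow> 'a::{complex_normed_vector,banach}) \<Rightarrow> 'a" where
  "sqint p d g = segint p (p + Complex d 0) g + segint (p + Complex d 0) (p + Complex d d) g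
     + segint (p + Complex d d) (p + Complex 0 d) g + segint (p + Complex 0 d) p g"

definition sqedges :: "complex \<Rightarrow> real \<Rightarrow> complex set" where
  "sqedges p d = closed_segment p (p + Complex d 0) \<union> closed_segment (p + Complex d 0) (p + Complex d d)
     \<union> closed_segment (p + Complex d d) (p + Complex 0 d) \<union> closed_segment (p + Complex 0 d) p"

lemma sqint_cong: "(\<And>\<zeta>. \<zeta> \<in> sqedges p d \<Longrightarrow> f \<zeta> = g \<zeta>) \<Longrightarrow> sqint p d f = sqint p d g"
  unfolding sqint_def sqedges_def by (intro arg_cong2[of _ _ _ _ "(+)"] segint_cong) auto

text \<open>
  The endpoint terms of the previous lemma cancel along a closed polygon. So the Cauchy integral is
  constant along the contraction, from \<open>f\<close> itself to the constant \<open>f w\<close>.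
\<close>

lemma square_cauchy_homotopy:
  fixes f :: "complex \<Rightarrow> 'a::{complex_normed_vector,banach}"
  assumes f: "holo f S" "convex S" and w: "w \<in> S" "w \<notin> sqedges p d"
    and c: "p \<in> S" "p + Complex d 0 \<in> S" "p + Complex d d \<in> S" "p + Complex 0 d \<in> S"
  shows "sqint p d (\<lambda>\<zeta>. (1 / (\<zeta> - w)) *\<^sub>C f \<zeta>) = sqint p d (\<lambda>\<zeta>. 1 / (\<zeta> - w)) *\<^sub>C f w"
proof -
  define \<psi> where "\<psi> s = sqint p d (\<lambda>\<zeta>. (1 / (\<zeta> - w)) *\<^sub>C f (w + of_real s * (\<zeta> - w)))" for s :: real
  define E where "E s = sqint p d (\<lambda>\<zeta>. cderiv f (w + complex_of_real s * (\<zeta> - w)))" for s :: real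
  have "(\<psi> has_vector_derivative E s) (at s within {0..1})" if "s \<in> {0..1}" for s
    unfolding \<psi>_def E_def sqint_def
    by (intro has_vector_derivative_add segment_cauchy_derivative(1)[OF f])
      (use w c that in \<open>auto simp: sqedges_def\<close>)
  moreover have "E s = 0" if s: "s \<in> {0..1}" for s
  proof (cases "s = 0")
    case True
    have "E s = ((p + Complex d 0 - p) + (p + Complex d d - (p + Complex d 0)) +
        (p + Complex 0 d - (p + Complex d d)) + (p - (p + Complex 0 d))) *\<^sub>C cderiv f w"
      unfolding scaleC_add_left using True by (simp add: E_def sqint_def segint_def)
    then show ?thesis by (simp only: diff_add_cancel add.commute add_diff_cancel_left' diff_add_eq)
        (simp add: complex_eq_iff)
  next
    case False
    have "s *\<^sub>R E s = 0"
      unfolding E_def sqint_def scaleR_add_right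
      by (subst (1 2 3 4) segment_cauchy_derivative(2)[OF f]) (use w c s in \<open>auto simp: sqedges_def\<close>)
    then show ?thesis using False by simp
  qed
  ultimately have "(\<psi> has_vector_derivative 0) (at s within {0..1})" if "s \<in> {0..1}" for s
    using that by metis
  then obtain k where "\<And>s. s \<in> {0..1} \<Longrightarrow> \<psi> s = k"
    using has_vector_derivative_zero_constant[of "{0..1}" \<psi>] by auto
  then have "\<psi> 1 = \<psi> 0" by simp
  moreover have "\<psi> 1 = sqint p d (\<lambda>\<zeta>. (1 / (\<zeta> - w)) *\<^sub>C f \<zeta>)" by (simp add: \<psi>_def)
  moreover have "segint a b (\<lambda>\<zeta>. (1 / (\<zeta> - w)) *\<^sub>C f w) = segint a b (\<lambda>\<zeta>. 1 / (\<zeta> - w)) *\<^sub>C f w"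
    if "closed_segment a b \<subseteq> sqedges p d" for a b
  proof (rule segint_linear)
    show "bounded_linear (\<lambda>c. c *\<^sub>C f w)" by (rule scaleC.bounded_linear_left)
    show "continuous_on (closed_segment a b) (\<lambda>\<zeta>. 1 / (\<zeta> - w))"
      using w(2) that by (intro continuous_intros) auto
  qed (simp add: scaleC_scaleC)
  then have "\<psi> 0 = sqint p d (\<lambda>\<zeta>. 1 / (\<zeta> - w)) *\<^sub>C f w"
    unfolding \<psi>_def sqint_def by (simp add: scaleC_add_left sqedges_def Un_assoc subset_eq)
  ultimately show ?thesis by simp
qed

lemma sqedges_eq:
  assumes "d > 0"
  shows "sqedges p d = cbox p (p + Complex d d) - box p (p + Complex d d)"
proof -
  have c: "Complex (Re p + d) (Im p) = p + Complex d 0" "Complex (Re p) (Im p + d) = p + Complex 0 d"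
    by (simp_all add: complex_eq_iff)
  have "path_image (rectpath p (p + Complex d d)) = sqedges p d"
    by (simp add: rectpath_def Let_def path_image_join sqedges_def Un_assoc c)
  then show ?thesis using path_image_rectpath_cbox_minus_box[of p "p + Complex d d"] assms by simp
qed

lemma sqint_inverse:
  assumes d: "d > 0" and w: "w \<in> box p (p + Complex d d)"
  shows "sqint p d (\<lambda>\<zeta>. 1 / (\<zeta> - w)) = 2 * of_real pi * \<i>"
proof -
  let ?r = "rectpath p (p + Complex d d)"
  have c: "Complex (Re p + d) (Im p) = p + Complex d 0" "Complex (Re p) (Im p + d) = p + Complex 0 d"
    by (simp_all add: complex_eq_iff)
  have nin: "w \<notin> sqedges p d" using w sqedges_eq[OF d] by auto
  have seg: "((\<lambda>\<zeta>. 1 / (\<zeta> - w)) has_contour_integral segint a b (\<lambda>\<zeta>. 1 / (\<zeta> - w))) (linepath a b)"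
    if "closed_segment a b \<subseteq> sqedges p d" for a b
  proof -
    have "continuous_on (closed_segment a b) (\<lambda>\<zeta>. 1 / (\<zeta> - w))"
      using nin that by (intro continuous_intros) auto
    from segint_integrable[OF this] show ?thesis
      unfolding has_contour_integral_linepath segint_def
      by (simp add: has_integral_integral mult.commute)
  qed
  have "((\<lambda>\<zeta>. 1 / (\<zeta> - w)) has_contour_integral sqint p d (\<lambda>\<zeta>. 1 / (\<zeta> - w))) ?r"
    unfolding rectpath_def Let_def sqint_def add.assoc using seg
    by (simp add: c) (intro has_contour_integral_join valid_path_join, auto simp: sqedges_def)
  moreover have "((\<lambda>\<zeta>. 1 / (\<zeta> - w)) has_contour_integral 2 * of_real pi * \<i> * winding_number ?r w) ?r"
    using has_contour_integral_winding_number[of ?r w] nin sqedges_eq[OF d]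
      path_image_rectpath_cbox_minus_box[of p "p + Complex d d"] d by simp
  ultimately show ?thesis
    using has_contour_integral_unique winding_number_rectpath[OF w] by fastforce
qed

lemma square_cauchy_formula:
  fixes f :: "complex \<Rightarrow> 'a::{complex_normed_vector,banach}"
  assumes "holo f S" "convex S" "d > 0" "cbox p (p + Complex d d) \<subseteq> S" "w \<in> box p (p + Complex d d)"
  shows "sqint p d (\<lambda>\<zeta>. (1 / (\<zeta> - w)) *\<^sub>C f \<zeta>) = (2 * of_real pi * \<i>) *\<^sub>C f w"
proof -
  have "w \<in> S" using assms(4,5) box_subset_cbox by blast
  moreover have "w \<notin> sqedges p d" using assms(5) sqedges_eq[OF assms(3)] by auto
  ultimately show ?thesis
    using square_cauchy_homotopy[OF assms(1,2), of w p d] sqint_inverse[OF assms(3,5)] assms(3,4)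
    by (auto simp: subset_eq in_cbox_complex_iff)
qed

text \<open>
  Cauchy's formula for \<open>(\<zeta> - w) f(\<zeta>)\<close> at the centre \<open>w\<close>, where this map vanishes.
\<close>

lemma square_cauchy_theorem:
  fixes f :: "complex \<Rightarrow> 'a::{complex_normed_vector,banach}"
  assumes "holo f S" "convex S" "d > 0" "cbox p (p + Complex d d) \<subseteq> S"
  shows "sqint p d f = 0"
proof -
  define w where "w = p + Complex (d / 2) (d / 2)"
  have w: "w \<in> box p (p + Complex d d)" using assms(3) by (simp add: w_def in_box_complex_iff)
  have "holo (\<lambda>\<zeta>. (\<zeta> - w) *\<^sub>C f \<zeta>) S"
    using assms(1) holoD(1)[OF assms(1)] by (intro holo_scaleC holo_diff holo_ident holo_const)
  from square_cauchy_formula[OF this assms(2,3,4) w]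
  have "sqint p d (\<lambda>\<zeta>. (1 / (\<zeta> - w)) *\<^sub>C (\<zeta> - w) *\<^sub>C f \<zeta>) = 0" by simp
  moreover have "sqint p d (\<lambda>\<zeta>. (1 / (\<zeta> - w)) *\<^sub>C (\<zeta> - w) *\<^sub>C f \<zeta>) = sqint p d f"
    using w sqedges_eq[OF assms(3)] by (intro sqint_cong) (auto simp: scaleC_scaleC)
  ultimately show ?thesis by simp
qed

section \<open>Taylor expansion, limits and difference quotients\<close>

text \<open>
  The geometric series of \<open>1 / (\<zeta> - w)\<close> about \<open>z\<close>, integrated term by term. The exact remainder of
  the finite geometric sum shows convergence.
\<close>

lemma cauchy_type_segment:
  fixes g :: "complex \<Rightarrow> 'a::{complex_normed_vector,banach}"
  assumes g: "continuous_on (closed_segment x y) g"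
    and M: "\<And>\<zeta>. \<zeta> \<in> closed_segment x y \<Longrightarrow> norm (g \<zeta>) \<le> M"
    and r: "r > 0" "\<And>\<zeta>. \<zeta> \<in> closed_segment x y \<Longrightarrow> r \<le> norm (\<zeta> - z)"
  obtains b where "\<And>k. norm (b k) \<le> norm (y - x) * (M / r ^ Suc k)"
    "\<And>w. w \<in> ball z r \<Longrightarrow>
       (\<lambda>k. (w - z) ^ k *\<^sub>C b k) sums segint x y (\<lambda>\<zeta>. (1 / (\<zeta> - w)) *\<^sub>C g \<zeta>)"
proof
  define b where "b k = segint x y (\<lambda>\<zeta>. (1 / (\<zeta> - z) ^ Suc k) *\<^sub>C g \<zeta>)" for k
  have nz: "\<zeta> - z \<noteq> 0" if "\<zeta> \<in> closed_segment x y" for \<zeta> using r(1) r(2)[OF that] by auto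
  have M0: "M \<ge> 0" using M[of x] by (meson ends_in_segment(1) norm_ge_zero order_trans)
  have cont: "continuous_on (closed_segment x y) (\<lambda>\<zeta>. (1 / (\<zeta> - z) ^ Suc k) *\<^sub>C g \<zeta>)" for k
    using nz by (intro continuous_intros g) auto
  show "norm (b k) \<le> norm (y - x) * (M / r ^ Suc k)" for k
    unfolding b_def
  proof (rule segint_bound[OF cont])
    fix \<zeta> assume \<zeta>: "\<zeta> \<in> closed_segment x y"
    have "norm ((1 / (\<zeta> - z) ^ Suc k) *\<^sub>C g \<zeta>) = norm (g \<zeta>) / norm (\<zeta> - z) ^ Suc k"
      by (simp add: norm_scaleC norm_divide norm_power norm_mult)
    also have "\<dots> \<le> M / r ^ Suc k"
      using M0 M[OF \<zeta>] r(2)[OF \<zeta>] r(1) by (intro frac_le power_mono) auto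
    finally show "norm ((1 / (\<zeta> - z) ^ Suc k) *\<^sub>C g \<zeta>) \<le> M / r ^ Suc k" .
  qed
  fix w assume w: "w \<in> ball z r"
  let ?q = "norm (w - z) / r"
  have q: "0 \<le> ?q" "?q < 1" and rw: "0 < r - norm (w - z)"
    using w r(1) by (auto simp: dist_norm norm_minus_commute)
  have far: "r - norm (w - z) \<le> norm (\<zeta> - w)" if "\<zeta> \<in> closed_segment x y" for \<zeta>
    using r(2)[OF that] norm_triangle_ineq[of "\<zeta> - w" "w - z"] by simp
  then have nzw: "\<zeta> - w \<noteq> 0" if "\<zeta> \<in> closed_segment x y" for \<zeta> using rw that by fastforce
  have rest: "norm (segint x y (\<lambda>\<zeta>. (1 / (\<zeta> - w)) *\<^sub>C g \<zeta>) - (\<Sum>k<n. (w - z) ^ k *\<^sub>C b k))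
      \<le> norm (y - x) * (?q ^ n * (M / (r - norm (w - z))))" for n
  proof -
    let ?R = "\<lambda>\<zeta>. (((w - z) / (\<zeta> - z)) ^ n / (\<zeta> - w)) *\<^sub>C g \<zeta>"
    have cR: "continuous_on (closed_segment x y) ?R"
      using nz nzw by (intro continuous_intros g) auto
    have geo: "1 / (\<zeta> - w) = (\<Sum>k<n. (w - z) ^ k / (\<zeta> - z) ^ Suc k) + ((w - z) / (\<zeta> - z)) ^ n / (\<zeta> - w)"
      if "\<zeta> \<in> closed_segment x y" for \<zeta>
    proof (induction n)
      case (Suc n)
      have "((w - z) / (\<zeta> - z)) ^ n / (\<zeta> - w) =
          (w - z) ^ n / (\<zeta> - z) ^ Suc n + ((w - z) / (\<zeta> - z)) ^ Suc n / (\<zeta> - w)"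
        using nz[OF that] nzw[OF that] by (simp add: divide_simps) (simp add: algebra_simps)
      then show ?case using Suc by simp
    qed simp
    have "segint x y (\<lambda>\<zeta>. (1 / (\<zeta> - w)) *\<^sub>C g \<zeta>)
        = segint x y (\<lambda>\<zeta>. (\<Sum>k<n. (w - z) ^ k *\<^sub>C (1 / (\<zeta> - z) ^ Suc k) *\<^sub>C g \<zeta>) + ?R \<zeta>)"
      by (rule segint_cong, subst geo)
        (auto simp: scaleC_add_left scaleC.sum_left scaleC_scaleC simp del: power_Suc)
    also have "\<dots> = (\<Sum>k<n. (w - z) ^ k *\<^sub>C b k) + segint x y ?R"
    proof -
      have c1: "continuous_on (closed_segment x y) (\<lambda>\<zeta>. (w - z) ^ k *\<^sub>C (1 / (\<zeta> - z) ^ Suc k) *\<^sub>C g \<zeta>)" for k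
        by (rule continuous_on_scaleC[OF continuous_on_const cont])
      show ?thesis
        by (subst segint_add[OF continuous_on_sum[OF c1] cR], subst segint_sum[OF c1],
            subst segint_scaleC[OF cont]) (simp add: b_def)
    qed
    finally have "segint x y (\<lambda>\<zeta>. (1 / (\<zeta> - w)) *\<^sub>C g \<zeta>) - (\<Sum>k<n. (w - z) ^ k *\<^sub>C b k) = segint x y ?R"
      by simp
    moreover have "norm (segint x y ?R) \<le> norm (y - x) * (?q ^ n * (M / (r - norm (w - z))))"
    proof (rule segint_bound[OF cR])
      fix \<zeta> assume \<zeta>: "\<zeta> \<in> closed_segment x y"
      have "norm (?R \<zeta>) = (norm (w - z) / norm (\<zeta> - z)) ^ n * (norm (g \<zeta>) / norm (\<zeta> - w))"
        by (simp add: norm_scaleC norm_divide norm_power norm_mult)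
      also have "\<dots> \<le> ?q ^ n * (M / (r - norm (w - z)))"
        using M0 M[OF \<zeta>] r(2)[OF \<zeta>] r(1) far[OF \<zeta>] rw
        by (intro mult_mono power_mono frac_le divide_left_mono mult_pos_pos) auto
      finally show "norm (?R \<zeta>) \<le> ?q ^ n * (M / (r - norm (w - z)))" .
    qed
    ultimately show ?thesis by simp
  qed
  have "(\<lambda>n. norm (y - x) * (?q ^ n * (M / (r - norm (w - z))))) \<longlonglongrightarrow> norm (y - x) * (0 * (M / (r - norm (w - z))))"
    using q by (intro tendsto_intros LIMSEQ_power_zero) auto
  then have "(\<lambda>n. segint x y (\<lambda>\<zeta>. (1 / (\<zeta> - w)) *\<^sub>C g \<zeta>) - (\<Sum>k<n. (w - z) ^ k *\<^sub>C b k)) \<longlonglongrightarrow> 0"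
    by (intro Lim_null_comparison[OF always_eventually[OF allI[OF rest]]]) simp
  from tendsto_diff[OF tendsto_const[of "segint x y (\<lambda>\<zeta>. (1 / (\<zeta> - w)) *\<^sub>C g \<zeta>)"] this]
  show "(\<lambda>k. (w - z) ^ k *\<^sub>C b k) sums segint x y (\<lambda>\<zeta>. (1 / (\<zeta> - w)) *\<^sub>C g \<zeta>)"
    by (simp add: sums_def)
qed

lemma continuous_on_segment_bound:
  fixes g :: "complex \<Rightarrow> 'a::real_normed_vector"
  assumes "continuous_on (closed_segment x y) g"
  obtains M where "\<And>\<zeta>. \<zeta> \<in> closed_segment x y \<Longrightarrow> norm (g \<zeta>) \<le> M"
proof -
  from compact_imp_bounded[OF compact_continuous_image[OF assms compact_segment]]
  obtain M where "\<forall>u\<in>g ` closed_segment x y. norm u \<le> M" unfolding bounded_iff by blast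
  then show ?thesis using that by blast
qed

lemma cauchy_type_holo:
  fixes g :: "complex \<Rightarrow> 'a::{complex_normed_vector,banach}"
  assumes g: "continuous_on (closed_segment x y) g"
  shows "holo (\<lambda>w. segint x y (\<lambda>\<zeta>. (1 / (\<zeta> - w)) *\<^sub>C g \<zeta>)) (- closed_segment x y)"
proof (rule holo_local)
  fix z assume "z \<in> - closed_segment x y"
  then obtain r where r: "r > 0" "ball z r \<subseteq> - closed_segment x y"
    using open_contains_ball[of "- closed_segment x y"] by (auto simp: open_Compl)
  obtain M where M: "\<And>\<zeta>. \<zeta> \<in> closed_segment x y \<Longrightarrow> norm (g \<zeta>) \<le> M"
    using continuous_on_segment_bound[OF g] by blast
  have far: "r \<le> norm (\<zeta> - z)" if "\<zeta> \<in> closed_segment x y" for \<zeta>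
    using r(2) that by (force simp: dist_norm norm_minus_commute subset_eq)
  obtain b where b: "\<And>w. w \<in> ball z r \<Longrightarrow>
      (\<lambda>k. (w - z) ^ k *\<^sub>C b k) sums segint x y (\<lambda>\<zeta>. (1 / (\<zeta> - w)) *\<^sub>C g \<zeta>)"
    using cauchy_type_segment[OF g M r(1) far] by metis
  show "\<exists>T. z \<in> T \<and> T \<subseteq> - closed_segment x y \<and>
      holo (\<lambda>w. segint x y (\<lambda>\<zeta>. (1 / (\<zeta> - w)) *\<^sub>C g \<zeta>)) T"
    using power_series_holo[OF b] r by (intro exI[of _ "ball z r"]) auto
qed

lemma centred_square:
  fixes z :: complex
  assumes "r > 0"
  defines "p \<equiv> z - Complex r r"
  shows "cbox p (p + Complex (2 * r) (2 * r)) \<subseteq> ball z (2 * r)"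
    and "ball z r \<subseteq> box p (p + Complex (2 * r) (2 * r))"
    and "\<zeta> \<in> sqedges p (2 * r) \<Longrightarrow> r \<le> norm (\<zeta> - z)"
proof -
  show "cbox p (p + Complex (2 * r) (2 * r)) \<subseteq> ball z (2 * r)"
  proof
    fix x assume "x \<in> cbox p (p + Complex (2 * r) (2 * r))"
    then have b: "\<bar>Re (x - z)\<bar> \<le> r" "\<bar>Im (x - z)\<bar> \<le> r" by (auto simp: in_cbox_complex_iff p_def)
    then have "(Re (x - z))\<^sup>2 + (Im (x - z))\<^sup>2 \<le> r\<^sup>2 + r\<^sup>2"
      by (intro add_mono) (metis assms(1) abs_le_square_iff abs_of_pos)+
    also have "\<dots> < (2 * r)\<^sup>2" using assms(1) by (simp add: power2_eq_square)
    finally have "norm (x - z) < 2 * r"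
      using assms(1) unfolding cmod_def by (intro real_less_lsqrt) auto
    then show "x \<in> ball z (2 * r)" by (simp add: dist_norm norm_minus_commute)
  qed
  show sub: "ball z r \<subseteq> box p (p + Complex (2 * r) (2 * r))"
  proof
    fix x assume "x \<in> ball z r"
    then have "norm (x - z) < r" by (simp add: dist_norm norm_minus_commute)
    then show "x \<in> box p (p + Complex (2 * r) (2 * r))"
      using abs_Re_le_cmod[of "x - z"] abs_Im_le_cmod[of "x - z"]
      by (auto simp: in_box_complex_iff p_def)
  qed
  assume "\<zeta> \<in> sqedges p (2 * r)"
  then have "\<zeta> \<notin> ball z r" using sub sqedges_eq[of "2 * r" p] assms(1) by auto
  then show "r \<le> norm (\<zeta> - z)" by (simp add: dist_norm norm_minus_commute)
qed

text \<open>
  Expanding the kernel \<open>1 / (\<zeta> - w)\<close> on the boundary of the square of half side \<open>r\<close> gives a power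
  series on the inscribed disc, with Cauchy estimates up to a factor.
\<close>

lemma cauchy_type_square:
  fixes g :: "complex \<Rightarrow> 'a::{complex_normed_vector,banach}"
  assumes r: "r > 0" and p: "p = z - Complex r r" and g: "continuous_on (sqedges p (2 * r)) g"
    and M: "\<And>\<zeta>. \<zeta> \<in> sqedges p (2 * r) \<Longrightarrow> norm (g \<zeta>) \<le> M"
  shows "\<exists>a. (\<forall>k. norm (a k) \<le> 2 * M / r ^ k) \<and>
    (\<forall>w\<in>ball z r. (\<lambda>k. (w - z) ^ k *\<^sub>C a k) sums
       ((1 / (2 * of_real pi * \<i>)) *\<^sub>C sqint p (2 * r) (\<lambda>\<zeta>. (1 / (\<zeta> - w)) *\<^sub>C g \<zeta>)))"
proof -
  have seg: "\<exists>b. (\<forall>k. norm (b k) \<le> 2 * r * (M / r ^ Suc k)) \<and> (\<forall>w\<in>ball z r.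
       (\<lambda>k. (w - z) ^ k *\<^sub>C b k) sums segint x y (\<lambda>\<zeta>. (1 / (\<zeta> - w)) *\<^sub>C g \<zeta>))"
    if "closed_segment x y \<subseteq> sqedges p (2 * r)" "norm (y - x) = 2 * r" for x y
  proof -
    have "r \<le> norm (\<zeta> - z)" if "\<zeta> \<in> closed_segment x y" for \<zeta>
      using centred_square(3)[OF r, of \<zeta> z] that p \<open>closed_segment x y \<subseteq> sqedges p (2 * r)\<close> by blast
    from cauchy_type_segment[OF continuous_on_subset[OF g that(1)] M r this] that
    show ?thesis by (metis subsetD)
  qed
  let ?a = "p" and ?b = "p + Complex (2 * r) 0" and ?c = "p + Complex (2 * r) (2 * r)" and ?d = "p + Complex 0 (2 * r)"
  have e: "closed_segment ?a ?b \<subseteq> sqedges p (2 * r)" "closed_segment ?b ?c \<subseteq> sqedges p (2 * r)"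
    "closed_segment ?c ?d \<subseteq> sqedges p (2 * r)" "closed_segment ?d ?a \<subseteq> sqedges p (2 * r)"
    unfolding sqedges_def by blast+
  have nn: "norm (?b - ?a) = 2 * r" "norm (?c - ?b) = 2 * r" "norm (?d - ?c) = 2 * r" "norm (?a - ?d) = 2 * r"
    using r by (simp_all add: cmod_def real_sqrt_mult)
  obtain b1 where b1: "\<And>k. norm (b1 k) \<le> 2 * r * (M / r ^ Suc k)"
    "\<And>w. w \<in> ball z r \<Longrightarrow> (\<lambda>k. (w - z) ^ k *\<^sub>C b1 k) sums segint ?a ?b (\<lambda>\<zeta>. (1 / (\<zeta> - w)) *\<^sub>C g \<zeta>)"
    using seg[OF e(1) nn(1)] by blast
  obtain b2 where b2: "\<And>k. norm (b2 k) \<le> 2 * r * (M / r ^ Suc k)"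
    "\<And>w. w \<in> ball z r \<Longrightarrow> (\<lambda>k. (w - z) ^ k *\<^sub>C b2 k) sums segint ?b ?c (\<lambda>\<zeta>. (1 / (\<zeta> - w)) *\<^sub>C g \<zeta>)"
    using seg[OF e(2) nn(2)] by blast
  obtain b3 where b3: "\<And>k. norm (b3 k) \<le> 2 * r * (M / r ^ Suc k)"
    "\<And>w. w \<in> ball z r \<Longrightarrow> (\<lambda>k. (w - z) ^ k *\<^sub>C b3 k) sums segint ?c ?d (\<lambda>\<zeta>. (1 / (\<zeta> - w)) *\<^sub>C g \<zeta>)"
    using seg[OF e(3) nn(3)] by blast
  obtain b4 where b4: "\<And>k. norm (b4 k) \<le> 2 * r * (M / r ^ Suc k)"
    "\<And>w. w \<in> ball z r \<Longrightarrow> (\<lambda>k. (w - z) ^ k *\<^sub>C b4 k) sums segint ?d ?a (\<lambda>\<zeta>. (1 / (\<zeta> - w)) *\<^sub>C g \<zeta>)"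
    using seg[OF e(4) nn(4)] by blast
  note b = b1(1) b2(1) b3(1) b4(1) and s = b1(2) b2(2) b3(2) b4(2)
  define a where "a k = (1 / (2 * of_real pi * \<i>)) *\<^sub>C (b1 k + b2 k + b3 k + b4 k)" for k
  show ?thesis
  proof (intro exI[of _ a] conjI allI ballI)
    fix k
    have "norm (a k) = (1 / (2 * pi)) * norm (b1 k + b2 k + b3 k + b4 k)"
      by (simp add: a_def norm_scaleC norm_divide norm_mult)
    also have "\<dots> \<le> (1 / 4) * (4 * (2 * r * (M / r ^ Suc k)))"
    proof (rule mult_mono)
      have "norm (b1 k + b2 k + b3 k + b4 k) \<le> norm (b1 k) + norm (b2 k) + norm (b3 k) + norm (b4 k)"
        by (meson add_right_mono norm_triangle_ineq order_trans)
      also have "\<dots> \<le> 2 * r * (M / r ^ Suc k) + 2 * r * (M / r ^ Suc k)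
          + 2 * r * (M / r ^ Suc k) + 2 * r * (M / r ^ Suc k)"
        by (intro add_mono b)
      finally show "norm (b1 k + b2 k + b3 k + b4 k) \<le> 4 * (2 * r * (M / r ^ Suc k))" by simp
    qed (use pi_gt3 in \<open>auto simp: field_simps\<close>)
    also have "\<dots> = 2 * M / r ^ k" using r by simp
    finally show "norm (a k) \<le> 2 * M / r ^ k" .
  next
    fix w assume w: "w \<in> ball z r"
    have "(\<lambda>k. (w - z) ^ k *\<^sub>C (b1 k + b2 k + b3 k + b4 k)) sums sqint p (2 * r) (\<lambda>\<zeta>. (1 / (\<zeta> - w)) *\<^sub>C g \<zeta>)"
      unfolding sqint_def scaleC_add_right by (intro sums_add s w)
    from bounded_linear.sums[OF bounded_linear_scaleC[of "1 / (2 * of_real pi * \<i>)"] this]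
    show "(\<lambda>k. (w - z) ^ k *\<^sub>C a k) sums
       ((1 / (2 * of_real pi * \<i>)) *\<^sub>C sqint p (2 * r) (\<lambda>\<zeta>. (1 / (\<zeta> - w)) *\<^sub>C g \<zeta>))"
      by (simp only: a_def scaleC_scaleC mult.commute)
  qed
qed

lemma cauchy_centred_square:
  fixes f :: "complex \<Rightarrow> 'a::{complex_normed_vector,banach}"
  assumes "holo f (ball z R)" "r > 0" "2 * r \<le> R" "w \<in> ball z r" and p: "p = z - Complex r r"
  shows "(1 / (2 * of_real pi * \<i>)) *\<^sub>C sqint p (2 * r) (\<lambda>\<zeta>. (1 / (\<zeta> - w)) *\<^sub>C f \<zeta>) = f w"
proof -
  have "cbox p (p + Complex (2 * r) (2 * r)) \<subseteq> ball z R" "w \<in> box p (p + Complex (2 * r) (2 * r))"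
    using centred_square(1,2)[OF assms(2), of z] assms(3,4) p by auto
  then have "sqint p (2 * r) (\<lambda>\<zeta>. (1 / (\<zeta> - w)) *\<^sub>C f \<zeta>) = (2 * of_real pi * \<i>) *\<^sub>C f w"
    using square_cauchy_formula[OF assms(1), of "2 * r" p w] assms(2) by simp
  then show ?thesis by (simp add: scaleC_scaleC)
qed

lemma sqedges_centred_subset:
  assumes "r > 0" "2 * r \<le> R"
  shows "sqedges (z - Complex r r) (2 * r) \<subseteq> ball z R"
  using centred_square(1)[OF assms(1), of z] sqedges_eq[of "2 * r" "z - Complex r r"] assms by auto

lemma taylor:
  fixes f :: "complex \<Rightarrow> 'a::{complex_normed_vector,banach}"
  assumes f: "holo f (ball z R)" and r: "r > 0" "2 * r \<le> R"
    and M: "\<And>\<zeta>. \<zeta> \<in> ball z R \<Longrightarrow> norm (f \<zeta>) \<le> M"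
  shows "\<exists>a. (\<forall>k. norm (a k) \<le> 2 * M / r ^ k) \<and>
    (\<forall>w\<in>ball z r. (\<lambda>k. (w - z) ^ k *\<^sub>C a k) sums f w)"
proof -
  define p where "p = z - Complex r r"
  note sub = sqedges_centred_subset[OF r, of z, folded p_def]
  have "continuous_on (sqedges p (2 * r)) f"
    using holo_continuous_on[OF f] continuous_on_subset sub by blast
  from cauchy_type_square[OF r(1) p_def this, of M]
  have "\<exists>a. (\<forall>k. norm (a k) \<le> 2 * M / r ^ k) \<and> (\<forall>w\<in>ball z r. (\<lambda>k. (w - z) ^ k *\<^sub>C a k) sums
       ((1 / (2 * of_real pi * \<i>)) *\<^sub>C sqint p (2 * r) (\<lambda>\<zeta>. (1 / (\<zeta> - w)) *\<^sub>C f \<zeta>)))"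
    using M sub by blast
  then show ?thesis using cauchy_centred_square[OF f r _ p_def] by (simp only: cong: ball_cong)
qed

lemma holo_bounded_smaller_ball:
  fixes f :: "complex \<Rightarrow> 'a::{complex_normed_vector,banach}"
  assumes "holo f S" "cball z R \<subseteq> S"
  obtains M where "M > 0" "\<And>\<zeta>. \<zeta> \<in> cball z R \<Longrightarrow> norm (f \<zeta>) \<le> M"
proof -
  have "continuous_on (cball z R) f" using continuous_on_subset[OF holo_continuous_on[OF assms(1)] assms(2)] .
  from compact_imp_bounded[OF compact_continuous_image[OF this compact_cball]]
  obtain M where "M > 0" "\<forall>u\<in>f ` cball z R. norm u \<le> M" unfolding bounded_pos by blast
  then show ?thesis using that by blast
qed

lemma holo_imp_banach_analytic_on:
  fixes f :: "complex \<Rightarrow> 'a::{complex_normed_vector,banach}"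
  assumes "holo f S"
  shows "banach_analytic_on f S"
  unfolding banach_analytic_on_def
proof
  fix z assume "z \<in> S"
  then obtain R where R: "R > 0" "cball z R \<subseteq> S" using holoD(1)[OF assms] by (meson open_contains_cball)
  obtain M where M: "\<And>\<zeta>. \<zeta> \<in> cball z R \<Longrightarrow> norm (f \<zeta>) \<le> M"
    using holo_bounded_smaller_ball[OF assms R(2)] by blast
  have "holo f (ball z R)" by (rule holo_subset[OF assms]) (use R in auto)
  then have "\<exists>a. (\<forall>k. norm (a k) \<le> 2 * M / (R / 2) ^ k) \<and>
      (\<forall>w\<in>ball z (R / 2). (\<lambda>k. (w - z) ^ k *\<^sub>C a k) sums f w)"
    by (rule taylor) (use R M in auto)
  then show "\<exists>r>0. \<exists>c. \<forall>w\<in>ball z r. (\<lambda>k. (w - z) ^ k *\<^sub>C c k) sums f w"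
    using R(1) half_gt_zero by blast
qed

text \<open>
  Cauchy's formula on a small square survives the limit, and represents \<open>g\<close> as a Cauchy integral,
  which has a power series.
\<close>

lemma holo_uniform_limit:
  fixes f :: "nat \<Rightarrow> complex \<Rightarrow> 'a::{complex_normed_vector,banach}"
  assumes f: "\<And>n. holo (f n) S" and ul: "uniform_limit S f g sequentially"
  shows "holo g S"
proof (rule holo_local)
  fix z assume "z \<in> S"
  then obtain R where R: "R > 0" "cball z R \<subseteq> S" using holoD(1)[OF f[of 0]] by (meson open_contains_cball)
  define r where "r = R / 2"
  define p where "p = z - Complex r r"
  have r: "r > 0" "2 * r \<le> R" using R by (auto simp: r_def)
  have sub: "sqedges p (2 * r) \<subseteq> S"
    using sqedges_centred_subset[OF r, of z] R(2) ball_subset_cball[of z R] unfolding p_def by blast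
  have cg: "continuous_on S g"
    by (rule uniform_limit_theorem[OF _ ul]) (auto intro: always_eventually holo_continuous_on f)
  have "compact (sqedges p (2 * r))" unfolding sqedges_def by (intro compact_Un compact_segment)
  from compact_imp_bounded[OF compact_continuous_image[OF continuous_on_subset[OF cg sub] this]]
  obtain M where M: "\<And>\<zeta>. \<zeta> \<in> sqedges p (2 * r) \<Longrightarrow> norm (g \<zeta>) \<le> M" unfolding bounded_iff by auto
  obtain a where a: "\<And>w. w \<in> ball z r \<Longrightarrow> (\<lambda>k. (w - z) ^ k *\<^sub>C a k) sums
       ((1 / (2 * of_real pi * \<i>)) *\<^sub>C sqint p (2 * r) (\<lambda>\<zeta>. (1 / (\<zeta> - w)) *\<^sub>C g \<zeta>))"
    using cauchy_type_square[OF r(1) p_def continuous_on_subset[OF cg sub] M] by blast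
  have "(1 / (2 * of_real pi * \<i>)) *\<^sub>C sqint p (2 * r) (\<lambda>\<zeta>. (1 / (\<zeta> - w)) *\<^sub>C g \<zeta>) = g w"
    if w: "w \<in> ball z r" for w
  proof (rule LIMSEQ_unique)
    have nw: "w \<notin> sqedges p (2 * r)"
    proof
      assume "w \<in> sqedges p (2 * r)"
      from centred_square(3)[OF r(1) this[unfolded p_def]] w show False
        by (simp add: dist_norm norm_minus_commute)
    qed
    have seg: "(\<lambda>n. segint x y (\<lambda>\<zeta>. (1 / (\<zeta> - w)) *\<^sub>C f n \<zeta>)) \<longlonglongrightarrow>
        segint x y (\<lambda>\<zeta>. (1 / (\<zeta> - w)) *\<^sub>C g \<zeta>)" if xy: "closed_segment x y \<subseteq> sqedges p (2 * r)" for x y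
    proof -
      have cs: "continuous_on (closed_segment x y) (\<lambda>\<zeta>. 1 / (\<zeta> - w))"
        using nw xy by (intro continuous_intros) auto
      obtain B where B: "\<And>\<zeta>. \<zeta> \<in> closed_segment x y \<Longrightarrow> norm (1 / (\<zeta> - w)) \<le> B"
        using continuous_on_segment_bound[OF cs] by blast
      have xyS: "closed_segment x y \<subseteq> S" using xy sub by blast
      have c: "continuous_on (closed_segment x y) (\<lambda>\<zeta>. (1 / (\<zeta> - w)) *\<^sub>C h \<zeta>)"
        if "continuous_on S h" for h :: "complex \<Rightarrow> 'a"
        by (rule continuous_on_scaleC[OF cs continuous_on_subset[OF that xyS]])
      have B0: "B \<ge> 0" using B[of x] by (meson ends_in_segment(1) norm_ge_zero order_trans)
      show ?thesis
      proof (rule LIMSEQ_I)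
        fix e :: real assume e: "e > 0"
        define e' where "e' = e / (norm (y - x) * B + 1)"
        have pos: "norm (y - x) * B + 1 > 0" using B0 by (simp add: add_nonneg_pos)
        then have e': "e' > 0" using e by (simp add: e'_def)
        obtain N where N: "\<And>n \<zeta>. n \<ge> N \<Longrightarrow> \<zeta> \<in> S \<Longrightarrow> norm (f n \<zeta> - g \<zeta>) \<le> e'"
          using uniform_limitD[OF ul e'] unfolding eventually_sequentially dist_norm
          by (meson less_imp_le)
        have "norm (segint x y (\<lambda>\<zeta>. (1 / (\<zeta> - w)) *\<^sub>C f n \<zeta>) - segint x y (\<lambda>\<zeta>. (1 / (\<zeta> - w)) *\<^sub>C g \<zeta>)) < e"
          if "n \<ge> N" for n
        proof -
          have cd: "continuous_on S (\<lambda>\<zeta>. f n \<zeta> - g \<zeta>)"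
            by (rule continuous_on_diff[OF holo_continuous_on[OF f] cg])
          have "segint x y (\<lambda>\<zeta>. (1 / (\<zeta> - w)) *\<^sub>C f n \<zeta>)
              = segint x y (\<lambda>\<zeta>. (1 / (\<zeta> - w)) *\<^sub>C (f n \<zeta> - g \<zeta>) + (1 / (\<zeta> - w)) *\<^sub>C g \<zeta>)"
            by (simp only: scaleC_add_right[symmetric] diff_add_cancel)
          also have "\<dots> = segint x y (\<lambda>\<zeta>. (1 / (\<zeta> - w)) *\<^sub>C (f n \<zeta> - g \<zeta>))
              + segint x y (\<lambda>\<zeta>. (1 / (\<zeta> - w)) *\<^sub>C g \<zeta>)"
            by (rule segint_add[OF c[OF cd] c[OF cg]])
          finally have "segint x y (\<lambda>\<zeta>. (1 / (\<zeta> - w)) *\<^sub>C f n \<zeta>) - segint x y (\<lambda>\<zeta>. (1 / (\<zeta> - w)) *\<^sub>C g \<zeta>)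
              = segint x y (\<lambda>\<zeta>. (1 / (\<zeta> - w)) *\<^sub>C (f n \<zeta> - g \<zeta>))" by simp
          also have "norm \<dots> \<le> norm (y - x) * (B * e')"
          proof (rule segint_bound[OF c[OF cd]])
            fix \<zeta> assume \<zeta>: "\<zeta> \<in> closed_segment x y"
            then have "\<zeta> \<in> S" using xyS by blast
            then show "norm ((1 / (\<zeta> - w)) *\<^sub>C (f n \<zeta> - g \<zeta>)) \<le> B * e'"
              unfolding norm_scaleC by (intro mult_mono B[OF \<zeta>] N[OF that] B0 norm_ge_zero)
          qed
          also have "\<dots> < (norm (y - x) * B + 1) * e'" using e' by (simp add: algebra_simps)
          also have "\<dots> = e" using pos by (simp add: e'_def)
          finally show ?thesis .
        qed
        then show "\<exists>N. \<forall>n\<ge>N. norm (segint x y (\<lambda>\<zeta>. (1 / (\<zeta> - w)) *\<^sub>C f n \<zeta>)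
            - segint x y (\<lambda>\<zeta>. (1 / (\<zeta> - w)) *\<^sub>C g \<zeta>)) < e" by blast
      qed
    qed
    show "(\<lambda>n. (1 / (2 * of_real pi * \<i>)) *\<^sub>C sqint p (2 * r) (\<lambda>\<zeta>. (1 / (\<zeta> - w)) *\<^sub>C f n \<zeta>))
      \<longlonglongrightarrow> (1 / (2 * of_real pi * \<i>)) *\<^sub>C sqint p (2 * r) (\<lambda>\<zeta>. (1 / (\<zeta> - w)) *\<^sub>C g \<zeta>)"
      unfolding sqint_def by (intro scaleC.tendsto tendsto_add tendsto_const seg) (auto simp: sqedges_def)
    have "w \<in> cball z R" using w r by simp
    then have "w \<in> S" using R(2) by blast
    have "holo (f n) (ball z R)" for n by (rule holo_subset[OF f]) (use R in auto)
    from cauchy_centred_square[OF this r w p_def]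
    have "(1 / (2 * of_real pi * \<i>)) *\<^sub>C sqint p (2 * r) (\<lambda>\<zeta>. (1 / (\<zeta> - w)) *\<^sub>C f n \<zeta>) = f n w" for n .
    then
    show "(\<lambda>n. (1 / (2 * of_real pi * \<i>)) *\<^sub>C sqint p (2 * r) (\<lambda>\<zeta>. (1 / (\<zeta> - w)) *\<^sub>C f n \<zeta>)) \<longlonglongrightarrow> g w"
      using tendsto_uniform_limitI[OF ul \<open>w \<in> S\<close>] by (simp only:)
  qed
  then have "(\<lambda>k. (w - z) ^ k *\<^sub>C a k) sums g w" if "w \<in> ball z r" for w using a[OF that] that by simp
  then have "holo g (ball z r)" by (rule power_series_holo)
  then show "\<exists>T. z \<in> T \<and> T \<subseteq> S \<and> holo g T" using r R by (intro exI[of _ "ball z r"]) auto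
qed

lemma tail_power_series:
  fixes a :: "nat \<Rightarrow> 'a::{complex_normed_vector,banach}"
  assumes s: "\<And>w. w \<in> ball z r \<Longrightarrow> (\<lambda>k. (w - z) ^ k *\<^sub>C a k) sums f w" and r: "r > 0"
  shows "a 0 = f z" "cderiv f z = a 1"
    "\<And>w. w \<in> ball z r \<Longrightarrow> (\<lambda>k. (w - z) ^ k *\<^sub>C a (Suc k)) sums (if w = z then a 1 else (1 / (w - z)) *\<^sub>C (f w - f z))"
proof -
  have z0: "(\<lambda>k. (z - z) ^ k *\<^sub>C b k) sums b 0" for b :: "nat \<Rightarrow> 'a"
  proof -
    have "(\<lambda>k. (z - z) ^ k *\<^sub>C b k) = (\<lambda>k. if k = 0 then b 0 else 0)" by (auto simp: fun_eq_iff power_0_left)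
    then show ?thesis using sums_single[of 0 "\<lambda>_. b 0"] by simp
  qed
  show a0: "a 0 = f z" using sums_unique2[OF z0 s[of z]] r by simp
  define F where "F w = (if w = z then a 1 else (1 / (w - z)) *\<^sub>C (f w - f z))" for w
  have F: "(\<lambda>k. (w - z) ^ k *\<^sub>C a (Suc k)) sums F w" if w: "w \<in> ball z r" for w
  proof (cases "w = z")
    case True
    then show ?thesis using z0[of "\<lambda>k. a (Suc k)"] by (simp add: F_def)
  next
    case False
    have "(\<lambda>k. (w - z) ^ Suc k *\<^sub>C a (Suc k)) sums (f w - f z)"
      using s[OF w] a0 sums_split_initial_segment[of "\<lambda>k. (w - z) ^ k *\<^sub>C a k" "f w" 1] by simp
    from bounded_linear.sums[OF bounded_linear_scaleC this, of "1 / (w - z)"]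
    show ?thesis using False by (simp add: F_def scaleC_scaleC)
  qed
  then show "(\<lambda>k. (w - z) ^ k *\<^sub>C a (Suc k)) sums (if w = z then a 1 else (1 / (w - z)) *\<^sub>C (f w - f z))"
    if "w \<in> ball z r" for w using that by (simp add: F_def)
  have "holo F (ball z r)" by (rule power_series_holo[OF F])
  from holoD(3)[OF this, of z] have "has_cderiv F (cderiv F z) z" using r by simp
  moreover have "((\<lambda>w. w - z) has_derivative (\<lambda>h. h)) (at z)" by (auto intro!: derivative_eq_intros)
  ultimately have "((\<lambda>w. (w - z) *\<^sub>C F w) has_derivative (\<lambda>h. (z - z) *\<^sub>C h *\<^sub>C cderiv F z + h *\<^sub>C F z)) (at z)"
    by (intro scaleC.FDERIV)
  from has_derivative_add[OF has_derivative_const[of "f z"] this]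
  have "((\<lambda>w. f z + (w - z) *\<^sub>C F w) has_derivative (\<lambda>h. h *\<^sub>C a 1)) (at z)"
    by (simp add: F_def)
  then have "has_cderiv f (a 1) z"
  proof (rule has_derivative_transform_within_open[OF _ open_UNIV UNIV_I])
    show "f z + (w - z) *\<^sub>C F w = f w" for w by (simp add: F_def scaleC_scaleC)
  qed
  then show "cderiv f z = a 1" by (rule cderiv_eq)
qed

definition slope :: "(complex \<Rightarrow> 'a::complex_normed_vector) \<Rightarrow> complex \<Rightarrow> complex \<Rightarrow> 'a" where
  "slope g \<kappa> \<mu> = (if \<mu> = \<kappa> then cderiv g \<kappa> else (1 / (\<mu> - \<kappa>)) *\<^sub>C (g \<mu> - g \<kappa>))"

lemma slope_mult: "(\<mu> - \<kappa>) *\<^sub>C slope g \<kappa> \<mu> = g \<mu> - g \<kappa>"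
  by (simp add: slope_def scaleC_scaleC)

lemma holo_slope:
  fixes g :: "complex \<Rightarrow> 'a::{complex_normed_vector,banach}"
  assumes g: "holo g S"
  shows "holo (slope g \<kappa>) S"
proof (rule holo_local)
  fix x assume x: "x \<in> S"
  show "\<exists>T. x \<in> T \<and> T \<subseteq> S \<and> holo (slope g \<kappa>) T"
  proof (cases "x = \<kappa>")
    case True
    obtain r a where r: "r > 0" and a: "\<And>w. w \<in> ball \<kappa> r \<Longrightarrow> (\<lambda>k. (w - \<kappa>) ^ k *\<^sub>C a k) sums g w"
      using holo_imp_banach_analytic_on[OF g] x True unfolding banach_analytic_on_def by metis
    obtain e where e: "e > 0" "ball \<kappa> e \<subseteq> S" using holoD(1)[OF g] x True by (meson open_contains_ball)
    have "cderiv g \<kappa> = a 1" by (rule tail_power_series(2)[OF a r])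
    then have "slope g \<kappa> = (\<lambda>w. if w = \<kappa> then a 1 else (1 / (w - \<kappa>)) *\<^sub>C (g w - g \<kappa>))"
      by (simp add: slope_def fun_eq_iff)
    then have "holo (slope g \<kappa>) (ball \<kappa> r)"
      using power_series_holo[OF tail_power_series(3)[OF a r]] by simp
    then have "holo (slope g \<kappa>) (ball \<kappa> (min e r))" by (rule holo_subset) auto
    moreover have "ball \<kappa> (min e r) \<subseteq> S" using e(2) by auto
    ultimately show ?thesis using True r e(1) by (intro exI[of _ "ball \<kappa> (min e r)"]) auto
  next
    case False
    have o: "open (S - {\<kappa>})" using holoD(1)[OF g] by (simp add: open_delete)
    have "holo (\<lambda>\<mu>. (1 / (\<mu> - \<kappa>)) *\<^sub>C (g \<mu> - g \<kappa>)) (S - {\<kappa>})"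
      by (intro holo_scaleC holo_diff holo_inverse(1)[OF o] holo_const[OF o] holo_subset[OF g _ o]) auto
    then have "holo (slope g \<kappa>) (S - {\<kappa>})" by (rule holo_cong) (simp add: slope_def)
    then show ?thesis using x False by (intro exI[of _ "S - {\<kappa>}"]) auto
  qed
qed

lemma cderiv_bound:
  fixes g :: "complex \<Rightarrow> 'a::{complex_normed_vector,banach}"
  assumes g: "holo g (ball z (2 * \<rho>))" and \<rho>: "\<rho> > 0" and M: "\<And>\<zeta>. \<zeta> \<in> ball z (2 * \<rho>) \<Longrightarrow> norm (g \<zeta>) \<le> M"
  shows "norm (cderiv g z) \<le> 2 * M / \<rho>"
proof -
  obtain a where a: "\<And>k. norm (a k) \<le> 2 * M / \<rho> ^ k"
    "\<And>w. w \<in> ball z \<rho> \<Longrightarrow> (\<lambda>k. (w - z) ^ k *\<^sub>C a k) sums g w"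
    using taylor[OF g \<rho> order_refl M] by blast
  show ?thesis using tail_power_series(2)[OF a(2) \<rho>] a(1)[of 1] by simp
qed

text \<open>
  Mean value inequality on a disc, which is convex, with Cauchy's estimate for the derivative.
\<close>

lemma slope_bound:
  fixes g :: "complex \<Rightarrow> 'a::{complex_normed_vector,banach}"
  assumes g: "holo g (ball z (4 * \<rho>))" and \<rho>: "\<rho> > 0" and M: "\<And>\<zeta>. \<zeta> \<in> ball z (4 * \<rho>) \<Longrightarrow> norm (g \<zeta>) \<le> M"
    and lm: "\<kappa> \<in> ball z (2 * \<rho>)" "\<mu> \<in> ball z (2 * \<rho>)"
  shows "norm (slope g \<kappa> \<mu>) \<le> 2 * M / \<rho>"
proof -
  have d: "norm (cderiv g \<zeta>) \<le> 2 * M / \<rho>" if "\<zeta> \<in> ball z (2 * \<rho>)" for \<zeta>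
  proof (rule cderiv_bound[OF _ \<rho>])
    have sub: "ball \<zeta> (2 * \<rho>) \<subseteq> ball z (4 * \<rho>)"
    proof
      fix x assume "x \<in> ball \<zeta> (2 * \<rho>)"
      then show "x \<in> ball z (4 * \<rho>)" using that dist_triangle[of z x \<zeta>] by simp
    qed
    show "holo g (ball \<zeta> (2 * \<rho>))" by (rule holo_subset[OF g sub]) simp
    show "norm (g x) \<le> M" if "x \<in> ball \<zeta> (2 * \<rho>)" for x using M sub that by blast
  qed
  show ?thesis
  proof (cases "\<mu> = \<kappa>")
    case True then show ?thesis using d lm by (simp add: slope_def)
  next
    case False
    have "norm (g \<mu> - g \<kappa>) \<le> (2 * M / \<rho>) * norm (\<mu> - \<kappa>)"
    proof -
      have der: "(g has_derivative (\<lambda>h. h *\<^sub>C cderiv g x)) (at x within ball z (2 * \<rho>))" if "x \<in> ball z (2 * \<rho>)" for x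
      proof -
        have "x \<in> ball z (4 * \<rho>)" using that \<rho> by simp
        from holoD(3)[OF g this] show ?thesis by (rule has_derivative_at_withinI)
      qed
      have "onorm (\<lambda>h. h *\<^sub>C cderiv g x) \<le> 2 * M / \<rho>" if "x \<in> ball z (2 * \<rho>)" for x
      proof (rule onorm_le)
        show "norm (h *\<^sub>C cderiv g x) \<le> 2 * M / \<rho> * norm h" for h
          using mult_right_mono[OF d[OF that] norm_ge_zero[of h]] unfolding norm_scaleC by (simp only: mult.commute)
      qed
      from differentiable_bound[OF convex_ball der this lm(2,1)] show ?thesis .
    qed
    moreover have "norm (slope g \<kappa> \<mu>) = norm (g \<mu> - g \<kappa>) / norm (\<mu> - \<kappa>)"
      using False by (simp add: slope_def norm_scaleC norm_divide)
    ultimately show ?thesis using False by (simp only: pos_divide_le_eq zero_less_norm_iff right_minus_eq not_False_eq_True)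
  qed
qed

section \<open>Spaces of bounded families\<close>

instantiation prod :: (complex_normed_vector, complex_normed_vector) complex_normed_vector
begin

definition scaleC_prod :: "complex \<Rightarrow> 'a \<times> 'b \<Rightarrow> 'a \<times> 'b" where
  "scaleC_prod c x = (c *\<^sub>C fst x, c *\<^sub>C snd x)"

instance
proof
  fix c :: complex and x :: "'a \<times> 'b"
  have "norm (c *\<^sub>C x) = sqrt ((norm c)\<^sup>2 * ((norm (fst x))\<^sup>2 + (norm (snd x))\<^sup>2))"
    by (simp add: scaleC_prod_def norm_prod_def norm_scaleC power_mult_distrib distrib_left)
  then show "norm (c *\<^sub>C x) = norm c * norm x" by (simp add: real_sqrt_mult norm_prod_def)
qed (simp_all add: scaleC_prod_def scaleC_of_real scaleC_add_right scaleC_add_left scaleC_scaleC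
    scaleR_prod_def)

end

lemma scaleC_Pair [simp]: "c *\<^sub>C (x, y) = (c *\<^sub>C x, c *\<^sub>C y)"
  by (simp add: scaleC_prod_def)

lemma fst_scaleC [simp]: "fst (c *\<^sub>C x) = c *\<^sub>C fst x" and snd_scaleC [simp]: "snd (c *\<^sub>C x) = c *\<^sub>C snd x"
  by (simp_all add: scaleC_prod_def)

lemma bcontfun_scaleC:
  fixes f :: "'i::topological_space \<Rightarrow> 'a::complex_normed_vector"
  assumes "f \<in> bcontfun"
  shows "(\<lambda>x. c *\<^sub>C f x) \<in> bcontfun"
proof -
  have "bounded ((\<lambda>y. c *\<^sub>C y) ` range f)"
    using assms unfolding bcontfun_def by (intro bounded_linear_image bounded_linear_scaleC) auto
  then show ?thesis using assms unfolding bcontfun_def by (auto simp: image_image intro!: continuous_intros)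
qed

instantiation bcontfun :: (topological_space, complex_normed_vector) complex_normed_vector
begin

definition scaleC_bcontfun :: "complex \<Rightarrow> ('a \<Rightarrow>\<^sub>C 'b) \<Rightarrow> 'a \<Rightarrow>\<^sub>C 'b" where
  "scaleC_bcontfun c f = Bcontfun (\<lambda>x. c *\<^sub>C apply_bcontfun f x)"

lemma apply_bcontfun_scaleC [simp]: "apply_bcontfun (c *\<^sub>C f) x = c *\<^sub>C apply_bcontfun f x"
  unfolding scaleC_bcontfun_def by (simp add: Bcontfun_inverse bcontfun_scaleC apply_bcontfun)

instance
proof
  fix r :: real and c d :: complex and f g :: "'a \<Rightarrow>\<^sub>C 'b"
  show one: "complex_of_real r *\<^sub>C f = r *\<^sub>R f" for r and f :: "'a \<Rightarrow>\<^sub>C 'b" by (rule bcontfun_eqI) (simp add: scaleC_of_real)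
  show "c *\<^sub>C (f + g) = c *\<^sub>C f + c *\<^sub>C g" by (rule bcontfun_eqI) (simp add: scaleC_add_right)
  show "(c + d) *\<^sub>C f = c *\<^sub>C f + d *\<^sub>C f" by (rule bcontfun_eqI) (simp add: scaleC_add_left)
  show mult: "c *\<^sub>C d *\<^sub>C f = (c * d) *\<^sub>C f" for c d and f :: "'a \<Rightarrow>\<^sub>C 'b" by (rule bcontfun_eqI) (simp add: scaleC_scaleC)
  have le: "norm (c *\<^sub>C f) \<le> norm c * norm f" for c and f :: "'a \<Rightarrow>\<^sub>C 'b"
    by (rule norm_bound) (simp add: norm_scaleC mult_left_mono norm_bounded)
  show "norm (c *\<^sub>C f) = norm c * norm f"
  proof (cases "c = 0")
    case True then show ?thesis using le[of 0 f] by simp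
  next
    case False
    have "norm f = norm ((1 / c) *\<^sub>C c *\<^sub>C f)" using False one[of 1 f] by (simp add: mult)
    also have "\<dots> \<le> norm (1 / c) * norm (c *\<^sub>C f)" by (rule le)
    finally have "norm c * norm f \<le> norm (c *\<^sub>C f)" using False by (simp add: norm_divide field_simps)
    then show ?thesis using le[of c f] by simp
  qed
qed

end

instance bcontfun :: (metric_space, banach) banach ..

text \<open>
  Every function on a discrete space is continuous, so the bounded continuous functions on
  \<open>'i discrete\<close> form the Banach space of all bounded families.
\<close>

type_synonym ('i, 'a) linf = "'i discrete \<Rightarrow>\<^sub>C 'a"

definition coord :: "('i, 'a::complex_normed_vector) linf \<Rightarrow> 'i \<Rightarrow> 'a" where
  "coord x i = apply_bcontfun x (discrete i)"

text \<open>
  Meaningful for bounded families only; the value is arbitrary otherwise.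
\<close>

definition family :: "('i \<Rightarrow> 'a::complex_normed_vector) \<Rightarrow> ('i, 'a) linf" where
  "family f = Bcontfun (\<lambda>i. f (of_discrete i))"

lemma coord_family:
  assumes "\<And>i. norm (f i) \<le> M"
  shows "coord (family f) i = f i"
proof -
  have "continuous_on UNIV (\<lambda>i. f (of_discrete i))"
    by (simp add: continuous_on_open_vimage open_discrete)
  then have "(\<lambda>i. f (of_discrete i)) \<in> bcontfun" using assms by (rule bcontfun_normI)
  then show ?thesis by (simp add: coord_def family_def Bcontfun_inverse discrete_inverse)
qed

lemma linf_eqI: "(\<And>i. coord x i = coord y i) \<Longrightarrow> x = y"
  unfolding coord_def by (metis bcontfun_eqI of_discrete_inverse)

lemma norm_coord: "norm (coord x i) \<le> norm x"
  unfolding coord_def by (rule norm_bounded)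

lemma norm_linf_le: "(\<And>i. norm (coord x i) \<le> b) \<Longrightarrow> norm x \<le> b"
  unfolding coord_def by (metis norm_bound of_discrete_inverse)

lemma norm_family_le:
  assumes "\<And>i. norm (f i) \<le> b"
  shows "norm (family f) \<le> b"
  by (rule norm_linf_le) (simp add: coord_family[OF assms] assms)

lemma coord_simps [simp]:
  "coord (x + y) i = coord x i + coord y i" "coord (x - y) i = coord x i - coord y i"
  "coord (c *\<^sub>C x) i = c *\<^sub>C coord x i" "coord (r *\<^sub>R x) i = r *\<^sub>R coord x i" "coord 0 i = 0"
  by (simp_all add: coord_def)

lemma coord_sum: "coord (\<Sum>k\<in>K. x k) i = (\<Sum>k\<in>K. coord (x k) i)"
  by (induction K rule: infinite_finite_induct) auto

lemma bounded_linear_coord: "bounded_linear (\<lambda>x. coord x i)"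
  by (rule bounded_linear_intro[where K = 1]) (auto simp: norm_coord)

lemma geometric_tail_bound:
  fixes t :: "nat \<Rightarrow> 'a::banach"
  assumes s: "t sums s" and q: "0 \<le> q" "q < 1" and t: "\<And>k. norm (t k) \<le> C * q ^ k"
  shows "norm (s - (\<Sum>k<n. t k)) \<le> C * q ^ n / (1 - q)"
proof -
  have S: "(\<lambda>k. t (k + n)) sums (s - (\<Sum>k<n. t k))" by (rule sums_split_initial_segment[OF s])
  have g: "(\<lambda>k. C * q ^ n * q ^ k) sums (C * q ^ n * (1 / (1 - q)))"
    using q by (intro sums_mult geometric_sums) auto
  have "norm (\<Sum>k. t (k + n)) \<le> (\<Sum>k. C * q ^ n * q ^ k)"
    using t[of "k + n" for k] by (intro norm_suminf_le sums_summable[OF g]) (simp add: power_add mult_ac)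
  then show ?thesis using sums_unique[OF S] sums_unique[OF g] by simp
qed

text \<open>
  The Taylor coefficients of the members form bounded families, and the Taylor series converge
  uniformly over the family, because Cauchy's estimates depend on the common bound only.
\<close>

lemma family_power_series:
  fixes f :: "'i \<Rightarrow> complex \<Rightarrow> 'a::{complex_normed_vector,banach}"
  assumes f: "\<And>i. holo (f i) (ball z R)" and M: "\<And>i \<zeta>. \<zeta> \<in> ball z R \<Longrightarrow> norm (f i \<zeta>) \<le> M"
    and r: "0 < r" "2 * r \<le> R"
  shows "\<exists>a. \<forall>w\<in>ball z r. (\<lambda>k. (w - z) ^ k *\<^sub>C a k) sums family (\<lambda>i. f i w)"
proof -
  have "\<forall>i. \<exists>a. (\<forall>k. norm (a k) \<le> 2 * M / r ^ k) \<and> (\<forall>w\<in>ball z r. (\<lambda>k. (w - z) ^ k *\<^sub>C a k) sums f i w)"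
    using taylor[OF f r M] by blast
  then obtain A where A: "\<And>i k. norm (A i k) \<le> 2 * M / r ^ k"
    "\<And>i w. w \<in> ball z r \<Longrightarrow> (\<lambda>k. (w - z) ^ k *\<^sub>C A i k) sums f i w" by metis
  define a where "a k = family (\<lambda>i. A i k)" for k
  have ca: "coord (a k) i = A i k" for k i unfolding a_def by (rule coord_family) (rule A)
  have "(\<lambda>k. (w - z) ^ k *\<^sub>C a k) sums family (\<lambda>i. f i w)" if w: "w \<in> ball z r" for w
  proof -
    define q where "q = norm (w - z) / r"
    have q: "0 \<le> q" "q < 1" using w r by (auto simp: q_def dist_norm norm_minus_commute)
    have wR: "w \<in> ball z R" using w r by simp
    have cf: "coord (family (\<lambda>i. f i w)) i = f i w" for i by (rule coord_family) (rule M[OF wR])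
    have "norm (family (\<lambda>i. f i w) - (\<Sum>k<n. (w - z) ^ k *\<^sub>C a k)) \<le> 2 * M * q ^ n / (1 - q)" for n
    proof (rule norm_linf_le)
      fix i
      have "norm ((w - z) ^ k *\<^sub>C A i k) \<le> 2 * M * q ^ k" for k
        using mult_left_mono[OF A(1)[of i k], of "norm (w - z) ^ k"] r
        by (simp add: norm_scaleC norm_power q_def power_divide field_simps)
      from geometric_tail_bound[OF A(2)[OF w] q this]
      show "norm (coord (family (\<lambda>i. f i w) - (\<Sum>k<n. (w - z) ^ k *\<^sub>C a k)) i) \<le> 2 * M * q ^ n / (1 - q)"
        by (simp add: cf ca coord_sum)
    qed
    note bd = this
    have "(\<lambda>n. 2 * M * q ^ n / (1 - q)) \<longlonglongrightarrow> 2 * M * 0 / (1 - q)"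
      using q by (intro tendsto_intros LIMSEQ_power_zero) auto
    then have "(\<lambda>n. family (\<lambda>i. f i w) - (\<Sum>k<n. (w - z) ^ k *\<^sub>C a k)) \<longlonglongrightarrow> 0"
      by (intro Lim_null_comparison[OF always_eventually[OF allI[OF bd]]]) simp
    from tendsto_diff[OF tendsto_const[of "family (\<lambda>i. f i w)"] this]
    show ?thesis by (simp add: sums_def)
  qed
  then show ?thesis by blast
qed

text \<open>
  For a zero \<open>p\<close> of \<open>g\<close> this is the difference quotient of \<open>g\<close> at \<open>p\<close>. The pole \<open>p\<close> may also lie outside
  the domain of \<open>g\<close>; so one family can contain poles near and far.
\<close>

definition zero_quot :: "(complex \<Rightarrow> 'a::complex_normed_vector) \<Rightarrow> complex \<Rightarrow> complex \<Rightarrow> 'a" where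
  "zero_quot g p \<zeta> = (if \<zeta> = p then cderiv g p else (1 / (\<zeta> - p)) *\<^sub>C g \<zeta>)"

lemma zero_quot_holo_bound:
  fixes g :: "complex \<Rightarrow> 'a::{complex_normed_vector,banach}"
  assumes g: "holo g (ball z (4 * \<rho>))" and \<rho>: "\<rho> > 0" and M: "\<And>\<zeta>. \<zeta> \<in> ball z (4 * \<rho>) \<Longrightarrow> norm (g \<zeta>) \<le> M"
    and p: "p \<in> ball z (4 * \<rho>) \<Longrightarrow> g p = 0"
  shows "holo (zero_quot g p) (ball z \<rho>)" "\<And>\<zeta>. \<zeta> \<in> ball z \<rho> \<Longrightarrow> norm (zero_quot g p \<zeta>) \<le> 2 * M / \<rho>"
proof -
  have sub: "ball z \<rho> \<subseteq> ball z (4 * \<rho>)" using \<rho> by (intro subset_ball) simp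
  have "z \<in> ball z (4 * \<rho>)" using \<rho> by simp
  then have M0: "0 \<le> M" using M norm_ge_zero order_trans by blast
  have "holo (zero_quot g p) (ball z \<rho>) \<and> (\<forall>\<zeta>\<in>ball z \<rho>. norm (zero_quot g p \<zeta>) \<le> 2 * M / \<rho>)"
  proof (cases "p \<in> ball z (2 * \<rho>)")
    case True
    then have "g p = 0" using p \<rho> by simp
    then have eq: "zero_quot g p = slope g p" by (simp add: zero_quot_def slope_def fun_eq_iff)
    show ?thesis unfolding eq
    proof
      show "holo (slope g p) (ball z \<rho>)" by (rule holo_subset[OF holo_slope[OF g] sub]) simp
      show "\<forall>\<zeta>\<in>ball z \<rho>. norm (slope g p \<zeta>) \<le> 2 * M / \<rho>"
        using slope_bound[OF g \<rho> M True] \<rho> by simp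
    qed
  next
    case False
    have far: "\<rho> \<le> norm (\<zeta> - p)" if "\<zeta> \<in> ball z \<rho>" for \<zeta>
      using False that norm_triangle_ineq[of "z - \<zeta>" "\<zeta> - p"] by (auto simp: dist_norm)
    then have np: "p \<notin> ball z \<rho>" using \<rho> by force
    have "holo (\<lambda>\<zeta>. (1 / (\<zeta> - p)) *\<^sub>C g \<zeta>) (ball z \<rho>)"
      by (intro holo_scaleC holo_inverse(1) holo_subset[OF g sub]) (use np in auto)
    then have "holo (zero_quot g p) (ball z \<rho>)"
      by (rule holo_cong) (use np in \<open>auto simp: zero_quot_def\<close>)
    moreover have "norm (zero_quot g p \<zeta>) \<le> 2 * M / \<rho>" if \<zeta>: "\<zeta> \<in> ball z \<rho>" for \<zeta>
    proof -
      have "norm (zero_quot g p \<zeta>) = norm (g \<zeta>) / norm (\<zeta> - p)"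
        using \<zeta> np by (auto simp: zero_quot_def norm_scaleC norm_divide)
      also have "\<dots> \<le> (2 * M) / \<rho>"
        by (rule frac_le) (use M[of \<zeta>] M0 \<zeta> sub far[OF \<zeta>] \<rho> in auto)
      finally show ?thesis .
    qed
    ultimately show ?thesis by blast
  qed
  then show "holo (zero_quot g p) (ball z \<rho>)" "\<And>\<zeta>. \<zeta> \<in> ball z \<rho> \<Longrightarrow> norm (zero_quot g p \<zeta>) \<le> 2 * M / \<rho>"
    by blast+
qed

lemma zero_quot_family:
  fixes g :: "'i \<Rightarrow> complex \<Rightarrow> 'a::{complex_normed_vector,banach}"
  assumes g: "\<And>i. holo (g i) (ball z (4 * \<rho>))" and \<rho>: "\<rho> > 0"
    and M: "\<And>i \<zeta>. \<zeta> \<in> ball z (4 * \<rho>) \<Longrightarrow> norm (g i \<zeta>) \<le> M"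
    and p: "\<And>i. p i \<in> ball z (4 * \<rho>) \<Longrightarrow> g i (p i) = 0"
  shows "\<exists>a. \<forall>w\<in>ball z (\<rho> / 2). (\<lambda>k. (w - z) ^ k *\<^sub>C a k) sums family (\<lambda>i. zero_quot (g i) (p i) w)"
proof (rule family_power_series[where R = \<rho>])
  show "holo (zero_quot (g i) (p i)) (ball z \<rho>)" for i
    by (rule zero_quot_holo_bound(1)[OF g \<rho> M p])
  show "norm (zero_quot (g i) (p i) \<zeta>) \<le> 2 * M / \<rho>" if "\<zeta> \<in> ball z \<rho>" for i \<zeta>
    by (rule zero_quot_holo_bound(2)[OF g \<rho> M p that])
qed (use \<rho> in auto)

section \<open>Surjective families of operators and local lifting\<close>

text \<open>
  Lift the error again and again; the errors decrease geometrically.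
\<close>

lemma approximate_lift_sum:
  fixes f :: "'a::banach \<Rightarrow>\<^sub>L 'b::banach"
  assumes "\<And>y. \<exists>x. norm x \<le> K * norm y \<and> norm (y - blinfun_apply f x) \<le> norm y / 2"
  shows "\<exists>x. blinfun_apply f x = y \<and> norm x \<le> 2 * K * norm y"
proof -
  obtain s where s: "\<And>y. norm (s y) \<le> K * norm y" "\<And>y. norm (y - blinfun_apply f (s y)) \<le> norm y / 2"
    using assms by metis
  define Y where "Y n = ((\<lambda>y. y - blinfun_apply f (s y)) ^^ n) y" for n
  have Y: "Y 0 = y" "Y (Suc n) = Y n - blinfun_apply f (s (Y n))" for n by (auto simp: Y_def)
  have Yn: "norm (Y n) \<le> norm y * (1 / 2) ^ n" for n
  proof (induction n)
    case (Suc n)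
    have "norm (Y (Suc n)) \<le> norm (Y n) / 2" unfolding Y by (rule s(2))
    then show ?case using Suc by simp
  qed (simp add: Y)
  have K: "0 \<le> K * norm y" using s(1)[of y] norm_ge_zero order_trans by blast
  have sY: "norm (s (Y n)) \<le> K * norm y * (1 / 2) ^ n" for n
  proof (cases "norm y = 0")
    case True then show ?thesis using Yn[of n] s(1)[of "Y n"] by simp
  next
    case False
    then have "0 \<le> K" using K by (simp add: zero_le_mult_iff)
    then show ?thesis using s(1)[of "Y n"] mult_left_mono[OF Yn[of n], of K] by (simp add: mult.assoc)
  qed
  have geo: "(\<lambda>n. K * norm y * (1 / 2) ^ n) sums (K * norm y * (1 / (1 - 1 / 2)))"
    by (intro sums_mult geometric_sums) simp
  have summ: "summable (\<lambda>n. s (Y n))"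
    by (rule summable_comparison_test'[OF sums_summable[OF geo] sY])
  have "norm (\<Sum>n. s (Y n)) \<le> 2 * K * norm y"
    using norm_suminf_le[OF sY sums_summable[OF geo]] sums_unique[OF geo] by simp
  moreover have "blinfun_apply f (\<Sum>n. s (Y n)) = y"
  proof -
    have "(\<lambda>n. blinfun_apply f (s (Y n))) sums blinfun_apply f (\<Sum>n. s (Y n))"
      by (rule bounded_linear.sums[OF blinfun.bounded_linear_right summable_sums[OF summ]])
    moreover have "(\<lambda>n. Y n - Y (Suc n)) sums (Y 0 - 0)"
    proof (rule telescope_sums')
      have "(\<lambda>n. norm y * (1 / 2) ^ n) \<longlonglongrightarrow> norm y * 0"
        by (intro tendsto_intros LIMSEQ_power_zero) simp
      then show "Y \<longlonglongrightarrow> 0" by (intro Lim_null_comparison[OF always_eventually[OF allI[OF Yn]]]) simp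
    qed
    ultimately show ?thesis by (simp add: Y sums_unique2)
  qed
  ultimately show ?thesis by blast
qed

text \<open>
  The open mapping theorem in quantitative form. By Baire's theorem the closure of the image of some
  ball contains a ball; differences of preimages then give approximate lifts of bounded norm.
\<close>

lemma open_mapping_bound:
  fixes f :: "'a::banach \<Rightarrow>\<^sub>L 'b::banach"
  assumes "surj (blinfun_apply f)"
  shows "\<exists>C>0. \<forall>y. \<exists>x. blinfun_apply f x = y \<and> norm x \<le> C * norm y"
proof -
  define F where "F n = closure (blinfun_apply f ` cball 0 (real n))" for n
  have "(\<Union>n. F n) = UNIV"
  proof -
    have "y \<in> (\<Union>n. F n)" for y
    proof -
      obtain x where x: "blinfun_apply f x = y" using assms by (metis surjD)
      obtain n where "norm x \<le> real n" using real_arch_simple by blast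
      then have "y \<in> F n" using x closure_subset[of "blinfun_apply f ` cball 0 (real n)"] by (auto simp: F_def)
      then show ?thesis by blast
    qed
    then show ?thesis by blast
  qed
  then have ne: "interior (\<Union>(range F)) \<noteq> {}" by simp
  have "\<exists>n. interior (F n) \<noteq> {}"
  proof (rule ccontr)
    assume "\<not> ?thesis"
    then have "Met_TC.mtopology interior_of \<Union>(range F) = {}"
    proof (intro Met_TC.metric_Baire_category_alt)
      show "Met_TC.mcomplete TYPE('b)" by (simp only: mcomplete_iff_complete complete_UNIV)
    qed (auto simp: F_def)
    then show False using ne by simp
  qed
  then obtain n y0 where "y0 \<in> interior (F n)" by blast
  then obtain e where e: "e > 0" "cball y0 e \<subseteq> F n" unfolding mem_interior_cball by blast
  have approx: "\<exists>x. norm x \<le> 2 * real n \<and> norm (y - blinfun_apply f x) \<le> d" if "norm y \<le> e" "d > 0" for y d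
  proof -
    have d: "d / 2 > 0" using that(2) by simp
    have "y0 + y \<in> F n" "y0 \<in> F n" using e that by (auto simp: subset_eq dist_norm)
    then obtain x1 x2 where x: "norm x1 \<le> real n" "norm x2 \<le> real n"
      "dist (blinfun_apply f x1) (y0 + y) < d / 2" "dist (blinfun_apply f x2) y0 < d / 2"
    proof -
      obtain u where u: "u \<in> blinfun_apply f ` cball 0 (real n)" "dist u (y0 + y) < d / 2"
        using \<open>y0 + y \<in> F n\<close> d unfolding F_def closure_approachable by blast
      obtain v where v: "v \<in> blinfun_apply f ` cball 0 (real n)" "dist v y0 < d / 2"
        using \<open>y0 \<in> F n\<close> d unfolding F_def closure_approachable by blast
      from u(1) v(1) obtain x1 x2 where "u = blinfun_apply f x1" "norm x1 \<le> real n"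
        "v = blinfun_apply f x2" "norm x2 \<le> real n" by auto
      then show thesis using u(2) v(2) that by blast
    qed
    have "norm (x1 - x2) \<le> 2 * real n" using x norm_triangle_ineq4[of x1 x2] by simp
    moreover have eq: "y - blinfun_apply f (x1 - x2)
        = (blinfun_apply f x2 - y0) - (blinfun_apply f x1 - (y0 + y))" by (simp add: blinfun.diff_right)
    have "norm (y - blinfun_apply f (x1 - x2)) \<le> norm (blinfun_apply f x2 - y0) + norm (blinfun_apply f x1 - (y0 + y))"
      unfolding eq by (rule norm_triangle_ineq4)
    then have "norm (y - blinfun_apply f (x1 - x2)) \<le> d"
      using x(3,4) unfolding dist_norm by linarith
    ultimately show ?thesis by blast
  qed
  define K where "K = (2 * real n + 1) / e"
  have "\<exists>x. norm x \<le> K * norm y \<and> norm (y - blinfun_apply f x) \<le> norm y / 2" for y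
  proof (cases "y = 0")
    case True then show ?thesis by (intro exI[of _ 0]) simp
  next
    case False
    define t where "t = norm y / e"
    have t: "t > 0" using False e by (simp add: t_def)
    obtain x where x: "norm x \<le> 2 * real n" "norm ((1 / t) *\<^sub>R y - blinfun_apply f x) \<le> e / 2"
      using approx[of "(1 / t) *\<^sub>R y" "e / 2"] e False by (auto simp: t_def)
    have "norm (t *\<^sub>R x) \<le> K * norm y"
    proof -
      have "norm (t *\<^sub>R x) = t * norm x" using t by simp
      also have "\<dots> \<le> t * (2 * real n + 1)" using x(1) t by (intro mult_left_mono) auto
      finally show ?thesis by (simp add: K_def t_def mult.commute)
    qed
    moreover have "norm (y - blinfun_apply f (t *\<^sub>R x)) = t * norm ((1 / t) *\<^sub>R y - blinfun_apply f x)"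
    proof -
      have "y - blinfun_apply f (t *\<^sub>R x) = t *\<^sub>R ((1 / t) *\<^sub>R y - blinfun_apply f x)"
        using t by (simp add: blinfun.scaleR_right scaleR_diff_right)
      then show ?thesis using t by simp
    qed
    then have "norm (y - blinfun_apply f (t *\<^sub>R x)) \<le> norm y / 2"
      using mult_left_mono[OF x(2), of t] t e by (simp add: t_def)
    ultimately show ?thesis by blast
  qed
  from approximate_lift_sum[of K f, OF this]
  have "\<forall>y. \<exists>x. blinfun_apply f x = y \<and> norm x \<le> 2 * K * norm y" by blast
  moreover have "2 * K > 0" using e by (simp add: K_def)
  ultimately show ?thesis by blast
qed

locale surj_family =
  fixes U :: "complex set"
    and \<pi> :: "complex \<Rightarrow> 'a::{complex_normed_vector,banach} \<Rightarrow>\<^sub>L 'b::{complex_normed_vector,banach}"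
  assumes holo_pi: "holo \<pi> U"
    and linear_pi: "\<And>z c x. z \<in> U \<Longrightarrow> blinfun_apply (\<pi> z) (c *\<^sub>C x) = c *\<^sub>C blinfun_apply (\<pi> z) x"
    and surj_pi: "\<And>z. z \<in> U \<Longrightarrow> surj (blinfun_apply (\<pi> z))"
begin

lemma open_U: "open U" using holoD(1)[OF holo_pi] .

lemma holo_apply:
  assumes "holo g S" "S \<subseteq> U"
  shows "holo (\<lambda>z. blinfun_apply (\<pi> z) (g z)) S"
  by (rule holo_blinfun_apply[OF holo_subset[OF holo_pi assms(2) holoD(1)[OF assms(1)]] assms(1)])
    (use assms(2) linear_pi in auto)

text \<open>
  The Taylor coefficients of the lift are constructed one by one: a constant lift of the value at \<open>z\<close> is
  subtracted, the rest is divided by \<open>w - z\<close>, and so on. Each step costs a factor \<open>L\<close>, by the slope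
  bound and the open mapping constant of \<open>\<pi> z\<close>, so the lift converges for \<open>|w - z| < 1 / L\<close>. This
  radius depends on \<open>\<pi>\<close>, \<open>z\<close> and \<open>R\<close> only and not on \<open>f\<close>.
\<close>

lemma local_lift:
  assumes R: "R > 0" "ball z R \<subseteq> U"
  shows "\<exists>r>0. r \<le> R \<and> (\<forall>f. holo f (ball z R) \<longrightarrow>
    (\<exists>c. holo c (ball z r) \<and> (\<forall>w\<in>ball z r. blinfun_apply (\<pi> w) (c w) = f w)))"
proof -
  define \<rho> where "\<rho> = R / 8"
  have \<rho>: "\<rho> > 0" "4 * \<rho> < R" "ball z (4 * \<rho>) \<subseteq> cball z (4 * \<rho>)" "cball z (4 * \<rho>) \<subseteq> ball z R" "cball z (4 * \<rho>) \<subseteq> U"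
    using R by (auto simp: \<rho>_def)
  have zU: "z \<in> U" using R by auto
  obtain P where P: "P > 0" "\<And>w. w \<in> cball z (4 * \<rho>) \<Longrightarrow> norm (\<pi> w) \<le> P"
    using holo_bounded_smaller_ball[OF holo_pi \<rho>(5)] by blast
  obtain C s where C: "C > 0" and s: "\<And>y. blinfun_apply (\<pi> z) (s y) = y" "\<And>y. norm (s y) \<le> C * norm y"
    using open_mapping_bound[OF surj_pi[OF zU]] by metis
  define L where "L = 2 * (1 + P * C) / \<rho>"
  have L: "L > 0" using P C \<rho> by (simp add: L_def add_pos_pos)
  define r where "r = min (4 * \<rho>) (1 / L)"
  have r: "r > 0" "r \<le> R" "ball z r \<subseteq> ball z (4 * \<rho>)" using \<rho> L by (auto simp: r_def)
  have "\<exists>c. holo c (ball z r) \<and> (\<forall>w\<in>ball z r. blinfun_apply (\<pi> w) (c w) = f w)"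
    if f: "holo f (ball z R)" for f
  proof -
    obtain N where N: "N > 0" "\<And>w. w \<in> cball z (4 * \<rho>) \<Longrightarrow> norm (f w) \<le> N"
      using holo_bounded_smaller_ball[OF f \<rho>(4)] by blast
    define F where "F = rec_nat f (\<lambda>k g. slope (\<lambda>w. g w - blinfun_apply (\<pi> w) (s (g z))) z)"
    have F: "F 0 = f" "F (Suc k) = slope (\<lambda>w. F k w - blinfun_apply (\<pi> w) (s (F k z))) z" for k
      by (simp_all add: F_def)
    define G where "G k w = F k w - blinfun_apply (\<pi> w) (s (F k z))" for k w
    have FS: "F (Suc k) = slope (G k) z" for k unfolding F G_def by simp
    have hpi: "holo (\<lambda>w. blinfun_apply (\<pi> w) x) (ball z R)" for x
      by (rule holo_apply[OF holo_const R(2)]) simp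
    have hF: "holo (F k) (ball z R)" for k
      by (induction k) (auto simp: F intro!: f holo_slope holo_diff hpi)
    then have hG: "holo (G k) (ball z R)" for k unfolding G_def by (intro holo_diff hpi)
    have G0: "G k z = 0" for k by (simp add: G_def s)
    have rec: "F k w = blinfun_apply (\<pi> w) (s (F k z)) + (w - z) *\<^sub>C F (Suc k) w" for k w
      by (simp only: FS slope_mult G0) (simp add: G_def)
    have FB: "\<forall>w\<in>ball z (4 * \<rho>). norm (F k w) \<le> N * L ^ k" for k
    proof (induction k)
      case 0 then show ?case using N \<rho>(3) by (auto simp: F)
    next
      case (Suc k)
      let ?M = "N * L ^ k"
      have GB: "norm (G k w) \<le> (1 + P * C) * ?M" if w: "w \<in> ball z (4 * \<rho>)" for w
      proof -
        have "norm (s (F k z)) \<le> C * ?M"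
          using s(2)[of "F k z"] Suc \<rho>(1) C by (smt (verit, best) centre_in_ball mult_left_mono mult_pos_pos)
        moreover have "norm (blinfun_apply (\<pi> w) (s (F k z))) \<le> P * norm (s (F k z))"
          using norm_blinfun[of "\<pi> w"] P(2)[of w] w \<rho>(3)
          by (meson mult_right_mono norm_ge_zero order_trans subsetD)
        ultimately have "norm (blinfun_apply (\<pi> w) (s (F k z))) \<le> P * (C * ?M)"
          using P(1) by (meson mult_left_mono order_less_imp_le order_trans)
        then have "norm (G k w) \<le> ?M + P * (C * ?M)"
          unfolding G_def using Suc w by (meson add_mono norm_triangle_le_diff)
        then show ?thesis by (simp add: algebra_simps)
      qed
      have hG4: "holo (G k) (ball z (4 * \<rho>))" by (rule holo_subset[OF hG]) (use \<rho> in auto)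
      have M0: "0 \<le> (1 + P * C) * ?M" using N L P C by simp
      have LM: "N * L ^ Suc k = 2 * ((1 + P * C) * ?M) / \<rho>" by (simp add: L_def)
      show ?case
      proof
        fix w assume w: "w \<in> ball z (4 * \<rho>)"
        show "norm (F (Suc k) w) \<le> N * L ^ Suc k"
        proof (cases "w \<in> ball z (2 * \<rho>)")
          case True
          show ?thesis unfolding FS LM
            by (rule slope_bound[OF hG4 \<rho>(1) GB _ True]) (use \<rho> in auto)
        next
          case False
          then have far: "\<rho> \<le> norm (w - z)" "w \<noteq> z" using \<rho> by (auto simp: dist_norm norm_minus_commute)
          have "norm (F (Suc k) w) = norm (G k w) / norm (w - z)"
            using far by (simp add: FS slope_def G0 norm_scaleC norm_divide)
          also have "\<dots> \<le> (2 * ((1 + P * C) * ?M)) / \<rho>"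
            by (rule frac_le) (use GB[OF w] M0 far \<rho>(1) in linarith)+
          finally show ?thesis unfolding LM .
        qed
      qed
    qed
    define c where "c k = s (F k z)" for k
    have cB: "norm (c k) \<le> C * N * L ^ k" for k
    proof -
      have "norm (F k z) \<le> N * L ^ k" using FB[of k] \<rho>(1) by simp
      then have "C * norm (F k z) \<le> C * (N * L ^ k)" using C by simp
      then show ?thesis unfolding c_def using s(2)[of "F k z"] by (simp add: mult.assoc)
    qed
    have q: "L * norm (w - z) < 1" "0 \<le> L * norm (w - z)" if "w \<in> ball z r" for w
      using that L by (auto simp: r_def dist_norm norm_minus_commute field_simps)
    have summ: "summable (\<lambda>k. (w - z) ^ k *\<^sub>C c k)" if w: "w \<in> ball z r" for w
    proof (rule summable_comparison_test')
      show "summable (\<lambda>k. C * N * (L * norm (w - z)) ^ k)"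
        using q[OF w] by (intro summable_mult summable_geometric) simp
      show "norm ((w - z) ^ k *\<^sub>C c k) \<le> C * N * (L * norm (w - z)) ^ k" for k
        using mult_left_mono[OF cB[of k], of "norm (w - z) ^ k"]
        by (simp add: norm_scaleC norm_power power_mult_distrib mult_ac)
    qed
    define cc where "cc w = (\<Sum>k. (w - z) ^ k *\<^sub>C c k)" for w
    have ccs: "(\<lambda>k. (w - z) ^ k *\<^sub>C c k) sums cc w" if "w \<in> ball z r" for w
      unfolding cc_def by (rule summable_sums[OF summ[OF that]])
    have "blinfun_apply (\<pi> w) (cc w) = f w" if w: "w \<in> ball z r" for w
    proof -
      have wU: "w \<in> U" using w r R(2) by auto
      have part: "f w - (\<Sum>k<n. blinfun_apply (\<pi> w) ((w - z) ^ k *\<^sub>C c k)) = (w - z) ^ n *\<^sub>C F n w" for n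
      proof (induction n)
        case (Suc n)
        have "(w - z) ^ n *\<^sub>C F n w = blinfun_apply (\<pi> w) ((w - z) ^ n *\<^sub>C c n) + (w - z) ^ Suc n *\<^sub>C F (Suc n) w"
          by (subst rec) (simp add: c_def linear_pi[OF wU] scaleC_add_right scaleC_scaleC mult.commute)
        then show ?case using Suc by (simp add: algebra_simps)
      qed (simp add: F)
      have bd: "norm ((w - z) ^ n *\<^sub>C F n w) \<le> N * (L * norm (w - z)) ^ n" for n
      proof -
        have "norm (F n w) \<le> N * L ^ n" using FB[of n] w r(3) by blast
        from mult_left_mono[OF this, of "norm (w - z) ^ n"] show ?thesis
          by (simp add: norm_scaleC norm_power power_mult_distrib mult_ac)
      qed
      have "(\<lambda>n. N * (L * norm (w - z)) ^ n) \<longlonglongrightarrow> N * 0"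
        using q[OF w] by (intro tendsto_intros LIMSEQ_power_zero) simp
      then have "(\<lambda>n. (w - z) ^ n *\<^sub>C F n w) \<longlonglongrightarrow> 0"
        by (intro Lim_null_comparison[OF always_eventually[OF allI[OF bd]]]) simp
      then have "(\<lambda>n. f w - (\<Sum>k<n. blinfun_apply (\<pi> w) ((w - z) ^ k *\<^sub>C c k))) \<longlonglongrightarrow> 0"
        unfolding part .
      from tendsto_diff[OF tendsto_const[of "f w"] this]
      have "(\<lambda>k. blinfun_apply (\<pi> w) ((w - z) ^ k *\<^sub>C c k)) sums f w" by (simp add: sums_def)
      with bounded_linear.sums[OF blinfun.bounded_linear_right[of "\<pi> w"] ccs[OF w]] show ?thesis
        by (rule sums_unique2)
    qed
    moreover have "holo cc (ball z r)" by (rule power_series_holo[OF ccs])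
    ultimately show ?thesis by blast
  qed
  then show ?thesis using r by blast
qed

text \<open>
  Since \<open>\<pi>(w) y = 0\<close>, the map \<open>v \<mapsto> \<pi>(v) y\<close> is \<open>v - w\<close> times an analytic map with a lift \<open>c\<close>; then
  \<open>y - (v - w) c(v)\<close> lies in the kernel of \<open>\<pi> v\<close>.
\<close>

lemma kernel_extension:
  assumes R: "R > 0" "ball z R \<subseteq> U"
  shows "\<exists>r>0. r \<le> R \<and> (\<forall>w\<in>ball z r. \<forall>y. blinfun_apply (\<pi> w) y = 0 \<longrightarrow>
    (\<exists>k. holo k (ball z r) \<and> k w = y \<and> (\<forall>v\<in>ball z r. blinfun_apply (\<pi> v) (k v) = 0)))"
proof -
  obtain r where r: "r > 0" "r \<le> R" and lift: "\<And>f. holo f (ball z R) \<Longrightarrow>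
    \<exists>c. holo c (ball z r) \<and> (\<forall>w\<in>ball z r. blinfun_apply (\<pi> w) (c w) = f w)"
    using local_lift[OF R] by blast
  have "\<exists>k. holo k (ball z r) \<and> k w = y \<and> (\<forall>v\<in>ball z r. blinfun_apply (\<pi> v) (k v) = 0)"
    if w: "w \<in> ball z r" and y: "blinfun_apply (\<pi> w) y = 0" for w y
  proof -
    have "holo (\<lambda>v. blinfun_apply (\<pi> v) y) (ball z R)" by (rule holo_apply[OF holo_const R(2)]) simp
    from lift[OF holo_slope[OF this, of w]]
    obtain c where c: "holo c (ball z r)"
      "\<And>v. v \<in> ball z r \<Longrightarrow> blinfun_apply (\<pi> v) (c v) = slope (\<lambda>v. blinfun_apply (\<pi> v) y) w v" by blast
    define k where "k v = y - (v - w) *\<^sub>C c v" for v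
    have "holo k (ball z r)" unfolding k_def
      by (intro holo_diff holo_const holo_scaleC holo_ident c(1)) auto
    moreover have "blinfun_apply (\<pi> v) (k v) = 0" if "v \<in> ball z r" for v
    proof -
      have "v \<in> U" using that r R by auto
      then show ?thesis
        using that by (simp add: k_def blinfun.diff_right linear_pi c(2) slope_mult y)
    qed
    ultimately show ?thesis by (intro exI[of _ k]) (simp add: k_def)
  qed
  then show ?thesis using r by blast
qed

end

definition map_linf :: "('a::complex_normed_vector \<Rightarrow>\<^sub>L 'b::complex_normed_vector) \<Rightarrow> ('i, 'a) linf \<Rightarrow>\<^sub>L ('i, 'b) linf" where
  "map_linf T = Blinfun (\<lambda>x. family (\<lambda>i. blinfun_apply T (coord x i)))"

lemma norm_apply_coord: "norm (blinfun_apply T (coord x i)) \<le> norm T * norm x"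
  by (meson mult_left_mono norm_blinfun norm_coord norm_ge_zero order_trans)

lemma
  fixes T :: "'a::complex_normed_vector \<Rightarrow>\<^sub>L 'b::complex_normed_vector" and x :: "('i, 'a) linf"
  shows map_linf_apply: "blinfun_apply (map_linf T) x = family (\<lambda>i. blinfun_apply T (coord x i))"
  and coord_map_linf [simp]: "coord (blinfun_apply (map_linf T) x) i = blinfun_apply T (coord x i)"
  and norm_map_linf: "norm (map_linf T :: ('i, 'a) linf \<Rightarrow>\<^sub>L ('i, 'b) linf) \<le> norm T"
proof -
  have c: "coord (family (\<lambda>i. blinfun_apply T (coord x i))) i = blinfun_apply T (coord x i)" for x :: "('i, 'a) linf" and i
    by (rule coord_family) (rule norm_apply_coord)
  have "bounded_linear (\<lambda>x :: ('i, 'a) linf. family (\<lambda>i. blinfun_apply T (coord x i)))"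
  proof (rule bounded_linear_intro[where K = "norm T"])
    fix x y :: "('i, 'a) linf" and r :: real
    show "family (\<lambda>i. blinfun_apply T (coord (x + y) i)) =
        family (\<lambda>i. blinfun_apply T (coord x i)) + family (\<lambda>i. blinfun_apply T (coord y i))"
      by (rule linf_eqI, rule trans[OF c]) (simp only: c coord_simps blinfun.add_right)
    show "family (\<lambda>i. blinfun_apply T (coord (r *\<^sub>R x) i)) = r *\<^sub>R family (\<lambda>i. blinfun_apply T (coord x i))"
      by (rule linf_eqI, rule trans[OF c]) (simp only: c coord_simps blinfun.scaleR_right)
    show "norm (family (\<lambda>i. blinfun_apply T (coord x i))) \<le> norm x * norm T"
      by (rule norm_family_le) (simp only: norm_apply_coord mult.commute[of "norm x"])
  qed
  then show a: "blinfun_apply (map_linf T) x = family (\<lambda>i. blinfun_apply T (coord x i))" for x :: "('i, 'a) linf"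
    unfolding map_linf_def by (simp add: bounded_linear_Blinfun_apply)
  show "coord (blinfun_apply (map_linf T) x) i = blinfun_apply T (coord x i)" for x :: "('i, 'a) linf" and i by (simp add: a c)
  show "norm (map_linf T :: ('i, 'a) linf \<Rightarrow>\<^sub>L ('i, 'b) linf) \<le> norm T"
    by (rule norm_blinfun_bound) (auto simp: a intro!: norm_family_le norm_apply_coord)
qed

text \<open>
  Coordinatewise lifts of a bounded family can be chosen bounded, by the open mapping constant.
\<close>

lemma surj_family_linf:
  assumes "surj_family U \<pi>"
  shows "surj_family U (\<lambda>z. map_linf (\<pi> z) :: ('i, 'a::{complex_normed_vector,banach}) linf \<Rightarrow>\<^sub>L ('i, 'b::{complex_normed_vector,banach}) linf)"
proof -
  interpret surj_family U \<pi> by fact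
  show ?thesis
  proof (rule surj_family.intro)
    show "holo (\<lambda>z. map_linf (\<pi> z) :: ('i, 'a) linf \<Rightarrow>\<^sub>L ('i, 'b) linf) U"
    proof (rule holo_linear[OF _ _ holo_pi])
      show "bounded_linear (map_linf :: ('a \<Rightarrow>\<^sub>L 'b) \<Rightarrow> ('i, 'a) linf \<Rightarrow>\<^sub>L ('i, 'b) linf)"
      proof (rule bounded_linear_intro[where K = 1])
        show "map_linf (S + T) = (map_linf S + map_linf T :: ('i, 'a) linf \<Rightarrow>\<^sub>L ('i, 'b) linf)" for S T :: "'a \<Rightarrow>\<^sub>L 'b"
          by (intro blinfun_eqI linf_eqI) (simp add: blinfun.add_left)
        show "map_linf (r *\<^sub>R T) = (r *\<^sub>R map_linf T :: ('i, 'a) linf \<Rightarrow>\<^sub>L ('i, 'b) linf)" for r and T :: "'a \<Rightarrow>\<^sub>L 'b"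
          by (intro blinfun_eqI linf_eqI) (simp add: blinfun.scaleR_left)
        show "norm (map_linf T :: ('i, 'a) linf \<Rightarrow>\<^sub>L ('i, 'b) linf) \<le> norm T * 1" for T :: "'a \<Rightarrow>\<^sub>L 'b"
          by (simp add: norm_map_linf)
      qed
      show "map_linf (c *\<^sub>C T) = (c *\<^sub>C map_linf T :: ('i, 'a) linf \<Rightarrow>\<^sub>L ('i, 'b) linf)" for c and T :: "'a \<Rightarrow>\<^sub>L 'b"
        by (intro blinfun_eqI linf_eqI) simp
    qed
  next
    fix z assume z: "z \<in> U"
    show "blinfun_apply (map_linf (\<pi> z)) (c *\<^sub>C x) = c *\<^sub>C blinfun_apply (map_linf (\<pi> z)) x" for c and x :: "('i, 'a) linf"
      by (rule linf_eqI) (simp add: linear_pi[OF z])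
    obtain C s where C: "C > 0" and s: "\<And>y. blinfun_apply (\<pi> z) (s y) = y" "\<And>y. norm (s y) \<le> C * norm y"
      using open_mapping_bound[OF surj_pi[OF z]] by metis
    show "surj (blinfun_apply (map_linf (\<pi> z) :: ('i, 'a) linf \<Rightarrow>\<^sub>L ('i, 'b) linf))"
    proof (rule surjI)
      fix y :: "('i, 'b) linf"
      have sB: "norm (s (coord y i)) \<le> C * norm y" for i
        using order_trans[OF s(2)[of "coord y i"] mult_left_mono[OF norm_coord[of y i] less_imp_le[OF C]]] .
      show "blinfun_apply (map_linf (\<pi> z)) (family (\<lambda>i. s (coord y i))) = y"
        by (intro linf_eqI) (simp add: coord_family[of "\<lambda>i. s (coord y i)", OF sB] s)
    qed
  qed
qed

section \<open>Analytic maps modulo a closed subspace\<close>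

definition csubspace :: "'x::complex_normed_vector set \<Rightarrow> bool" where
  "csubspace Y \<longleftrightarrow> 0 \<in> Y \<and> (\<forall>x\<in>Y. \<forall>y\<in>Y. x + y \<in> Y) \<and> (\<forall>c. \<forall>x\<in>Y. c *\<^sub>C x \<in> Y)"

lemma csubspaceD:
  assumes "csubspace Y"
  shows "0 \<in> Y" "x \<in> Y \<Longrightarrow> y \<in> Y \<Longrightarrow> x + y \<in> Y" "x \<in> Y \<Longrightarrow> c *\<^sub>C x \<in> Y"
    "x \<in> Y \<Longrightarrow> r *\<^sub>R x \<in> Y" "x \<in> Y \<Longrightarrow> y \<in> Y \<Longrightarrow> x - y \<in> Y"
proof -
  show z: "0 \<in> Y" and a: "\<And>x y. x \<in> Y \<Longrightarrow> y \<in> Y \<Longrightarrow> x + y \<in> Y" and s: "\<And>c x. x \<in> Y \<Longrightarrow> c *\<^sub>C x \<in> Y"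
    using assms by (auto simp: csubspace_def)
  show r: "\<And>r x. x \<in> Y \<Longrightarrow> r *\<^sub>R x \<in> Y" using s scaleC_of_real by metis
  show "x \<in> Y \<Longrightarrow> y \<in> Y \<Longrightarrow> x - y \<in> Y" using a[of x "(-1) *\<^sub>R y"] r[of y "-1"] by simp
qed

lemma csubspace_sum:
  assumes "csubspace Y" "\<And>i. i \<in> I \<Longrightarrow> f i \<in> Y"
  shows "(\<Sum>i\<in>I. f i) \<in> Y"
  using assms(2) by (induction I rule: infinite_finite_induct) (auto simp: csubspaceD[OF assms(1)])

lemma csubspace_closure:
  assumes "csubspace Y"
  shows "csubspace (closure Y)"
  unfolding csubspace_def
proof (intro conjI ballI allI)
  show "0 \<in> closure Y" using csubspaceD(1)[OF assms] closure_subset by blast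
next
  fix x y assume "x \<in> closure Y" "y \<in> closure Y"
  then obtain f g where "\<forall>n. f n \<in> Y" "f \<longlonglongrightarrow> x" "\<forall>n. g n \<in> Y" "g \<longlonglongrightarrow> y"
    unfolding closure_sequential by blast
  then show "x + y \<in> closure Y" unfolding closure_sequential
    using csubspaceD(2)[OF assms] by (intro exI[of _ "\<lambda>n. f n + g n"]) (auto intro: tendsto_add)
next
  fix c x assume "x \<in> closure Y"
  then obtain f where "\<forall>n. f n \<in> Y" "f \<longlonglongrightarrow> x" unfolding closure_sequential by blast
  then show "c *\<^sub>C x \<in> closure Y" unfolding closure_sequential
    using csubspaceD(3)[OF assms]
    by (intro exI[of _ "\<lambda>n. c *\<^sub>C f n"]) (auto intro: scaleC.tendsto)
qed

lemma series_in_closed_subspace: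
  assumes "csubspace Y" "closed Y" "t sums s" "\<And>k. t k \<in> Y"
  shows "s \<in> Y"
proof (rule closed_sequentially[OF assms(2)])
  show "(\<Sum>k<n. t k) \<in> Y" for n by (rule csubspace_sum[OF assms(1,4)])
  show "(\<lambda>n. \<Sum>k<n. t k) \<longlonglongrightarrow> s" using assms(3) by (simp add: sums_def)
qed

text \<open>
  The identity theorem modulo \<open>Y\<close>: one Taylor coefficient after the other is forced into \<open>Y\<close>.
\<close>

lemma identity_mod_subspace:
  fixes a :: "nat \<Rightarrow> 'x::{complex_normed_vector,banach}"
  assumes Y: "csubspace Y" "closed Y" and r: "r > 0"
    and s: "\<And>w. w \<in> ball z r \<Longrightarrow> (\<lambda>k. (w - z) ^ k *\<^sub>C a k) sums F w"
    and acc: "\<And>e. e > 0 \<Longrightarrow> \<exists>w\<in>ball z e. w \<noteq> z \<and> F w \<in> Y"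
  shows "a k \<in> Y" "w \<in> ball z r \<Longrightarrow> F w \<in> Y"
proof -
  have Fz: "F z \<in> Y" if s: "\<And>w. w \<in> ball z r \<Longrightarrow> (\<lambda>k. (w - z) ^ k *\<^sub>C a k) sums F w"
    and acc: "\<And>e. e > 0 \<Longrightarrow> \<exists>w\<in>ball z e. w \<noteq> z \<and> F w \<in> Y" for a F
  proof -
    have "continuous_on (ball z r) F" by (rule holo_continuous_on[OF power_series_holo[OF s]])
    then have cont: "isCont F z" using r by (simp add: continuous_on_eq_continuous_at)
    have "F z \<in> closure Y" unfolding closure_approachable
    proof (intro allI impI)
      fix e :: real assume "e > 0"
      then obtain d where d: "d > 0" "\<And>w. dist w z < d \<Longrightarrow> dist (F w) (F z) < e"
        using cont unfolding continuous_at_eps_delta by blast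
      obtain w where w: "w \<in> ball z d" "F w \<in> Y" using acc[OF d(1)] by blast
      have "dist (F w) (F z) < e" by (rule d(2)) (use w(1) in \<open>simp add: dist_commute\<close>)
      then show "\<exists>y\<in>Y. dist y (F z) < e" using w(2) by blast
    qed
    then show ?thesis using Y(2) by simp
  qed
  have "a k \<in> Y" if s: "\<And>w. w \<in> ball z r \<Longrightarrow> (\<lambda>k. (w - z) ^ k *\<^sub>C a k) sums F w"
    and acc: "\<And>e. e > 0 \<Longrightarrow> \<exists>w\<in>ball z e. w \<noteq> z \<and> F w \<in> Y" for a F k
    using that
  proof (induction k arbitrary: a F)
    case (0 a F)
    show ?case using Fz[OF 0] tail_power_series(1)[OF 0(1) r] by simp
  next
    case (Suc k a F)
    have a0: "F z \<in> Y" by (rule Fz[OF Suc.prems])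
    define G where "G w = (if w = z then a 1 else (1 / (w - z)) *\<^sub>C (F w - F z))" for w
    show ?case
    proof (rule Suc.IH[of "\<lambda>k. a (Suc k)" G])
      show "(\<lambda>k. (w - z) ^ k *\<^sub>C a (Suc k)) sums G w" if "w \<in> ball z r" for w
        unfolding G_def by (rule tail_power_series(3)[OF Suc.prems(1) r that])
      fix e :: real assume "e > 0"
      then obtain w where w: "w \<in> ball z e" "w \<noteq> z" "F w \<in> Y" using Suc.prems(2) by blast
      then have "G w \<in> Y" using a0 by (simp add: G_def csubspaceD[OF Y(1)])
      then show "\<exists>w\<in>ball z e. w \<noteq> z \<and> G w \<in> Y" using w by blast
    qed
  qed
  from this[OF s acc] show ak: "a k \<in> Y" for k by blast
  show "F w \<in> Y" if "w \<in> ball z r"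
    by (rule series_in_closed_subspace[OF Y s[OF that]]) (simp add: csubspaceD(3)[OF Y(1)] ak)
qed

lemma infdist_less:
  assumes "Y \<noteq> {}" "e > 0"
  shows "\<exists>y\<in>Y. dist x y < infdist x Y + e"
proof -
  have "Inf (dist x ` Y) < infdist x Y + e" using assms by (simp add: infdist_notempty)
  then show ?thesis using cInf_lessD[of "dist x ` Y" "infdist x Y + e"] assms(1) by blast
qed

text \<open>
  The distance from \<open>Y\<close> is the norm of the quotient by \<open>Y\<close>; the estimates are those of a seminorm.
\<close>

lemma infdist_subspace:
  assumes Y: "csubspace Y"
  shows "infdist (x + y) Y \<le> infdist x Y + infdist y Y"
    and "r \<ge> 0 \<Longrightarrow> infdist (r *\<^sub>R x) Y \<le> r * infdist x Y"
    and "infdist x Y \<le> norm x"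
    and "x - y \<in> Y \<Longrightarrow> infdist x Y = infdist y Y"
proof -
  have ne: "Y \<noteq> {}" using csubspaceD(1)[OF Y] by blast
  show "infdist x Y \<le> norm x" using infdist_le[OF csubspaceD(1)[OF Y], of x] by (simp only: dist_0_norm dist_commute[of x])
  show add: "infdist (x + y) Y \<le> infdist x Y + infdist y Y" for x y
  proof (rule field_le_epsilon)
    fix e :: real assume e: "e > 0"
    obtain u where u: "u \<in> Y" "dist x u < infdist x Y + e / 2" using infdist_less[OF ne half_gt_zero[OF e], of x] by blast
    obtain v where v: "v \<in> Y" "dist y v < infdist y Y + e / 2" using infdist_less[OF ne half_gt_zero[OF e], of y] by blast
    have "infdist (x + y) Y \<le> dist (x + y) (u + v)" by (rule infdist_le[OF csubspaceD(2)[OF Y u(1) v(1)]])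
    also have "\<dots> \<le> dist x u + dist y v" by (rule dist_triangle_add)
    finally show "infdist (x + y) Y \<le> infdist x Y + infdist y Y + e" using u(2) v(2) by simp
  qed
  show "infdist (r *\<^sub>R x) Y \<le> r * infdist x Y" if r: "r \<ge> 0"
  proof (rule field_le_epsilon)
    fix e :: real assume e: "e > 0"
    have er: "e / (r + 1) > 0" using e r by simp
    obtain u where u: "u \<in> Y" "dist x u < infdist x Y + e / (r + 1)"
      using infdist_less[OF ne er, of x] by blast
    have "infdist (r *\<^sub>R x) Y \<le> dist (r *\<^sub>R x) (r *\<^sub>R u)" by (rule infdist_le[OF csubspaceD(4)[OF Y u(1)]])
    also have "\<dots> = r * dist x u" using r by (simp add: dist_norm flip: scaleR_diff_right)
    also have "\<dots> \<le> r * (infdist x Y + e / (r + 1))" using u r by (intro mult_left_mono) auto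
    also have "\<dots> \<le> r * infdist x Y + e" using e r by (simp add: field_simps)
    finally show "infdist (r *\<^sub>R x) Y \<le> r * infdist x Y + e" .
  qed
  have le: "infdist x Y \<le> infdist y Y" if "x - y \<in> Y" for x y
  proof -
    have "infdist x Y \<le> infdist y Y + infdist (x - y) Y" using add[of y "x - y"] by simp
    then show ?thesis using that by simp
  qed
  show "infdist x Y = infdist y Y" if "x - y \<in> Y"
    using le[OF that] le[of y x] csubspaceD(4)[OF Y that, of "-1"] by simp
qed

text \<open>
  Averaging a power series over the four points \<open>z \<plusminus> h\<close>, \<open>z \<plusminus> \<i> h\<close> cancels the terms of degree
  one, two and three. So the distance from \<open>Y\<close> is subharmonic up to an error of order \<open>h\<^sup>4\<close>, which is
  small compared with the gain of order \<open>h\<^sup>2\<close> from a perturbation by \<open>\<epsilon> |z|\<^sup>2\<close>.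
\<close>

lemma four_point_mean:
  fixes a :: "nat \<Rightarrow> 'x::{complex_normed_vector,banach}"
  assumes Y: "csubspace Y" and r: "r > 0"
    and s: "\<And>w. w \<in> ball z r \<Longrightarrow> (\<lambda>k. (w - z) ^ k *\<^sub>C a k) sums F w"
  obtains C \<delta> where "C > 0" "\<delta> > 0" "\<delta> < r" "\<And>h. 0 < h \<Longrightarrow> h \<le> \<delta> \<Longrightarrow> 4 * infdist (F z) Y \<le>
    infdist (F (z + of_real h)) Y + infdist (F (z + \<i> * of_real h)) Y +
    infdist (F (z - of_real h)) Y + infdist (F (z - \<i> * of_real h)) Y + C * h ^ 4"
proof -
  define \<rho> where "\<rho> = r / 2"
  have \<rho>: "\<rho> > 0" "\<rho> < r" using r by (auto simp: \<rho>_def)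
  have "(\<lambda>k. (complex_of_real \<rho>) ^ k *\<^sub>C a k) sums F (z + of_real \<rho>)"
    using s[of "z + of_real \<rho>"] \<rho> by (simp add: dist_norm)
  then obtain M where M: "M > 0" "\<And>k. norm (a k) * \<rho> ^ k \<le> M"
    using power_series_coeff_bound[of "of_real \<rho>" a] \<rho> by (auto simp: sums_iff)
  define C where "C = 8 * M / \<rho> ^ 4"
  have "C > 0" using M \<rho> by (simp add: C_def)
  define P where "P w = (\<Sum>k<4. w ^ k *\<^sub>C a k)" for w
  have rest: "norm (F (z + w) - P w) \<le> C / 4 * h ^ 4" if w: "norm w = h" "0 < h" "h \<le> \<rho> / 2" for w h
  proof -
    have q: "0 \<le> h / \<rho>" "h / \<rho> \<le> 1 / 2" "h / \<rho> < 1" using w \<rho> by (auto simp: field_simps)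
    have sw: "(\<lambda>k. w ^ k *\<^sub>C a k) sums F (z + w)" using s[of "z + w"] w \<rho> by (simp add: dist_norm)
    have t: "norm (w ^ k *\<^sub>C a k) \<le> M * (h / \<rho>) ^ k" for k
    proof -
      have "norm (w ^ k *\<^sub>C a k) = h ^ k * (norm (a k) * \<rho> ^ k) / \<rho> ^ k"
        using w \<rho> by (simp add: norm_scaleC norm_power)
      also have "\<dots> \<le> h ^ k * M / \<rho> ^ k"
        using M w \<rho> by (intro divide_right_mono mult_left_mono) auto
      finally show ?thesis by (simp add: power_divide mult.commute)
    qed
    have "norm (F (z + w) - P w) \<le> M * (h / \<rho>) ^ 4 / (1 - h / \<rho>)"
      unfolding P_def by (rule geometric_tail_bound[OF sw q(1,3) t])
    also have "\<dots> \<le> M * (h / \<rho>) ^ 4 / (1 / 2)"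
      using q M by (intro divide_left_mono) auto
    also have "\<dots> = C / 4 * h ^ 4" by (simp add: C_def power_divide)
    finally show ?thesis .
  qed
  have PP: "P (of_real h) + P (\<i> * of_real h) + P (- of_real h) + P (- (\<i> * of_real h)) = 4 *\<^sub>R a 0" for h
  proof -
    let ?h = "complex_of_real h"
    have c: "?h\<^sup>2 + (\<i> * ?h)\<^sup>2 + (- ?h)\<^sup>2 + (- (\<i> * ?h))\<^sup>2 = 0"
      "?h ^ 3 + (\<i> * ?h) ^ 3 + (- ?h) ^ 3 + (- (\<i> * ?h)) ^ 3 = 0"
      by (simp add: power_mult_distrib) (simp add: power3_eq_cube)
    have "P (of_real h) + P (\<i> * of_real h) + P (- of_real h) + P (- (\<i> * of_real h))
        = (\<Sum>k<4. ((of_real h) ^ k + (\<i> * of_real h) ^ k + (- of_real h) ^ k + (- (\<i> * of_real h)) ^ k) *\<^sub>C a k)"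
      unfolding P_def scaleC_add_left sum.distrib ..
    also have "{..<4::nat} = {0, 1, 2, 3}" by auto
    also have "(\<Sum>k\<in>{0, 1, 2, 3}. ((of_real h) ^ k + (\<i> * of_real h) ^ k + (- of_real h) ^ k + (- (\<i> * of_real h)) ^ k) *\<^sub>C a k)
        = 4 *\<^sub>C a 0" using c by simp
    finally show ?thesis using scaleC_of_real[of 4 "a 0"] by simp
  qed
  have a0: "a 0 = F z" by (rule tail_power_series(1)[OF s r])
  have Yc: "infdist x Y \<le> infdist y Y + norm (y - x)" for x y :: 'x
    using infdist_subspace(1)[OF Y, of y "x - y"] infdist_subspace(3)[OF Y, of "x - y"]
    by (simp add: norm_minus_commute)
  have main: "4 * infdist (F z) Y \<le>
    infdist (F (z + of_real h)) Y + infdist (F (z + \<i> * of_real h)) Y +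
    infdist (F (z - of_real h)) Y + infdist (F (z - \<i> * of_real h)) Y + C * h ^ 4"
    if h: "0 < h" "h \<le> \<rho> / 2" for h
  proof -
    let ?h = "complex_of_real h"
    have n: "norm ?h = h" "norm (\<i> * ?h) = h" "norm (- ?h) = h" "norm (- (\<i> * ?h)) = h"
      using h by (simp_all add: norm_mult)
    have "infdist (F z) Y = infdist ((1 / 4) *\<^sub>R (P ?h + P (\<i> * ?h) + P (- ?h) + P (- (\<i> * ?h)))) Y"
      by (simp add: PP a0)
    also have "\<dots> \<le> 1 / 4 * infdist (P ?h + P (\<i> * ?h) + P (- ?h) + P (- (\<i> * ?h))) Y"
      by (rule infdist_subspace(2)[OF Y]) simp
    finally have "4 * infdist (F z) Y \<le> infdist (P ?h + P (\<i> * ?h) + P (- ?h) + P (- (\<i> * ?h))) Y" by simp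
    also have "\<dots> \<le> infdist (P ?h) Y + infdist (P (\<i> * ?h)) Y + infdist (P (- ?h)) Y + infdist (P (- (\<i> * ?h))) Y"
      using infdist_subspace(1)[OF Y, of "P ?h + P (\<i> * ?h) + P (- ?h)" "P (- (\<i> * ?h))"]
        infdist_subspace(1)[OF Y, of "P ?h + P (\<i> * ?h)" "P (- ?h)"]
        infdist_subspace(1)[OF Y, of "P ?h" "P (\<i> * ?h)"] by linarith
    finally show ?thesis
      using Yc[of "P ?h" "F (z + ?h)"] Yc[of "P (\<i> * ?h)" "F (z + \<i> * ?h)"]
        Yc[of "P (- ?h)" "F (z - ?h)"] Yc[of "P (- (\<i> * ?h))" "F (z - \<i> * ?h)"]
        rest[OF n(1) h] rest[OF n(2) h] rest[OF n(3) h] rest[OF n(4) h]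
      by simp
  qed
  have d: "\<rho> / 2 > 0" "\<rho> / 2 < r" using \<rho> by auto
  show ?thesis by (rule that[OF \<open>C > 0\<close> d main])
qed

lemma four_point_square:
  "4 * (norm z)\<^sup>2 + 4 * h\<^sup>2 = (norm (z + of_real h))\<^sup>2 + (norm (z + \<i> * of_real h))\<^sup>2 +
     (norm (z - of_real h))\<^sup>2 + (norm (z - \<i> * of_real h))\<^sup>2"
  by (simp add: cmod_power2) (simp add: power2_eq_square algebra_simps)

text \<open>
  Liouville's theorem modulo \<open>Y\<close>. The map is only given locally, by representatives \<open>x\<close> with
  \<open>adm w x\<close> whose differences lie in \<open>Y\<close>. The distance of the representatives from \<open>Y\<close> is a
  function \<open>u\<close> on the plane with a sub-mean value property, so \<open>u w + \<epsilon> |w|\<^sup>2\<close> has no local maximum.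
  As \<open>u\<close> vanishes at infinity, it is zero everywhere.
\<close>

lemma liouville_mod_subspace:
  fixes adm :: "complex \<Rightarrow> 'x::{complex_normed_vector,banach} \<Rightarrow> bool"
  assumes Y: "csubspace Y" "closed Y"
    and loc: "\<And>z. \<exists>r>0. \<exists>F a. \<forall>w\<in>ball z r. (\<lambda>k. (w - z) ^ k *\<^sub>C a k) sums F w \<and> adm w (F w)"
    and diff: "\<And>w x y. adm w x \<Longrightarrow> adm w y \<Longrightarrow> x - y \<in> Y"
    and inf: "\<And>e. e > 0 \<Longrightarrow> \<exists>R. \<forall>w. norm w \<ge> R \<longrightarrow> (\<exists>x. adm w x \<and> norm x \<le> e)"
    and adm: "adm w x"
  shows "x \<in> Y"
proof -
  have ex: "\<exists>x. adm w x" for w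
  proof -
    obtain r F a where "r > 0" "\<forall>v\<in>ball w r. (\<lambda>k. (v - w) ^ k *\<^sub>C a k) sums F v \<and> adm v (F v)"
      using loc by meson
    then show ?thesis using centre_in_ball by blast
  qed
  define u where "u w = infdist (SOME x. adm w x) Y" for w
  have u: "u w = infdist x Y" if "adm w x" for w x
    unfolding u_def using infdist_subspace(4)[OF Y(1) diff[OF someI_ex[OF ex] that]] .
  have u_cont: "continuous_on UNIV u"
  proof (intro continuous_at_imp_continuous_on ballI)
    fix z
    obtain r F a where r: "r > 0" and F: "\<forall>w\<in>ball z r. (\<lambda>k. (w - z) ^ k *\<^sub>C a k) sums F w \<and> adm w (F w)"
      using loc by meson
    have "continuous_on (ball z r) F" using power_series_holo[of z r a F] F holo_continuous_on by blast
    then have "continuous_on (ball z r) (\<lambda>w. infdist (F w) Y)" by (rule continuous_on_infdist)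
    then have "continuous_on (ball z r) u"
    proof (rule continuous_on_eq)
      show "infdist (F w) Y = u w" if "w \<in> ball z r" for w
        using u[of w "F w"] bspec[OF F that] by simp
    qed
    then show "isCont u z" using r by (simp add: continuous_on_eq_continuous_at)
  qed
  have mean: "\<exists>C \<delta>. C > 0 \<and> \<delta> > 0 \<and> (\<forall>h. 0 < h \<longrightarrow> h \<le> \<delta> \<longrightarrow> 4 * u z \<le> u (z + of_real h) + u (z + \<i> * of_real h)
      + u (z - of_real h) + u (z - \<i> * of_real h) + C * h ^ 4)" for z
  proof -
    obtain r F a where r: "r > 0" and F: "\<forall>w\<in>ball z r. (\<lambda>k. (w - z) ^ k *\<^sub>C a k) sums F w \<and> adm w (F w)"
      using loc by meson
    have s: "\<And>w. w \<in> ball z r \<Longrightarrow> (\<lambda>k. (w - z) ^ k *\<^sub>C a k) sums F w" using F by blast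
    obtain C \<delta> where C: "C > 0" "\<delta> > 0" "\<delta> < r" and m: "\<And>h. 0 < h \<Longrightarrow> h \<le> \<delta> \<Longrightarrow> 4 * infdist (F z) Y \<le>
      infdist (F (z + of_real h)) Y + infdist (F (z + \<i> * of_real h)) Y +
      infdist (F (z - of_real h)) Y + infdist (F (z - \<i> * of_real h)) Y + C * h ^ 4"
      using four_point_mean[OF Y(1) r s] by blast
    have uF: "u w = infdist (F w) Y" if "w \<in> ball z r" for w using F u that by blast
    have "4 * u z \<le> u (z + of_real h) + u (z + \<i> * of_real h)
      + u (z - of_real h) + u (z - \<i> * of_real h) + C * h ^ 4" if "0 < h" "h \<le> \<delta>" for h
      using m[OF that] that C(3) r
      by (subst (1 2 3 4 5) uF) (auto simp: dist_norm norm_mult)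
    then show ?thesis using C by blast
  qed
  have u0: "u w = 0" for w
  proof (rule ccontr)
    assume "u w \<noteq> 0"
    then have uw: "u w > 0" unfolding u_def using infdist_nonneg[of _ Y] by (simp add: less_le)
    obtain R0 where R0: "\<And>v. norm v \<ge> R0 \<Longrightarrow> \<exists>x. adm v x \<and> norm x \<le> u w / 4"
      using inf[of "u w / 4"] uw by auto
    define R where "R = max R0 (norm w + 1)"
    have R: "R > 0" "norm w < R" "R \<ge> R0" using norm_ge_zero[of w] by (auto simp: R_def simp del: norm_ge_zero)
    have u_far: "u v \<le> u w / 4" if "norm v = R" for v
    proof -
      have "norm v \<ge> R0" using that R by simp
      then obtain x where "adm v x" "norm x \<le> u w / 4" using R0 by blast
      then show ?thesis using u[of v x] infdist_subspace(3)[OF Y(1), of x] by simp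
    qed
    define \<epsilon> where "\<epsilon> = u w / (4 * R\<^sup>2)"
    have \<epsilon>: "\<epsilon> > 0" "\<epsilon> * R\<^sup>2 = u w / 4" using uw R by (auto simp: \<epsilon>_def)
    define v where "v z = u z + \<epsilon> * (norm z)\<^sup>2" for z
    have "continuous_on (cball 0 R) v" unfolding v_def
      by (intro continuous_intros continuous_on_subset[OF u_cont]) auto
    then obtain z where z: "z \<in> cball 0 R" "\<And>y. y \<in> cball 0 R \<Longrightarrow> v y \<le> v z"
      using continuous_attains_sup[of "cball 0 R" v] R by auto
    have wz: "u w \<le> v z" using z(2)[of w] R \<epsilon> by (simp add: v_def) (smt (verit) mult_nonneg_nonneg zero_le_power2)
    show False
    proof (cases "norm z = R")
      case True
      then have "v z \<le> u w / 4 + u w / 4" using u_far[of z] \<epsilon>(2) by (simp add: v_def)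
      then show False using wz uw by simp
    next
      case False
      then have zR: "norm z < R" using z(1) by simp
      obtain C \<delta> where C: "C > 0" "\<delta> > 0" and m: "\<And>h. 0 < h \<Longrightarrow> h \<le> \<delta> \<Longrightarrow> 4 * u z \<le> u (z + of_real h) + u (z + \<i> * of_real h)
        + u (z - of_real h) + u (z - \<i> * of_real h) + C * h ^ 4" using mean[of z] by blast
      define h where "h = min \<delta> (min (R - norm z) (sqrt (\<epsilon> / C)))"
      have h: "0 < h" "h \<le> \<delta>" "h \<le> R - norm z" "h \<le> sqrt (\<epsilon> / C)" using C \<epsilon> zR by (auto simp: h_def)
      have "h\<^sup>2 \<le> (sqrt (\<epsilon> / C))\<^sup>2" by (rule power_mono[OF h(4)]) (use h in simp)
      then have hC: "C * h\<^sup>2 \<le> \<epsilon>" using C \<epsilon> by (simp add: field_simps)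
      have "h ^ 4 = h\<^sup>2 * h\<^sup>2" by (simp add: power2_eq_square power4_eq_xxxx)
      then have h4: "C * h ^ 4 \<le> \<epsilon> * h\<^sup>2" using mult_right_mono[OF hC, of "h\<^sup>2"] by (simp add: mult.assoc)
      have pts: "v (z + of_real h) \<le> v z" "v (z + \<i> * of_real h) \<le> v z" "v (z - of_real h) \<le> v z" "v (z - \<i> * of_real h) \<le> v z"
      proof -
        have "norm (z + d) \<le> R" if "norm d = h" for d
          using norm_triangle_ineq[of z d] h(3) that by simp
        from this[of "of_real h"] this[of "\<i> * of_real h"] this[of "- of_real h"] this[of "- (\<i> * of_real h)"] h(1)
        show "v (z + of_real h) \<le> v z" "v (z + \<i> * of_real h) \<le> v z" "v (z - of_real h) \<le> v z" "v (z - \<i> * of_real h) \<le> v z"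
          by (auto intro!: z(2) simp: norm_mult)
      qed
      have "\<epsilon> * (4 * (norm z)\<^sup>2 + 4 * h\<^sup>2) = \<epsilon> * (norm (z + of_real h))\<^sup>2 + \<epsilon> * (norm (z + \<i> * of_real h))\<^sup>2 +
         \<epsilon> * (norm (z - of_real h))\<^sup>2 + \<epsilon> * (norm (z - \<i> * of_real h))\<^sup>2"
        unfolding four_point_square by (simp add: distrib_left)
      then have "4 * (\<epsilon> * h\<^sup>2) \<le> C * h ^ 4"
        using m[OF h(1,2)] pts unfolding v_def by (simp add: algebra_simps)
      moreover have "\<epsilon> * h\<^sup>2 > 0" using \<epsilon> h by simp
      ultimately show False using h4 by simp
    qed
  qed
  have "infdist x Y = 0" using u[OF adm] u0 by simp
  then show ?thesis using in_closed_iff_infdist_zero[OF Y(2)] csubspaceD(1)[OF Y(1)] by blast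
qed

section \<open>Simultaneous approximation of lifts and of their images\<close>

lemma holo_Pair:
  assumes "holo f S" "holo g S"
  shows "holo (\<lambda>z. (f z, g z)) S"
proof (rule holoI[where f' = "\<lambda>z. (cderiv f z, cderiv g z)"])
  show "open S" using holoD[OF assms(1)] by auto
  show "continuous_on S (\<lambda>z. (cderiv f z, cderiv g z))"
    using holoD(2)[OF assms(1)] holoD(2)[OF assms(2)] by (intro continuous_intros)
  show "has_cderiv (\<lambda>z. (f z, g z)) (cderiv f z, cderiv g z) z" if "z \<in> S" for z
    using has_derivative_Pair[OF holoD(3)[OF assms(1) that] holoD(3)[OF assms(2) that]] by simp
qed

lemma cderiv_cong:
  assumes "holo f S" "z \<in> S" "\<And>w. w \<in> S \<Longrightarrow> g w = f w"
  shows "cderiv g z = cderiv f z"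
  by (rule cderiv_eq, rule has_derivative_transform_within_open[OF holoD(3)[OF assms(1,2)] holoD(1)[OF assms(1)] assms(2)])
    (simp add: assms(3))

lemma cderiv_diff:
  assumes "holo f S" "holo g S" "z \<in> S"
  shows "cderiv (\<lambda>w. f w - g w) z = cderiv f z - cderiv g z"
  using has_derivative_diff[OF holoD(3)[OF assms(1,3)] holoD(3)[OF assms(2,3)]]
  by (intro cderiv_eq) (simp add: scaleC.diff_right)

lemma cderiv_const: "cderiv (\<lambda>w. c) z = 0"
  by (intro cderiv_eq) simp

lemma cderiv_linear:
  assumes "bounded_linear L" "\<And>c x. L (c *\<^sub>C x) = c *\<^sub>C L x" "holo f S" "z \<in> S"
  shows "cderiv (\<lambda>w. L (f w)) z = L (cderiv f z)"
  using bounded_linear.has_derivative[OF assms(1) holoD(3)[OF assms(3,4)]] assms(2)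
  by (intro cderiv_eq) simp

lemma cderiv_vanishing:
  assumes "holo g S" "z \<in> S"
  shows "cderiv (\<lambda>w. (w - z) *\<^sub>C g w) z = g z"
proof (rule cderiv_eq)
  have "((\<lambda>w. w - z) has_derivative (\<lambda>h. h)) (at z)" by (auto intro!: derivative_eq_intros)
  from scaleC.FDERIV[OF this holoD(3)[OF assms]]
  show "has_cderiv (\<lambda>w. (w - z) *\<^sub>C g w) (g z) z" by simp
qed

lemma zero_quot_bounded:
  fixes \<phi> :: "complex \<Rightarrow> 'a::{complex_normed_vector,banach}"
  assumes \<phi>: "holo \<phi> S" and K: "compact K" "K \<subseteq> S" and z: "\<mu> \<in> K \<Longrightarrow> \<phi> \<mu> = 0"
  shows "\<exists>M\<ge>0. \<forall>z\<in>K. norm (zero_quot \<phi> \<mu> z) \<le> M"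
proof -
  have "continuous_on K (zero_quot \<phi> \<mu>)"
  proof (cases "\<mu> \<in> K")
    case True
    then have "zero_quot \<phi> \<mu> = slope \<phi> \<mu>" using z by (simp add: zero_quot_def slope_def fun_eq_iff)
    then show ?thesis using continuous_on_subset[OF holo_continuous_on[OF holo_slope[OF \<phi>]] K(2)] by simp
  next
    case False
    have "continuous_on K (\<lambda>z. (1 / (z - \<mu>)) *\<^sub>C \<phi> z)"
      using False by (intro continuous_intros continuous_on_subset[OF holo_continuous_on[OF \<phi>] K(2)]) auto
    then show ?thesis by (rule continuous_on_eq) (use False in \<open>auto simp: zero_quot_def\<close>)
  qed
  from compact_imp_bounded[OF compact_continuous_image[OF this K(1)]]
  obtain M where "M > 0" "\<forall>u\<in>zero_quot \<phi> \<mu> ` K. norm u \<le> M" unfolding bounded_pos by blast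
  then show ?thesis by (intro exI[of _ M]) auto
qed

lemma holo_bounded_compact:
  fixes f :: "complex \<Rightarrow> 'a::{complex_normed_vector,banach}"
  assumes "holo f S" "compact K" "K \<subseteq> S"
  shows "\<exists>M\<ge>0. \<forall>z\<in>K. norm (f z) \<le> M"
proof -
  from compact_imp_bounded[OF compact_continuous_image[OF continuous_on_subset[OF holo_continuous_on[OF assms(1)] assms(3)] assms(2)]]
  obtain M where "M > 0" "\<forall>u\<in>f ` K. norm u \<le> M" unfolding bounded_pos by blast
  then show ?thesis by (intro exI[of _ M]) auto
qed

text \<open>
  An approximation theorem of Runge type: a lift given near \<open>K\<close> is approximated on \<open>K\<close> by analytic
  maps near the larger set \<open>K'\<close> whose images are, at the same time, close to the prescribed one on \<open>K'\<close>.
  Pairs (map on \<open>K\<close>, image on \<open>K'\<close>) are encoded as one bounded family over \<open>K'\<close> with values in the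
  product space; the first component is set to zero off \<open>K\<close>. Approximation means membership in the
  closure \<open>Y\<close> of the pairs \<open>(g, \<pi> g)\<close> with \<open>g\<close> analytic near \<open>K'\<close>.
\<close>

locale lift_pair = surj_family U \<pi>
  for U :: "complex set"
    and \<pi> :: "complex \<Rightarrow> 'a::{complex_normed_vector,banach} \<Rightarrow>\<^sub>L 'b::{complex_normed_vector,banach}" +
  fixes K K' :: "complex set"
  assumes K: "compact K" "K \<subseteq> K'" and K': "compact K'" "K' \<subseteq> U"
begin

definition res :: "(complex \<Rightarrow> 'a \<times> 'b) \<Rightarrow> (complex, 'a \<times> 'b) linf" where
  "res f = family (\<lambda>z. if z \<in> K' then f z else 0)"

definition both :: "(complex \<Rightarrow> 'a) \<Rightarrow> (complex \<Rightarrow> 'b) \<Rightarrow> complex \<Rightarrow> 'a \<times> 'b" where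
  "both k h z = (if z \<in> K then k z else 0, h z)"

text \<open>
  The pair \<open>(k, h) - (c, \<pi> c)\<close> for a constant \<open>c\<close>, divided by \<open>z - \<mu>\<close>.
\<close>

definition quot :: "(complex \<Rightarrow> 'a) \<Rightarrow> (complex \<Rightarrow> 'b) \<Rightarrow> complex \<Rightarrow> 'a \<Rightarrow> complex \<Rightarrow> 'a \<times> 'b" where
  "quot k h \<mu> c = both (zero_quot (\<lambda>z. k z - c) \<mu>) (zero_quot (\<lambda>z. h z - blinfun_apply (\<pi> z) c) \<mu>)"

definition lifts :: "(complex, 'a \<times> 'b) linf set" where
  "lifts = {res (both g (\<lambda>z. blinfun_apply (\<pi> z) (g z))) | g. \<exists>V. K' \<subseteq> V \<and> V \<subseteq> U \<and> holo g V}"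

lemma coord_res:
  assumes "\<And>z. z \<in> K' \<Longrightarrow> norm (f z) \<le> M"
  shows "coord (res f) z = (if z \<in> K' then f z else 0)"
  unfolding res_def
proof (rule coord_family[where M = "max M 0"])
  show "norm (if i \<in> K' then f i else 0) \<le> max M 0" for i using assms[of i] by auto
qed

lemma norm_res_le: "0 \<le> M \<Longrightarrow> (\<And>z. z \<in> K' \<Longrightarrow> norm (f z) \<le> M) \<Longrightarrow> norm (res f) \<le> M"
  unfolding res_def by (rule norm_family_le) auto

lemma res_cong: "(\<And>z. z \<in> K' \<Longrightarrow> f z = g z) \<Longrightarrow> res f = res g"
  unfolding res_def by (rule arg_cong[of _ _ family]) auto

lemma both_bounded:
  assumes "\<exists>M\<ge>0. \<forall>z\<in>K. norm (k z) \<le> M" "\<exists>M\<ge>0. \<forall>z\<in>K'. norm (h z) \<le> M"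
  shows "\<exists>M\<ge>0. \<forall>z\<in>K'. norm (both k h z) \<le> M"
proof -
  obtain A B where A: "A \<ge> 0" "\<forall>z\<in>K. norm (k z) \<le> A" and B: "B \<ge> 0" "\<forall>z\<in>K'. norm (h z) \<le> B"
    using assms by blast
  have "norm (both k h z) \<le> A + B" if "z \<in> K'" for z
    unfolding both_def using A B that by (intro order_trans[OF norm_Pair_le] add_mono) auto
  then show ?thesis using A B by (intro exI[of _ "A + B"]) auto
qed

lemma res_linear:
  assumes f: "\<exists>M\<ge>0. \<forall>z\<in>K'. norm (f z) \<le> M" and g: "\<exists>M\<ge>0. \<forall>z\<in>K'. norm (g z) \<le> M"
  shows "res (\<lambda>z. f z + g z) = res f + res g" "res (\<lambda>z. f z - g z) = res f - res g"
    "res (\<lambda>z. c *\<^sub>C f z) = c *\<^sub>C res f"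
proof -
  obtain A B where A: "\<And>z. z \<in> K' \<Longrightarrow> norm (f z) \<le> A" and B: "\<And>z. z \<in> K' \<Longrightarrow> norm (g z) \<le> B"
    using f g by blast
  have p: "norm (f z + g z) \<le> A + B" if "z \<in> K'" for z
    using A[OF that] B[OF that] norm_triangle_ineq[of "f z" "g z"] by simp
  have m: "norm (f z - g z) \<le> A + B" if "z \<in> K'" for z
    using A[OF that] B[OF that] norm_triangle_ineq4[of "f z" "g z"] by simp
  have s: "norm (c *\<^sub>C f z) \<le> norm c * A" if "z \<in> K'" for z
    using A[OF that] by (simp add: norm_scaleC mult_left_mono)
  show "res (\<lambda>z. f z + g z) = res f + res g"
    by (rule linf_eqI) (simp add: coord_res[OF p] coord_res[OF A] coord_res[OF B])
  show "res (\<lambda>z. f z - g z) = res f - res g"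
    by (rule linf_eqI) (simp add: coord_res[OF m] coord_res[OF A] coord_res[OF B])
  show "res (\<lambda>z. c *\<^sub>C f z) = c *\<^sub>C res f"
    by (rule linf_eqI) (simp add: coord_res[OF s] coord_res[OF A])
qed

lemma lift_bounded:
  assumes "holo g V" "K' \<subseteq> V" "V \<subseteq> U"
  shows "\<exists>M\<ge>0. \<forall>z\<in>K'. norm (both g (\<lambda>z. blinfun_apply (\<pi> z) (g z)) z) \<le> M"
  by (intro both_bounded holo_bounded_compact[OF assms(1)] holo_bounded_compact[OF holo_apply[OF assms(1,3)]])
    (use K K' assms in auto)

lemma csubspace_lifts: "csubspace lifts"
  unfolding csubspace_def
proof (intro conjI ballI allI)
  have "res (both (\<lambda>z. 0) (\<lambda>z. blinfun_apply (\<pi> z) 0)) = 0"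
    by (rule linf_eqI) (simp add: res_def both_def zero_prod_def[symmetric] coord_family[where M = 0])
  then show "0 \<in> lifts" unfolding lifts_def using K'(2) holo_const[OF open_U, of "0 :: 'a"]
    by (auto intro!: exI[of _ "\<lambda>z. 0"] exI[of _ U])
next
  fix x y assume "x \<in> lifts" "y \<in> lifts"
  then obtain f V g W where f: "x = res (both f (\<lambda>z. blinfun_apply (\<pi> z) (f z)))" "K' \<subseteq> V" "V \<subseteq> U" "holo f V"
    and g: "y = res (both g (\<lambda>z. blinfun_apply (\<pi> z) (g z)))" "K' \<subseteq> W" "W \<subseteq> U" "holo g W"
    unfolding lifts_def by blast
  have o: "open (V \<inter> W)" using holoD(1)[OF f(4)] holoD(1)[OF g(4)] by blast
  have "holo (\<lambda>z. f z + g z) (V \<inter> W)"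
    by (intro holo_add holo_subset[OF f(4)] holo_subset[OF g(4)] o) auto
  moreover have "x + y = res (\<lambda>z. both f (\<lambda>z. blinfun_apply (\<pi> z) (f z)) z + both g (\<lambda>z. blinfun_apply (\<pi> z) (g z)) z)"
    unfolding f(1) g(1) by (rule res_linear(1)[OF lift_bounded[OF f(4,2,3)] lift_bounded[OF g(4,2,3)], symmetric])
  moreover have "\<dots> = res (both (\<lambda>z. f z + g z) (\<lambda>z. blinfun_apply (\<pi> z) (f z + g z)))"
    by (rule res_cong) (simp add: both_def blinfun.add_right)
  ultimately show "x + y \<in> lifts" unfolding lifts_def using f g by (auto intro!: exI[of _ "V \<inter> W"])
next
  fix c x assume "x \<in> lifts"
  then obtain f V where f: "x = res (both f (\<lambda>z. blinfun_apply (\<pi> z) (f z)))" "K' \<subseteq> V" "V \<subseteq> U" "holo f V"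
    unfolding lifts_def by blast
  have "holo (\<lambda>z. c *\<^sub>C f z) V" by (intro holo_scaleC holo_const f holoD(1)[OF f(4)])
  moreover have "c *\<^sub>C x = res (\<lambda>z. c *\<^sub>C both f (\<lambda>z. blinfun_apply (\<pi> z) (f z)) z)"
    unfolding f(1) by (rule res_linear(3)[OF lift_bounded[OF f(4,2,3)] lift_bounded[OF f(4,2,3)], symmetric])
  moreover have "\<dots> = res (both (\<lambda>z. c *\<^sub>C f z) (\<lambda>z. blinfun_apply (\<pi> z) (c *\<^sub>C f z)))"
    by (rule res_cong) (use K' in \<open>auto simp: both_def linear_pi\<close>)
  ultimately show "c *\<^sub>C x \<in> lifts" unfolding lifts_def using f by (auto intro!: exI[of _ "V"])
qed

definition Y :: "(complex, 'a \<times> 'b) linf set" where "Y = closure lifts"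

lemma Y: "csubspace Y" "closed Y"
  unfolding Y_def using csubspace_closure[OF csubspace_lifts] by auto

lemma lift_in_Y: "K' \<subseteq> V \<Longrightarrow> V \<subseteq> U \<Longrightarrow> holo g V \<Longrightarrow> res (both g (\<lambda>z. blinfun_apply (\<pi> z) (g z))) \<in> Y"
  unfolding Y_def lifts_def by (rule subsetD[OF closure_subset]) blast

text \<open>
  As a function of the pole \<open>w\<close>, the coordinate \<open>i\<close> of the quotient is \<open>- N i w / (w - i)\<close>, where \<open>N i\<close> is
  analytic and vanishes at \<open>w = i\<close> because \<open>c\<close> is a lift. So \<open>zero_quot_family\<close> applies with the roles of
  variable and pole exchanged. At \<open>w = i\<close> the derivative with respect to the
  pole is minus the derivative with respect to the variable, because \<open>c\<close> lifts the data near \<open>w\<close>.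
\<close>

lemma quot_power_series:
  assumes V: "K \<subseteq> V" "V \<subseteq> U" "holo k V" and h: "holo h U"
    and \<rho>: "\<rho> > 0" and c: "holo c S" "cball z (4 * \<rho>) \<subseteq> S"
    and ck: "ball z (4 * \<rho>) \<inter> K = {} \<or> (ball z (4 * \<rho>) \<subseteq> V \<and> (\<forall>w\<in>ball z (4 * \<rho>). c w = k w))"
    and ch: "ball z (4 * \<rho>) \<inter> K' = {} \<or>
      (ball z (4 * \<rho>) \<subseteq> U \<and> (\<forall>w\<in>ball z (4 * \<rho>). blinfun_apply (\<pi> w) (c w) = h w))"
  shows "\<exists>a. \<forall>w\<in>ball z (\<rho> / 2). (\<lambda>j. (w - z) ^ j *\<^sub>C a j) sums res (quot k h w (c w))"
proof -
  let ?B = "ball z (4 * \<rho>)"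
  have cB: "holo c ?B" by (rule holo_subset[OF c(1)]) (use c(2) in auto)
  obtain C where C: "C > 0" "\<And>w. w \<in> cball z (4 * \<rho>) \<Longrightarrow> norm (c w) \<le> C"
    using holo_bounded_smaller_ball[OF c] by blast
  obtain P where P: "P \<ge> 0" "\<forall>z\<in>K'. norm (\<pi> z) \<le> P" using holo_bounded_compact[OF holo_pi K'] by blast
  obtain A where A: "A \<ge> 0" "\<forall>z\<in>K. norm (k z) \<le> A" using holo_bounded_compact[OF V(3) K(1) V(1)] by blast
  obtain B where B: "B \<ge> 0" "\<forall>z\<in>K'. norm (h z) \<le> B" using holo_bounded_compact[OF h K'] by blast
  define N where "N i w = (if i \<in> K' then both (\<lambda>i. k i - c w) (\<lambda>i. h i - blinfun_apply (\<pi> i) (c w)) i else 0)" for i w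
  have hN: "holo (N i) ?B" for i
  proof (cases "i \<in> K'")
    case True
    then have iU: "i \<in> U" using K' by auto
    have 1: "holo (\<lambda>w. if i \<in> K then k i - c w else 0) ?B"
      by (cases "i \<in> K") (simp_all add: holo_diff[OF holo_const cB] holo_const)
    have 2: "holo (\<lambda>w. h i - blinfun_apply (\<pi> i) (c w)) ?B"
      by (intro holo_diff holo_const holo_linear[OF blinfun.bounded_linear_right _ cB] linear_pi iU) auto
    show ?thesis using holo_Pair[OF 1 2] True by (simp add: N_def[abs_def] both_def)
  qed (simp add: N_def[abs_def] holo_const)
  have bN: "norm (N i w) \<le> (A + C) + (B + P * C)" if w: "w \<in> ?B" for i w
  proof -
    have cw: "norm (c w) \<le> C" using C(2)[of w] w by simp
    have "norm (k i - c w) \<le> A + C" if "i \<in> K"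
      using norm_triangle_ineq4[of "k i" "c w"] A that cw by fastforce
    then have 1: "norm (if i \<in> K then k i - c w else 0) \<le> A + C" using A C by auto
    have 2: "norm (h i - blinfun_apply (\<pi> i) (c w)) \<le> B + P * C" if "i \<in> K'"
    proof -
      have "norm (blinfun_apply (\<pi> i) (c w)) \<le> P * C"
        using norm_blinfun[of "\<pi> i" "c w"] mult_mono[of "norm (\<pi> i)" P "norm (c w)" C] P cw that by force
      then show ?thesis using norm_triangle_ineq4[of "h i" "blinfun_apply (\<pi> i) (c w)"] B that by fastforce
    qed
    show ?thesis
    proof (cases "i \<in> K'")
      case True
      have "norm (N i w) \<le> norm (if i \<in> K then k i - c w else 0) + norm (h i - blinfun_apply (\<pi> i) (c w))"
        using True norm_Pair_le[of "if i \<in> K then k i - c w else 0" "h i - blinfun_apply (\<pi> i) (c w)"]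
        by (simp add: N_def both_def split del: if_split)
      then show ?thesis using 1 2[OF True] by linarith
    qed (use A B C P in \<open>simp add: N_def\<close>)
  qed
  have N0: "N i i = 0" if i: "i \<in> ?B" for i
  proof (cases "i \<in> K'")
    case True
    then have "blinfun_apply (\<pi> i) (c i) = h i" using ch i by blast
    moreover have "i \<in> K \<Longrightarrow> c i = k i" using ck i by blast
    ultimately show ?thesis by (simp add: N_def both_def zero_prod_def)
  qed (simp add: N_def)
  have "\<exists>a. \<forall>w\<in>ball z (\<rho> / 2). (\<lambda>j. (w - z) ^ j *\<^sub>C a j) sums family (\<lambda>i. zero_quot (N i) i w)"
  proof (rule zero_quot_family[where p = "\<lambda>i. i"])
    show "norm (N i w) \<le> (A + C) + (B + P * C)" if "w \<in> ?B" for i w by (rule bN[OF that])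
    show "N i i = 0" if "i \<in> ?B" for i by (rule N0[OF that])
  qed (rule hN \<rho>)+
  then obtain a where a: "\<And>w. w \<in> ball z (\<rho> / 2) \<Longrightarrow> (\<lambda>j. (w - z) ^ j *\<^sub>C a j) sums family (\<lambda>i. zero_quot (N i) i w)"
    by blast
  have diag: "cderiv (N w) w = - quot k h w (c w) w" if w: "w \<in> ?B" "w \<in> K'" for w
  proof -
    have wU: "w \<in> U" using w K' by auto
    have BU: "?B \<subseteq> U" and hc: "\<And>v. v \<in> ?B \<Longrightarrow> h v = blinfun_apply (\<pi> v) (c v)" using ch w by auto
    have 1: "cderiv (\<lambda>v. h v - blinfun_apply (\<pi> v) (c w)) w = blinfun_apply (\<pi> w) (cderiv c w)"
    proof -
      have "holo (\<lambda>v. blinfun_apply (\<pi> v) (slope c w v)) ?B" by (rule holo_apply[OF holo_slope[OF cB] BU])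
      from cderiv_vanishing[OF this w(1)]
      have "cderiv (\<lambda>v. (v - w) *\<^sub>C blinfun_apply (\<pi> v) (slope c w v)) w = blinfun_apply (\<pi> w) (cderiv c w)"
        by (simp add: slope_def)
      moreover have "cderiv (\<lambda>v. h v - blinfun_apply (\<pi> v) (c w)) w
          = cderiv (\<lambda>v. (v - w) *\<^sub>C blinfun_apply (\<pi> v) (slope c w v)) w"
      proof (rule cderiv_cong[of _ ?B, OF _ w(1)])
        show "holo (\<lambda>v. (v - w) *\<^sub>C blinfun_apply (\<pi> v) (slope c w v)) ?B"
          by (intro holo_scaleC holo_diff holo_ident holo_const holo_apply[OF holo_slope[OF cB] BU]) auto
        show "h v - blinfun_apply (\<pi> v) (c w) = (v - w) *\<^sub>C blinfun_apply (\<pi> v) (slope c w v)" if "v \<in> ?B" for v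
        proof -
          have "v \<in> U" using that BU by blast
          then have "(v - w) *\<^sub>C blinfun_apply (\<pi> v) (slope c w v) = blinfun_apply (\<pi> v) ((v - w) *\<^sub>C slope c w v)"
            by (simp add: linear_pi)
          then show ?thesis by (simp add: slope_mult hc[OF that] blinfun.diff_right)
        qed
      qed
      ultimately show ?thesis by simp
    qed
    have 2: "cderiv (\<lambda>v. h w - blinfun_apply (\<pi> w) (c v)) w = - blinfun_apply (\<pi> w) (cderiv c w)"
    proof -
      have hl: "holo (\<lambda>v. blinfun_apply (\<pi> w) (c v)) ?B"
        by (rule holo_linear[OF blinfun.bounded_linear_right linear_pi[OF wU] cB])
      show ?thesis
        by (subst cderiv_diff[OF holo_const hl w(1)], simp, subst cderiv_linear[OF blinfun.bounded_linear_right linear_pi[OF wU] cB w(1)])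
          (simp add: cderiv_const)
    qed
    have 3: "cderiv (\<lambda>v. if w \<in> K then k w - c v else 0) w = - (if w \<in> K then cderiv (\<lambda>v. k v - c w) w else 0)"
    proof (cases "w \<in> K")
      case True
      then have BV: "?B \<subseteq> V" and kc: "\<And>v. v \<in> ?B \<Longrightarrow> c v = k v" using ck w by auto
      have kB: "holo k ?B" by (rule holo_subset[OF V(3) BV]) simp
      have "cderiv (\<lambda>v. k w - c v) w = 0 - cderiv c w" "cderiv (\<lambda>v. k v - c w) w = cderiv k w - 0"
        using cderiv_diff[OF holo_const cB w(1), of "k w"] cderiv_diff[OF kB holo_const w(1), of "c w"]
        by (simp_all add: cderiv_const)
      moreover have "cderiv c w = cderiv k w" by (rule cderiv_cong[OF kB w(1) kc])
      ultimately show ?thesis using True by simp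
    qed (simp add: cderiv_const)
    have 4: "holo (\<lambda>v. if w \<in> K then k w - c v else 0) ?B"
      by (cases "w \<in> K") (simp_all add: holo_diff[OF holo_const cB] holo_const)
    have 5: "holo (\<lambda>v. h w - blinfun_apply (\<pi> w) (c v)) ?B"
      by (intro holo_diff holo_const holo_linear[OF blinfun.bounded_linear_right _ cB] linear_pi wU) auto
    have "cderiv (N w) w = (cderiv (\<lambda>v. if w \<in> K then k w - c v else 0) w, cderiv (\<lambda>v. h w - blinfun_apply (\<pi> w) (c v)) w)"
      unfolding N_def[abs_def] both_def using w(2) has_derivative_Pair[OF holoD(3)[OF 4 w(1)] holoD(3)[OF 5 w(1)]]
      by (intro cderiv_eq) simp
    then show ?thesis unfolding 2 3 using 1 by (simp add: quot_def both_def zero_quot_def)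
  qed
  have eq: "zero_quot (N i) i w = - (if i \<in> K' then quot k h w (c w) i else 0)" if w: "w \<in> ball z (\<rho> / 2)" for i w
  proof (cases "i \<in> K'")
    case i: True
    have wB: "w \<in> ?B" using w \<rho> by simp
    show ?thesis
    proof (cases "w = i")
      case True
      then show ?thesis using diag[OF wB] i by (simp add: zero_quot_def)
    next
      case False
      have sc: "1 / (w - i) = - (1 / (i - w))" by (metis minus_diff_eq minus_divide_right)
      have "N i w = both (\<lambda>i. k i - c w) (\<lambda>i. h i - blinfun_apply (\<pi> i) (c w)) i" using i by (simp add: N_def)
      then show ?thesis using False i by (simp add: zero_quot_def quot_def both_def sc scaleC.minus_left)
    qed
  qed (simp add: zero_quot_def N_def[abs_def] cderiv_const)
  have "(\<lambda>j. (w - z) ^ j *\<^sub>C (- a j)) sums res (quot k h w (c w))" if w: "w \<in> ball z (\<rho> / 2)" for w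
  proof -
    have bd: "norm (zero_quot (N i) i w) \<le> 2 * ((A + C) + (B + P * C)) / \<rho>" for i
      by (rule zero_quot_holo_bound(2)[OF hN \<rho> bN N0]) (use w \<rho> in auto)
    have "res (quot k h w (c w)) = - family (\<lambda>i. zero_quot (N i) i w)"
    proof (rule linf_eqI)
      fix i
      have "norm (if i \<in> K' then quot k h w (c w) i else 0) \<le> 2 * ((A + C) + (B + P * C)) / \<rho>" for i
        using bd[of i] unfolding eq[OF w] by simp
      then have "coord (res (quot k h w (c w))) i = (if i \<in> K' then quot k h w (c w) i else 0)"
        unfolding res_def by (rule coord_family)
      moreover have "coord (- family (\<lambda>i. zero_quot (N i) i w)) i = - zero_quot (N i) i w"
        using coord_simps(4)[of "-1" "family (\<lambda>i. zero_quot (N i) i w)" i] coord_family[where f = "\<lambda>i. zero_quot (N i) i w", OF bd] by simp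
      ultimately show "coord (res (quot k h w (c w))) i = coord (- family (\<lambda>i. zero_quot (N i) i w)) i"
        unfolding eq[OF w] by simp
    qed
    then show ?thesis unfolding scaleC.minus_right by (simp only: sums_minus[OF a[OF w]])
  qed
  then show ?thesis by (intro exI[of _ "\<lambda>j. - a j"] ballI)
qed

lemma quot_bounded:
  assumes V: "K \<subseteq> V" "holo k V" and h: "holo h U"
    and c: "\<mu> \<in> K' \<Longrightarrow> blinfun_apply (\<pi> \<mu>) c = h \<mu>" "\<mu> \<in> K \<Longrightarrow> c = k \<mu>"
  shows "\<exists>M\<ge>0. \<forall>z\<in>K'. norm (quot k h \<mu> c z) \<le> M"
  unfolding quot_def
proof (intro both_bounded)
  show "\<exists>M\<ge>0. \<forall>z\<in>K. norm (zero_quot (\<lambda>z. k z - c) \<mu> z) \<le> M"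
    by (rule zero_quot_bounded[OF _ K(1) V(1)]) (use c in \<open>auto intro!: holo_diff holo_const V holoD(1)[OF V(2)]\<close>)
  show "\<exists>M\<ge>0. \<forall>z\<in>K'. norm (zero_quot (\<lambda>z. h z - blinfun_apply (\<pi> z) c) \<mu> z) \<le> M"
    by (rule zero_quot_bounded[OF _ K'])
      (use c in \<open>auto intro!: holo_diff h holo_apply[OF holo_const] open_U\<close>)
qed

lemma quot_diff:
  assumes V: "K \<subseteq> V" "holo k V" and h: "holo h U"
    and c: "\<mu> \<in> K' \<Longrightarrow> blinfun_apply (\<pi> \<mu>) c = h \<mu>" "\<mu> \<in> K \<Longrightarrow> c = k \<mu>"
    and c': "\<mu> \<in> K' \<Longrightarrow> blinfun_apply (\<pi> \<mu>) c' = h \<mu>" "\<mu> \<in> K \<Longrightarrow> c' = k \<mu>"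
  shows "res (quot k h \<mu> c) - res (quot k h \<mu> c') = res (quot (\<lambda>z. 0) (\<lambda>z. 0) \<mu> (c - c'))"
proof -
  have zq: "zero_quot f \<mu> z - zero_quot g \<mu> z = zero_quot (\<lambda>z. f z - g z) \<mu> z"
    if "holo f S" "holo g S" "z \<in> S" for f g :: "complex \<Rightarrow> 'c::{complex_normed_vector,banach}" and S z
    using cderiv_diff[OF that] by (auto simp: zero_quot_def scaleC.diff_right)
  have "res (quot k h \<mu> c) - res (quot k h \<mu> c') = res (\<lambda>z. quot k h \<mu> c z - quot k h \<mu> c' z)"
    by (rule res_linear(2)[symmetric]; rule quot_bounded[OF V h]) (use c c' in auto)
  also have "\<dots> = res (quot (\<lambda>z. 0) (\<lambda>z. 0) \<mu> (c - c'))"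
  proof (rule res_cong)
    fix z assume z: "z \<in> K'"
    have hk: "holo (\<lambda>z. k z - x) V" for x by (intro holo_diff holo_const V(2) holoD(1)[OF V(2)])
    have hh: "holo (\<lambda>z. h z - blinfun_apply (\<pi> z) x) U" for x
      by (intro holo_diff h holo_apply[OF holo_const[OF open_U]]) simp
    have 1: "zero_quot (\<lambda>z. k z - c) \<mu> z - zero_quot (\<lambda>z. k z - c') \<mu> z = zero_quot (\<lambda>z. 0 - (c - c')) \<mu> z" if "z \<in> K"
    proof -
      have "(\<lambda>z. k z - c - (k z - c')) = (\<lambda>z. 0 - (c - c'))" by auto
      then show ?thesis using zq[OF hk hk, of z c c'] V(1) that by auto
    qed
    have 2: "zero_quot (\<lambda>z. h z - blinfun_apply (\<pi> z) c) \<mu> z - zero_quot (\<lambda>z. h z - blinfun_apply (\<pi> z) c') \<mu> z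
        = zero_quot (\<lambda>z. 0 - blinfun_apply (\<pi> z) (c - c')) \<mu> z"
    proof -
      have "(\<lambda>z. h z - blinfun_apply (\<pi> z) c - (h z - blinfun_apply (\<pi> z) c')) = (\<lambda>z. 0 - blinfun_apply (\<pi> z) (c - c'))"
        by (auto simp: blinfun.diff_right)
      then show ?thesis using zq[OF hh hh, of z c c'] z K'(2) by auto
    qed
    show "quot k h \<mu> c z - quot k h \<mu> c' z = quot (\<lambda>z. 0) (\<lambda>z. 0) \<mu> (c - c') z"
      unfolding quot_def both_def using 1 2 by simp
  qed
  finally show ?thesis .
qed

text \<open>
  For a pole outside \<open>K'\<close> the constant \<open>d\<close> divided by the linear factor is analytic near \<open>K'\<close>.
\<close>

lemma quot_zero_outside:
  assumes "\<mu> \<notin> K'"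
  shows "res (quot (\<lambda>z. 0) (\<lambda>z. 0) \<mu> d) \<in> Y"
proof -
  define g where "g z = (1 / (z - \<mu>)) *\<^sub>C (- d)" for z
  have o: "open (U - {\<mu>})" using open_U by (simp add: open_delete)
  have "holo g (U - {\<mu>})" unfolding g_def
    by (rule holo_scaleC[OF holo_inverse(1)[OF o] holo_const[OF o]]) simp
  moreover have "K' \<subseteq> U - {\<mu>}" using K' assms by auto
  ultimately have "res (both g (\<lambda>z. blinfun_apply (\<pi> z) (g z))) \<in> Y" using lift_in_Y by blast
  moreover have "res (both g (\<lambda>z. blinfun_apply (\<pi> z) (g z))) = res (quot (\<lambda>z. 0) (\<lambda>z. 0) \<mu> d)"
  proof (rule res_cong)
    fix z assume "z \<in> K'"
    then have "z \<noteq> \<mu>" "z \<in> U" using assms K' by auto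
    then show "both g (\<lambda>z. blinfun_apply (\<pi> z) (g z)) z = quot (\<lambda>z. 0) (\<lambda>z. 0) \<mu> d z"
      by (simp add: quot_def both_def g_def zero_quot_def linear_pi blinfun.minus_right)
  qed
  ultimately show ?thesis by simp
qed

text \<open>
  The pole of a kernel element is pushed along a segment that avoids \<open>K\<close> and leaves \<open>K'\<close>. The set \<open>S\<close>
  of good poles contains the complement of \<open>K'\<close>. A pole outside \<open>K\<close> at which good poles accumulate
  has a good neighbourhood, by the identity theorem modulo \<open>Y\<close>, applied along analytic extensions of
  kernel elements. So the interior of \<open>S\<close> is relatively closed in the segment.
\<close>

lemma quot_kernel:
  assumes "\<mu> \<in> K' - K" and w: "w \<notin> K'" "closed_segment \<mu> w \<inter> K = {}"
    and d: "blinfun_apply (\<pi> \<mu>) d = 0"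
  shows "res (quot (\<lambda>z. 0) (\<lambda>z. 0) \<mu> d) \<in> Y"
proof -
  define S where "S = {z. z \<notin> K \<and> (\<forall>d. (z \<in> K' \<longrightarrow> blinfun_apply (\<pi> z) d = 0) \<longrightarrow> res (quot (\<lambda>z. 0) (\<lambda>z. 0) z d) \<in> Y)}"
  have out: "- K' \<subseteq> S" unfolding S_def using quot_zero_outside K by auto
  have step: "z \<in> interior S" if z: "z \<notin> K" and acc: "\<And>e. e > 0 \<Longrightarrow> \<exists>v\<in>ball z e. v \<noteq> z \<and> v \<in> S" for z
  proof (cases "z \<in> K'")
    case False
    then show ?thesis using interior_mono[OF out] compact_imp_closed[OF K'(1)] by (auto simp: interior_complement)
  next
    case True
    have "open (U - K)" using open_U compact_imp_closed[OF K(1)] by (simp add: open_Diff)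
    moreover have "z \<in> U - K" using z True K' by auto
    ultimately obtain R where R: "R > 0" "ball z R \<subseteq> U - K" by (meson open_contains_ball)
    then obtain r where r: "r > 0" "r \<le> R" and ext: "\<And>v y. v \<in> ball z r \<Longrightarrow> blinfun_apply (\<pi> v) y = 0 \<Longrightarrow>
      \<exists>k. holo k (ball z r) \<and> k v = y \<and> (\<forall>v\<in>ball z r. blinfun_apply (\<pi> v) (k v) = 0)"
      using kernel_extension[of R z] by blast
    define \<rho> where "\<rho> = r / 5"
    have \<rho>: "\<rho> > 0" "cball z (4 * \<rho>) \<subseteq> ball z r" using r by (auto simp: \<rho>_def)
    have "ball z (4 * \<rho>) \<subseteq> ball z R" using r by (intro subset_ball) (simp add: \<rho>_def)
    then have sub: "ball z (4 * \<rho>) \<subseteq> U - K" using R(2) by blast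
    have "v \<in> S" if v: "v \<in> ball z (\<rho> / 2)" for v
    proof -
      have vr: "v \<in> ball z r" using v r by (simp add: \<rho>_def)
      have "v \<in> ball z (4 * \<rho>)" using v \<rho>(1) by simp
      then have vK: "v \<notin> K" using sub by blast
      have "res (quot (\<lambda>z. 0) (\<lambda>z. 0) v y) \<in> Y" if y0: "v \<in> K' \<longrightarrow> blinfun_apply (\<pi> v) y = 0" for y
      proof (cases "v \<in> K'")
        case False then show ?thesis by (rule quot_zero_outside)
      next
        case True
        with y0 have y: "blinfun_apply (\<pi> v) y = 0" by blast
        obtain k where k: "holo k (ball z r)" "k v = y" "\<And>v. v \<in> ball z r \<Longrightarrow> blinfun_apply (\<pi> v) (k v) = 0"
          using ext[OF vr y] by blast
        have "\<exists>a. \<forall>w\<in>ball z (\<rho> / 2). (\<lambda>j. (w - z) ^ j *\<^sub>C a j) sums res (quot (\<lambda>z. 0) (\<lambda>z. 0) w (k w))"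
        proof (rule quot_power_series[OF _ _ _ _ \<rho>(1) k(1) \<rho>(2)])
          show "K \<subseteq> U" "U \<subseteq> U" using K K' by auto
          show "holo (\<lambda>z. 0 :: 'a) U" "holo (\<lambda>z. 0 :: 'b) U" by (rule holo_const[OF open_U])+
          show "ball z (4 * \<rho>) \<inter> K = {} \<or> ball z (4 * \<rho>) \<subseteq> U \<and> (\<forall>w\<in>ball z (4 * \<rho>). k w = 0)" using sub by blast
          have "ball z (4 * \<rho>) \<subseteq> ball z r" using \<rho>(2) ball_subset_cball by blast
          then show "ball z (4 * \<rho>) \<inter> K' = {} \<or> ball z (4 * \<rho>) \<subseteq> U \<and> (\<forall>w\<in>ball z (4 * \<rho>). blinfun_apply (\<pi> w) (k w) = 0)"
            using sub k(3) by blast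
        qed
        then obtain a where a: "\<And>w. w \<in> ball z (\<rho> / 2) \<Longrightarrow>
          (\<lambda>j. (w - z) ^ j *\<^sub>C a j) sums res (quot (\<lambda>z. 0) (\<lambda>z. 0) w (k w))" by blast
        have "res (quot (\<lambda>z. 0) (\<lambda>z. 0) v (k v)) \<in> Y"
        proof (rule identity_mod_subspace(2)[OF Y _ a _ v])
          fix e :: real assume e: "e > 0"
          obtain v' where v': "v' \<in> ball z (min e r)" "v' \<noteq> z" "v' \<in> S" using acc[of "min e r"] e r by auto
          then have "res (quot (\<lambda>z. 0) (\<lambda>z. 0) v' (k v')) \<in> Y" unfolding S_def using k(3)[of v'] by auto
          then show "\<exists>w\<in>ball z e. w \<noteq> z \<and> res (quot (\<lambda>z. 0) (\<lambda>z. 0) w (k w)) \<in> Y" using v' by auto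
        qed (use \<rho> in auto)
        then show ?thesis using k(2) by simp
      qed
      then show ?thesis unfolding S_def using vK by blast
    qed
    then show ?thesis using \<rho>(1) unfolding mem_interior by (intro exI[of _ "\<rho> / 2"]) auto
  qed
  define I where "I = closed_segment \<mu> w"
  have "w \<in> interior S"
    using w(1) interior_mono[OF out] compact_imp_closed[OF K'(1)] by (auto simp: interior_complement)
  moreover have "I \<subseteq> interior S \<union> - closure (interior S)"
  proof
    fix z assume z: "z \<in> I"
    show "z \<in> interior S \<union> - closure (interior S)"
    proof (cases "z \<in> closure (interior S)")
      case True
      show ?thesis
      proof (cases "z \<in> interior S")
        case False
        have "z \<in> interior S"
        proof (rule step)
          show "z \<notin> K" using z w(2) by (auto simp: I_def)
          fix e :: real assume "e > 0"
          then obtain v where "v \<in> interior S" "dist v z < e" using True unfolding closure_approachable by blast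
          then show "\<exists>v\<in>ball z e. v \<noteq> z \<and> v \<in> S" using False interior_subset[of S] by (auto simp: dist_commute)
        qed
        then show ?thesis by blast
      qed blast
    qed blast
  qed
  moreover have "connected I" "w \<in> I" "\<mu> \<in> I" by (auto simp: I_def)
  moreover have "interior S \<inter> - closure (interior S) \<inter> I = {}" using closure_subset by blast
  ultimately have "\<mu> \<in> interior S"
    using connectedD[of I "interior S" "- closure (interior S)"] by (auto simp: open_Compl)
  then show ?thesis using interior_subset[of S] d unfolding S_def by blast
qed

text \<open>
  For each \<open>\<mu>\<close> in the plane divide \<open>(k, h) - (c, \<pi> c)\<close> by \<open>z - \<mu>\<close>, where \<open>c\<close> lifts \<open>h \<mu>\<close> if
  \<open>\<mu> \<in> K'\<close>, and \<open>c = k \<mu>\<close> if \<open>\<mu> \<in> K\<close>. Modulo \<open>Y\<close> this does not depend on \<open>c\<close>, it is analytic in \<open>\<mu>\<close> and vanishes at infinity. So it is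
  \<open>0\<close>; and \<open>- \<mu>\<close> times it tends to \<open>(k, h)\<close>.
\<close>

lemma pair_in_Y:
  assumes hull: "\<And>\<mu>. \<mu> \<in> K' - K \<Longrightarrow> \<exists>w. w \<notin> K' \<and> closed_segment \<mu> w \<inter> K = {}"
    and h: "holo h U" and V: "K \<subseteq> V" "V \<subseteq> U" "holo k V"
    and kh: "\<And>z. z \<in> V \<Longrightarrow> blinfun_apply (\<pi> z) (k z) = h z"
  shows "res (both k h) \<in> Y"
proof -
  define adm where "adm \<mu> x \<longleftrightarrow> (\<exists>c. (\<mu> \<in> K' \<longrightarrow> blinfun_apply (\<pi> \<mu>) c = h \<mu>) \<and> (\<mu> \<in> K \<longrightarrow> c = k \<mu>) \<and>
     x = res (quot k h \<mu> c))" for \<mu> x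
  obtain A where A: "A \<ge> 0" "\<forall>z\<in>K. norm (k z) \<le> A" using holo_bounded_compact[OF V(3) K(1) V(1)] by blast
  obtain B where B: "B \<ge> 0" "\<forall>z\<in>K'. norm (h z) \<le> B" using holo_bounded_compact[OF h K'] by blast
  obtain D where D: "D > 0" "\<And>z. z \<in> K' \<Longrightarrow> norm z \<le> D"
    using compact_imp_bounded[OF K'(1)] unfolding bounded_pos by blast
  have bkh: "norm (both k h z) \<le> A + B" if "z \<in> K'" for z
    unfolding both_def using A B that by (intro order_trans[OF norm_Pair_le] add_mono) auto
  have far: "quot k h \<mu> 0 z = (1 / (z - \<mu>)) *\<^sub>C both k h z" if "z \<in> K'" "\<mu> \<notin> K'" for \<mu> z
    using that by (auto simp: quot_def both_def zero_quot_def)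
  have mem: "x \<in> Y" if "adm w x" for w x
  proof (rule liouville_mod_subspace[where adm = adm, OF Y])
    show "adm w x" by fact
  next
    fix z
    show "\<exists>r>0. \<exists>F a. \<forall>w\<in>ball z r. (\<lambda>j. (w - z) ^ j *\<^sub>C a j) sums F w \<and> adm w (F w)"
    proof -
      have "\<exists>c S R. R > 0 \<and> holo c S \<and> ball z R \<subseteq> S \<and>
        (ball z R \<inter> K = {} \<or> (ball z R \<subseteq> V \<and> (\<forall>w\<in>ball z R. c w = k w))) \<and>
        (ball z R \<inter> K' = {} \<or> (ball z R \<subseteq> U \<and> (\<forall>w\<in>ball z R. blinfun_apply (\<pi> w) (c w) = h w)))"
      proof (cases "z \<in> K")
        case True
        then obtain R where "R > 0" "ball z R \<subseteq> V" using V(1) holoD(1)[OF V(3)] by (meson open_contains_ball subsetD)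
        then show ?thesis using V kh by (intro exI[of _ k] exI[of _ V] exI[of _ R]) blast
      next
        case zK: False
        show ?thesis
        proof (cases "z \<in> K'")
          case True
          have "open (U - K)" using open_U compact_imp_closed[OF K(1)] by (simp add: open_Diff)
          moreover have "z \<in> U - K" using zK True K' by auto
          ultimately obtain R where R: "R > 0" "ball z R \<subseteq> U - K" by (meson open_contains_ball)
          have hR: "holo h (ball z R)" by (rule holo_subset[OF h]) (use R in auto)
          obtain r c where r: "r > 0" "r \<le> R" and c: "holo c (ball z r)" "\<forall>w\<in>ball z r. blinfun_apply (\<pi> w) (c w) = h w"
            using local_lift[of R z] R hR by blast
          have "ball z r \<subseteq> U - K" using r(2) R(2) subset_ball by blast
          then show ?thesis using r c by (intro exI[of _ c] exI[of _ "ball z r"] exI[of _ r]) blast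
        next
          case False
          have "open (- K')" using compact_imp_closed[OF K'(1)] by (simp add: open_Compl)
          then obtain R where "R > 0" "ball z R \<subseteq> - K'" using False by (meson ComplI open_contains_ball)
          then show ?thesis using K holo_const[of UNIV "0 :: 'a"]
            by (intro exI[of _ "\<lambda>z. 0"] exI[of _ UNIV] exI[of _ R]) auto
        qed
      qed
      then obtain c S R where R: "R > 0" and c: "holo c S" "ball z R \<subseteq> S"
        and ck: "ball z R \<inter> K = {} \<or> (ball z R \<subseteq> V \<and> (\<forall>w\<in>ball z R. c w = k w))"
        and ch: "ball z R \<inter> K' = {} \<or> (ball z R \<subseteq> U \<and> (\<forall>w\<in>ball z R. blinfun_apply (\<pi> w) (c w) = h w))" by blast
      define \<rho> where "\<rho> = R / 5"
      have \<rho>: "\<rho> > 0" "cball z (4 * \<rho>) \<subseteq> S" and sub: "ball z (4 * \<rho>) \<subseteq> ball z R"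
        using R c(2) by (auto simp: \<rho>_def subset_eq)
      have "\<exists>a. \<forall>w\<in>ball z (\<rho> / 2). (\<lambda>j. (w - z) ^ j *\<^sub>C a j) sums res (quot k h w (c w))"
        by (rule quot_power_series[OF V h \<rho>(1) c(1) \<rho>(2)]) (use ck ch sub in blast)+
      then obtain a where a: "\<And>w. w \<in> ball z (\<rho> / 2) \<Longrightarrow> (\<lambda>j. (w - z) ^ j *\<^sub>C a j) sums res (quot k h w (c w))"
        by blast
      moreover have "adm w (res (quot k h w (c w)))" if "w \<in> ball z (\<rho> / 2)" for w
      proof -
        have "w \<in> ball z R" using that R by (simp add: \<rho>_def)
        then have "w \<in> K' \<longrightarrow> blinfun_apply (\<pi> w) (c w) = h w" "w \<in> K \<longrightarrow> c w = k w" using ck ch by blast+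
        then show ?thesis unfolding adm_def by blast
      qed
      moreover have "\<rho> / 2 > 0" using \<rho> by simp
      ultimately show ?thesis
        by (intro exI[of _ "\<rho> / 2"] conjI exI[of _ "\<lambda>w. res (quot k h w (c w))"] exI[of _ a] ballI)
    qed
  next
    fix \<mu> x y assume "adm \<mu> x" "adm \<mu> y"
    then obtain c c' where c: "\<mu> \<in> K' \<Longrightarrow> blinfun_apply (\<pi> \<mu>) c = h \<mu>" "\<mu> \<in> K \<Longrightarrow> c = k \<mu>" "x = res (quot k h \<mu> c)"
      and c': "\<mu> \<in> K' \<Longrightarrow> blinfun_apply (\<pi> \<mu>) c' = h \<mu>" "\<mu> \<in> K \<Longrightarrow> c' = k \<mu>" "y = res (quot k h \<mu> c')"
      unfolding adm_def by blast
    show "x - y \<in> Y"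
    proof (cases "\<mu> \<in> K")
      case True
      then have "x = y" using c c' by simp
      then show ?thesis using csubspaceD(1)[OF Y(1)] by simp
    next
      case False
      have "x - y = res (quot (\<lambda>z. 0) (\<lambda>z. 0) \<mu> (c - c'))"
        unfolding c(3) c'(3) by (rule quot_diff[OF V(1,3) h c(1,2) c'(1,2)])
      moreover have "res (quot (\<lambda>z. 0) (\<lambda>z. 0) \<mu> (c - c')) \<in> Y"
      proof (cases "\<mu> \<in> K'")
        case True
        obtain w where "w \<notin> K'" "closed_segment \<mu> w \<inter> K = {}" using hull[of \<mu>] True False by blast
        then show ?thesis using quot_kernel[of \<mu> w "c - c'"] True False c(1) c'(1) by (simp add: blinfun.diff_right)
      qed (rule quot_zero_outside)
      ultimately show ?thesis by simp
    qed
  next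
    fix e :: real assume e: "e > 0"
    define R where "R = D + 1 + (A + B) / e"
    have "\<exists>x. adm w x \<and> norm x \<le> e" if w: "norm w \<ge> R" for w
    proof -
      have AB: "0 \<le> (A + B) / e" using A B e by simp
      then have wD: "norm w > D" using w by (simp add: R_def)
      then have wK: "w \<notin> K'" using D(2) by fastforce
      then have "adm w (res (quot k h w 0))" unfolding adm_def using K by (intro exI[of _ 0]) auto
      moreover have "norm (res (quot k h w 0)) \<le> e"
      proof (rule norm_res_le)
        fix z assume z: "z \<in> K'"
        have "(A + B) / e \<le> norm (z - w)"
          using norm_triangle_ineq2[of w z] D(2)[OF z] w unfolding norm_minus_commute[of w z] by (simp add: R_def)
        then have "A + B \<le> e * norm (z - w)" using e by (simp add: field_simps)
        moreover have "norm (z - w) > 0" using z wK by auto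
        moreover have "norm (quot k h w 0 z) = norm (both k h z) / norm (z - w)"
          by (simp add: far[OF z wK] norm_scaleC norm_divide)
        ultimately show "norm (quot k h w 0 z) \<le> e"
          using bkh[OF z] by (simp add: divide_le_eq)
      qed (use e in simp)
      ultimately show ?thesis by blast
    qed
    then show "\<exists>R. \<forall>w. norm w \<ge> R \<longrightarrow> (\<exists>x. adm w x \<and> norm x \<le> e)" by blast
  qed
  have bd: "\<exists>M\<ge>0. \<forall>z\<in>K'. norm (both k h z) \<le> M" using bkh A B by (intro exI[of _ "A + B"]) auto
  have "res (both k h) \<in> closure Y" unfolding closure_approachable
  proof (intro allI impI)
    fix e :: real assume e: "e > 0"
    define m where "m = D + 1 + D * (A + B + 1) / (e / 2)"
    define \<mu> where "\<mu> = complex_of_real m"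
    have "0 \<le> D * (A + B + 1) / (e / 2)" using A B D e by simp
    then have m: "m > D" "D * (A + B + 1) / (e / 2) \<le> m - D" by (auto simp: m_def)
    have \<mu>K: "\<mu> \<notin> K'" using D(1) D(2)[of \<mu>] m by (auto simp: \<mu>_def)
    define x where "x = (- \<mu>) *\<^sub>C res (quot k h \<mu> 0)"
    have "adm \<mu> (res (quot k h \<mu> 0))" unfolding adm_def using K \<mu>K by (intro exI[of _ 0]) auto
    then have xY: "x \<in> Y" unfolding x_def using mem csubspaceD(3)[OF Y(1)] by blast
    have qb: "\<exists>M\<ge>0. \<forall>z\<in>K'. norm (quot k h \<mu> 0 z) \<le> M" by (rule quot_bounded[OF V(1,3) h]) (use \<mu>K K in auto)
    have "x = res (\<lambda>z. (- \<mu>) *\<^sub>C quot k h \<mu> 0 z)" unfolding x_def by (rule res_linear(3)[OF qb qb, symmetric])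
    moreover have "\<exists>M\<ge>0. \<forall>z\<in>K'. norm ((- \<mu>) *\<^sub>C quot k h \<mu> 0 z) \<le> M"
    proof -
      obtain M where "M \<ge> 0" "\<forall>z\<in>K'. norm (quot k h \<mu> 0 z) \<le> M" using qb by blast
      then show ?thesis by (intro exI[of _ "norm \<mu> * M"]) (auto simp: norm_scaleC mult_left_mono)
    qed
    ultimately have "x - res (both k h) = res (\<lambda>z. (- \<mu>) *\<^sub>C quot k h \<mu> 0 z - both k h z)"
      using res_linear(2)[OF _ bd] by simp
    also have "norm \<dots> \<le> e / 2"
    proof (rule norm_res_le)
      fix z assume z: "z \<in> K'"
      have zm: "z - \<mu> \<noteq> 0" using z \<mu>K by auto
      have "(- \<mu>) *\<^sub>C quot k h \<mu> 0 z - both k h z = (- \<mu> / (z - \<mu>)) *\<^sub>C both k h z - 1 *\<^sub>C both k h z"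
        by (simp add: far[OF z \<mu>K] scaleC_scaleC)
      also have "\<dots> = (- \<mu> / (z - \<mu>) - 1) *\<^sub>C both k h z" by (simp only: scaleC.diff_left)
      also have "- \<mu> / (z - \<mu>) - 1 = - z / (z - \<mu>)" using zm by (simp add: field_simps)
      finally have "norm ((- \<mu>) *\<^sub>C quot k h \<mu> 0 z - both k h z) = norm z * norm (both k h z) / norm (z - \<mu>)"
        by (simp add: norm_scaleC norm_divide)
      also have "\<dots> \<le> D * (A + B + 1) / (m - D)"
      proof (rule frac_le)
        show "norm z * norm (both k h z) \<le> D * (A + B + 1)"
          using D(2)[OF z] bkh[OF z] D(1) by (intro mult_mono) auto
        show "m - D \<le> norm (z - \<mu>)"
          using norm_triangle_ineq2[of \<mu> z] D(1) D(2)[OF z] m unfolding norm_minus_commute[of \<mu> z] by (simp add: \<mu>_def)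
      qed (use A B D m in auto)
      also have "\<dots> \<le> e / 2" using m e by (simp add: field_simps)
      finally show "norm ((- \<mu>) *\<^sub>C quot k h \<mu> 0 z - both k h z) \<le> e / 2" .
    qed (use e in simp)
    finally show "\<exists>y\<in>Y. dist y (res (both k h)) < e" using xY e by (intro bexI[of _ x]) (auto simp: dist_norm)
  qed
  then show ?thesis using Y(2) by simp
qed

lemma Y_approx:
  assumes "y \<in> Y" "e > 0"
  shows "\<exists>W g. K' \<subseteq> W \<and> W \<subseteq> U \<and> holo g W \<and>
    (\<forall>z\<in>K'. norm (both g (\<lambda>z. blinfun_apply (\<pi> z) (g z)) z - coord y z) < e)"
proof -
  obtain x where x: "x \<in> lifts" "dist x y < e" using assms unfolding Y_def closure_approachable by blast
  then obtain g W where g: "x = res (both g (\<lambda>z. blinfun_apply (\<pi> z) (g z)))" "K' \<subseteq> W" "W \<subseteq> U" "holo g W"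
    unfolding lifts_def by blast
  have "norm (both g (\<lambda>z. blinfun_apply (\<pi> z) (g z)) z - coord y z) < e" if z: "z \<in> K'" for z
  proof -
    obtain M where "\<And>z. z \<in> K' \<Longrightarrow> norm (both g (\<lambda>z. blinfun_apply (\<pi> z) (g z)) z) \<le> M"
      using lift_bounded[OF g(4,2,3)] by blast
    from coord_res[OF this, where z = z] z
    have "both g (\<lambda>z. blinfun_apply (\<pi> z) (g z)) z - coord y z = coord (x - y) z" by (simp add: g(1))
    then show ?thesis using norm_coord[of "x - y" z] x(2) by (simp add: dist_norm)
  qed
  then show ?thesis using g by blast
qed

theorem simultaneous_approximation:
  assumes hull: "\<And>\<mu>. \<mu> \<in> K' - K \<Longrightarrow> \<exists>w. w \<notin> K' \<and> closed_segment \<mu> w \<inter> K = {}"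
    and h: "holo h U" and V: "K \<subseteq> V" "V \<subseteq> U" "holo k V"
    and kh: "\<And>z. z \<in> V \<Longrightarrow> blinfun_apply (\<pi> z) (k z) = h z" and e: "e > 0"
  shows "\<exists>W g. K' \<subseteq> W \<and> W \<subseteq> U \<and> holo g W \<and> (\<forall>z\<in>K. norm (g z - k z) < e) \<and>
    (\<forall>z\<in>K'. norm (blinfun_apply (\<pi> z) (g z) - h z) < e)"
proof -
  have "\<exists>M\<ge>0. \<forall>z\<in>K'. norm (both k h z) \<le> M"
    by (intro both_bounded holo_bounded_compact[OF V(3) K(1) V(1)] holo_bounded_compact[OF h K'])
  then obtain M where M: "\<And>z. z \<in> K' \<Longrightarrow> norm (both k h z) \<le> M" by blast
  have "res (both k h) \<in> Y" by (rule pair_in_Y[OF hull h V kh])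
  from Y_approx[OF this e] obtain W g where g: "K' \<subseteq> W" "W \<subseteq> U" "holo g W"
    and close: "\<And>z. z \<in> K' \<Longrightarrow> norm (both g (\<lambda>z. blinfun_apply (\<pi> z) (g z)) z - both k h z) < e"
    by (auto simp: coord_res[OF M])
  have "norm (g z - k z) < e" if z: "z \<in> K" for z
  proof -
    have "both g (\<lambda>z. blinfun_apply (\<pi> z) (g z)) z - both k h z = (g z - k z, blinfun_apply (\<pi> z) (g z) - h z)"
      using z by (simp add: both_def)
    then show ?thesis using close[of z] K(2) z norm_fst_le[of "g z - k z" "blinfun_apply (\<pi> z) (g z) - h z"] by auto
  qed
  moreover have "norm (blinfun_apply (\<pi> z) (g z) - h z) < e" if z: "z \<in> K'" for z
  proof -
    have "both g (\<lambda>z. blinfun_apply (\<pi> z) (g z)) z - both k h z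
        = (if z \<in> K then g z - k z else 0, blinfun_apply (\<pi> z) (g z) - h z)"
      by (simp add: both_def)
    then show ?thesis
      using close[OF z] norm_snd_le[of "blinfun_apply (\<pi> z) (g z) - h z" "if z \<in> K then g z - k z else 0"]
      by (simp split del: if_split)
  qed
  ultimately show ?thesis using g by blast
qed

end

section \<open>Cauchy's formula for a compact subset of an open set\<close>

lemma sum_diff_swap:
  fixes f :: "'i \<Rightarrow> 'a::ab_group_add"
  assumes "finite S" "finite T"
  shows "sum f S - sum f T = sum f (S - T) - sum f (T - S)"
  using sum.Int_Diff[OF assms(1), of f T] sum.Int_Diff[OF assms(2), of f S] by (simp add: Int_commute)

text \<open>
  Cauchy's theorem is applied to \<open>f(\<zeta>) / (\<zeta> - w)\<close> in a convex open set without \<open>w\<close>.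
\<close>

lemma square_avoiding_halfplane:
  fixes w :: complex
  assumes "w \<notin> cbox p (p + Complex d d)"
  obtains H where "open H" "convex H" "cbox p (p + Complex d d) \<subseteq> H" "w \<notin> H"
proof -
  consider "Re w < Re p" | "Re w > Re p + d" | "Im w < Im p" | "Im w > Im p + d"
    using assms by (auto simp: in_cbox_complex_iff not_le)
  then show ?thesis
  proof cases
    case 1 then show ?thesis
      by (intro that[of "{z. Re z > Re w}"]) (auto simp: open_halfspace_Re_gt convex_halfspace_Re_gt in_cbox_complex_iff)
  next
    case 2 then show ?thesis
      by (intro that[of "{z. Re z < Re w}"]) (auto simp: open_halfspace_Re_lt convex_halfspace_Re_lt in_cbox_complex_iff)
  next
    case 3 then show ?thesis
      by (intro that[of "{z. Im z > Im w}"]) (auto simp: open_halfspace_Im_gt convex_halfspace_Im_gt in_cbox_complex_iff)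
  next
    case 4 then show ?thesis
      by (intro that[of "{z. Im z < Im w}"]) (auto simp: open_halfspace_Im_lt convex_halfspace_Im_lt in_cbox_complex_iff)
  qed
qed

text \<open>
  Cauchy's formula is summed over all squares of a fine grid that meet a neighbourhood of \<open>K\<close>. An
  edge between two such squares occurs twice with opposite orientation; so only edges with exactly
  one adjacent square of this kind survive, and these keep away from \<open>K\<close>.
\<close>

lemma grid_cauchy_formula:
  fixes K V :: "complex set"
  assumes K: "compact K" and e: "e > 0" and V: "\<And>x y. x \<in> K \<Longrightarrow> dist x y \<le> e \<Longrightarrow> y \<in> V"
    and \<epsilon>: "\<epsilon> > 0"
  shows "\<exists>\<Gamma> N. open N \<and> K \<subseteq> N \<and> closure N \<subseteq> V \<and> compact (closure N) \<and>
    (\<forall>(a, b)\<in>set \<Gamma>. (\<exists>x\<in>K. dist x a \<le> e) \<and> norm (b - a) \<le> \<epsilon> \<and> closed_segment a b \<inter> closure N = {}) \<and>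
    (\<forall>f :: complex \<Rightarrow> 'a::{complex_normed_vector,banach}. holo f V \<longrightarrow> (\<forall>w\<in>N.
       f w = (\<Sum>(a, b)\<leftarrow>\<Gamma>. segint a b (\<lambda>\<zeta>. (1 / (\<zeta> - w)) *\<^sub>C ((1 / (2 * of_real pi * \<i>)) *\<^sub>C f \<zeta>)))))"
proof -
  \<comment> \<open>A square that meets the \<open>d\<close>-neighbourhood \<open>T\<close> of \<open>K\<close> lies within \<open>3 d < e\<close> of \<open>K\<close>.\<close>
  define d where "d = min (e / 4) \<epsilon>"
  have d: "d > 0" "4 * d \<le> e" "d \<le> \<epsilon>" using e \<epsilon> by (auto simp: d_def)
  define P where "P m n = Complex (d * real_of_int m) (d * real_of_int n)" for m n
  define Q where "Q m n = cbox (P m n) (P m n + Complex d d)" for m n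
  have PS: "P m n + Complex d 0 = P (m + 1) n" "P m n + Complex 0 d = P m (n + 1)"
    "P m n + Complex d d = P (m + 1) (n + 1)" for m n
    by (simp_all add: P_def algebra_simps complex_eq_iff)
  define T where "T = {x + y | x y. x \<in> K \<and> y \<in> cball 0 d}"
  define N where "N = (\<Union>x\<in>K. ball x d)"
  have T: "compact T" unfolding T_def by (rule compact_sums[OF K compact_cball])
  have T_iff: "t \<in> T \<longleftrightarrow> (\<exists>x\<in>K. dist x t \<le> d)" for t
  proof
    assume "\<exists>x\<in>K. dist x t \<le> d"
    then obtain x where "x \<in> K" "dist x t \<le> d" by blast
    then show "t \<in> T" unfolding T_def
      by (intro CollectI exI[of _ x] exI[of _ "t - x"]) (auto simp: dist_norm norm_minus_commute)
  next
    assume "t \<in> T"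
    then obtain x y where "t = x + y" "x \<in> K" "norm y \<le> d" by (auto simp: T_def)
    then show "\<exists>x\<in>K. dist x t \<le> d" by (intro bexI[of _ x]) (simp_all add: dist_norm)
  qed
  have "N \<subseteq> T"
  proof
    fix t assume "t \<in> N"
    then obtain x where "x \<in> K" "dist x t < d" by (auto simp: N_def)
    then show "t \<in> T" using T_iff less_imp_le by blast
  qed
  then have NT: "closure N \<subseteq> T" by (intro closure_minimal compact_imp_closed T)
  have N: "open N" "K \<subseteq> N" using d by (auto simp: N_def)
  have TV: "T \<subseteq> V"
  proof
    fix t assume "t \<in> T"
    then obtain x where "x \<in> K" "dist x t \<le> d" using T_iff by blast
    then show "t \<in> V" using V[of x t] d by simp
  qed
  have "compact (T \<inter> closure N)" by (rule compact_Int_closed[OF T closed_closure])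
  then have cN: "compact (closure N)" using NT by (simp add: Int_absorb1)
  define S where "S = {(m, n). Q m n \<inter> T \<noteq> {}}"
  have Qball: "Q m n \<subseteq> ball (P m n + Complex (d / 2) (d / 2)) d" for m n
    using centred_square(1)[of "d / 2" "P m n + Complex (d / 2) (d / 2)"] d by (simp add: Q_def)
  have near: "\<exists>x\<in>K. dist x y \<le> e" if S: "(m, n) \<in> S" and y: "y \<in> ball (P m n + Complex (d / 2) (d / 2)) d" for m n y
  proof -
    obtain t where t: "t \<in> Q m n" "t \<in> T" using S by (auto simp: S_def)
    obtain x where x: "x \<in> K" "dist x t \<le> d" using t(2) T_iff by blast
    have "dist (P m n + Complex (d / 2) (d / 2)) t < d" using subsetD[OF Qball t(1)] by simp
    then have "dist x y \<le> 3 * d"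
      using x(2) y dist_triangle[of x y t] dist_triangle3[of t y "P m n + Complex (d / 2) (d / 2)"]
      unfolding mem_ball by linarith
    then show ?thesis using x(1) d by (intro bexI[of _ x]) auto
  qed
  have finS: "finite S"
  proof -
    obtain B where B: "\<And>t. t \<in> T \<Longrightarrow> norm t \<le> B" using compact_imp_bounded[OF T] unfolding bounded_iff by blast
    define M where "M = \<lceil>B / d\<rceil> + 1"
    have "m \<in> {-M..M} \<and> n \<in> {-M..M}" if mn: "(m, n) \<in> S" for m n
    proof -
      obtain t where t: "t \<in> Q m n" "norm t \<le> B" using mn B by (auto simp: S_def)
      have 1: "d * real_of_int m \<le> Re t" "Re t \<le> d * real_of_int m + d" "d * real_of_int n \<le> Im t" "Im t \<le> d * real_of_int n + d"
        using t(1) by (auto simp: Q_def P_def in_cbox_complex_iff)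
      have 2: "\<bar>Re t\<bar> \<le> B" "\<bar>Im t\<bar> \<le> B" using t(2) abs_Re_le_cmod[of t] abs_Im_le_cmod[of t] by linarith+
      have rng: "k \<in> {-M..M}" if "d * real_of_int k \<le> B" "- B \<le> d * real_of_int k + d" for k
      proof -
        have "real_of_int k \<le> B / d" "- (B / d) - 1 \<le> real_of_int k" using that d by (simp_all add: field_simps)
        moreover have "B / d \<le> real_of_int \<lceil>B / d\<rceil>" by simp
        moreover have "real_of_int M = real_of_int \<lceil>B / d\<rceil> + 1" "real_of_int (- M) = - real_of_int M" by (simp_all add: M_def)
        ultimately have "real_of_int k \<le> real_of_int M" "real_of_int (- M) \<le> real_of_int k" by linarith+
        then have "k \<le> M" "- M \<le> k" by (simp_all only: of_int_le_iff)
        then show ?thesis by simp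
      qed
      have "d * real_of_int m \<le> B" "- B \<le> d * real_of_int m + d" "d * real_of_int n \<le> B" "- B \<le> d * real_of_int n + d"
        using 1 2 by linarith+
      then show ?thesis using rng by blast
    qed
    then have "S \<subseteq> {-M..M} \<times> {-M..M}" by auto
    then show ?thesis by (rule finite_subset) simp
  qed
  define up where "up = (\<lambda>(m, n). (m, n + 1)) ` S"
  define right where "right = (\<lambda>(m, n). (m + 1, n)) ` S"
  have fin: "finite up" "finite right" using finS by (auto simp: up_def right_def)
  define hor where "hor = (\<lambda>(m :: int, n). (P m n, P (m + 1) n))"
  define ver where "ver = (\<lambda>(m :: int, n). (P m n, P m (n + 1)))"
  have up_iff: "(m, n) \<in> up \<longleftrightarrow> (m, n - 1) \<in> S" for m n
    by (auto simp: up_def intro!: image_eqI[of _ _ "(m, n - 1)"])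
  have right_iff: "(m, n) \<in> right \<longleftrightarrow> (m - 1, n) \<in> S" for m n
    by (auto simp: right_def intro!: image_eqI[of _ _ "(m - 1, n)"])
  obtain l1 where l1: "set l1 = S - up" "distinct l1" using finite_distinct_list[of "S - up"] finS by auto
  obtain l2 where l2: "set l2 = up - S" "distinct l2" using finite_distinct_list[of "up - S"] fin by auto
  obtain l3 where l3: "set l3 = right - S" "distinct l3" using finite_distinct_list[of "right - S"] fin by auto
  obtain l4 where l4: "set l4 = S - right" "distinct l4" using finite_distinct_list[of "S - right"] finS by auto
  note l = l1 l2 l3 l4
  define \<Gamma> where "\<Gamma> = map hor l1 @ map (prod.swap \<circ> hor) l2 @ map ver l3 @ map (prod.swap \<circ> ver) l4"
  have sub_hor: "closed_segment (P m n) (P (m + 1) n) \<subseteq> Q m n \<inter> Q m (n - 1)" for m n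
  proof -
    have "{P m n, P (m + 1) n} \<subseteq> Q m n \<inter> Q m (n - 1)"
      using d by (auto simp: Q_def P_def in_cbox_complex_iff algebra_simps)
    moreover have "convex (Q m n \<inter> Q m (n - 1))" unfolding Q_def by (intro convex_Int convex_box)
    ultimately show ?thesis by (intro closed_segment_subset) auto
  qed
  have sub_ver: "closed_segment (P m n) (P m (n + 1)) \<subseteq> Q m n \<inter> Q (m - 1) n" for m n
  proof -
    have "{P m n, P m (n + 1)} \<subseteq> Q m n \<inter> Q (m - 1) n"
      using d by (auto simp: Q_def P_def in_cbox_complex_iff algebra_simps)
    moreover have "convex (Q m n \<inter> Q (m - 1) n)" unfolding Q_def by (intro convex_Int convex_box)
    ultimately show ?thesis by (intro closed_segment_subset) auto
  qed
  have good: "(\<exists>x\<in>K. dist x a \<le> e) \<and> norm (b - a) \<le> \<epsilon> \<and> closed_segment a b \<inter> closure N = {}"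
    if seg: "closed_segment a b \<subseteq> Q m n" "closed_segment a b \<subseteq> Q m' n'" and S: "(m, n) \<in> S" "(m', n') \<notin> S"
      and len: "norm (b - a) = d" for a b m n m' n'
  proof -
    have "a \<in> Q m n" using seg(1) by auto
    then have "\<exists>x\<in>K. dist x a \<le> e" using near[OF S(1)] Qball by blast
    moreover have "Q m' n' \<inter> T = {}" using S(2) by (auto simp: S_def)
    then have "closed_segment a b \<inter> closure N = {}" using seg(2) NT by blast
    moreover have "norm (b - a) \<le> \<epsilon>" using len d by simp
    ultimately show ?thesis by blast
  qed
  have len: "norm (P (m + 1) n - P m n) = d" "norm (P m n - P (m + 1) n) = d"
    "norm (P m (n + 1) - P m n) = d" "norm (P m n - P m (n + 1)) = d" for m n
    using d by (simp_all add: P_def cmod_def algebra_simps)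
  have \<Gamma>_good: "(\<exists>x\<in>K. dist x a \<le> e) \<and> norm (b - a) \<le> \<epsilon> \<and> closed_segment a b \<inter> closure N = {}" if ab: "(a, b) \<in> set \<Gamma>" for a b
  proof -
    consider m n where "(m, n) \<in> S - up" "(a, b) = (P m n, P (m + 1) n)"
      | m n where "(m, n) \<in> up - S" "(a, b) = (P (m + 1) n, P m n)"
      | m n where "(m, n) \<in> right - S" "(a, b) = (P m n, P m (n + 1))"
      | m n where "(m, n) \<in> S - right" "(a, b) = (P m (n + 1), P m n)"
      using ab unfolding \<Gamma>_def hor_def ver_def by (auto simp: l)
    then show ?thesis
    proof cases
      case (1 m n)
      then have "(m, n) \<in> S" "(m, n - 1) \<notin> S" by (simp_all add: up_iff)
      then show ?thesis using good[of "P m n" "P (m + 1) n" m n m "n - 1"] sub_hor[of m n] len 1(2) by simp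
    next
      case (2 m n)
      then have "(m, n) \<notin> S" "(m, n - 1) \<in> S" by (simp_all add: up_iff)
      then show ?thesis using good[of "P (m + 1) n" "P m n" m "n - 1" m n] sub_hor[of m n] len 2(2)
        by (simp add: closed_segment_commute)
    next
      case (3 m n)
      then have "(m, n) \<notin> S" "(m - 1, n) \<in> S" by (simp_all add: right_iff)
      then show ?thesis using good[of "P m n" "P m (n + 1)" "m - 1" n m n] sub_ver[of m n] len 3(2) by simp
    next
      case (4 m n)
      then have "(m, n) \<in> S" "(m - 1, n) \<notin> S" by (simp_all add: right_iff)
      then show ?thesis using good[of "P m (n + 1)" "P m n" m n "m - 1" n] sub_ver[of m n] len 4(2)
        by (simp add: closed_segment_commute)
    qed
  qed
  have main: "f w = (\<Sum>(a, b)\<leftarrow>\<Gamma>. segint a b (\<lambda>\<zeta>. (1 / (\<zeta> - w)) *\<^sub>C ((1 / (2 * of_real pi * \<i>)) *\<^sub>C f \<zeta>)))"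
    if f: "holo f V" and w: "w \<in> N" for f :: "complex \<Rightarrow> 'a" and w
  proof -
    define F where "F \<zeta> = (1 / (2 * complex_of_real pi * \<i>)) *\<^sub>C f \<zeta>" for \<zeta>
    have F: "holo F V" unfolding F_def[abs_def] by (intro holo_scaleC holo_const f holoD(1)[OF f])
    define G where "G w a b = segint a b (\<lambda>\<zeta>. (1 / (\<zeta> - w)) *\<^sub>C F \<zeta>)" for w a b
    have QV: "ball (P m n + Complex (d / 2) (d / 2)) d \<subseteq> V" if "(m, n) \<in> S" for m n
      using near[OF that] V by blast
    have off_grid: "f v = (\<Sum>(a, b)\<leftarrow>\<Gamma>. G v a b)"
      if v: "v \<in> N" "\<And>m. Re v \<noteq> d * real_of_int m" "\<And>n. Im v \<noteq> d * real_of_int n" for v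
    proof -
      have edge: "v \<notin> closed_segment (P m n) (P (m + 1) n)" "v \<notin> closed_segment (P m n) (P m (n + 1))" for m n
      proof -
        show "v \<notin> closed_segment (P m n) (P (m + 1) n)"
        proof
          assume "v \<in> closed_segment (P m n) (P (m + 1) n)"
          then have "v \<in> Q m n" "v \<in> Q m (n - 1)" using sub_hor[of m n] by blast+
          then have "d * real_of_int n \<le> Im v" "Im v \<le> d * real_of_int n"
            by (simp_all add: Q_def P_def in_cbox_complex_iff algebra_simps)
          then show False using v(3)[of n] by simp
        qed
        show "v \<notin> closed_segment (P m n) (P m (n + 1))"
        proof
          assume "v \<in> closed_segment (P m n) (P m (n + 1))"
          then have "v \<in> Q m n" "v \<in> Q (m - 1) n" using sub_ver[of m n] by blast+
          then have "d * real_of_int m \<le> Re v" "Re v \<le> d * real_of_int m"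
            by (simp_all add: Q_def P_def in_cbox_complex_iff algebra_simps)
          then show False using v(2)[of m] by simp
        qed
      qed
      have cont: "continuous_on (closed_segment a b) (\<lambda>\<zeta>. (1 / (\<zeta> - v)) *\<^sub>C F \<zeta>)"
        if "closed_segment a b \<subseteq> Q m n" "(m, n) \<in> S" "v \<notin> closed_segment a b" for a b m n
      proof -
        have "closed_segment a b \<subseteq> V" using that(1) QV[OF that(2)] Qball[of m n] by blast
        then show ?thesis using that(3)
          by (intro continuous_intros continuous_on_subset[OF holo_continuous_on[OF F]]) auto
      qed
      have sq: "sqint (P m n) d (\<lambda>\<zeta>. (1 / (\<zeta> - v)) *\<^sub>C F \<zeta>) =
          (G v (P m n) (P (m + 1) n) - G v (P m (n + 1)) (P (m + 1) (n + 1))) +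
          (G v (P (m + 1) n) (P (m + 1) (n + 1)) - G v (P m n) (P m (n + 1)))" if S: "(m, n) \<in> S" for m n
      proof -
        have 1: "G v (P (m + 1) (n + 1)) (P m (n + 1)) = - G v (P m (n + 1)) (P (m + 1) (n + 1))" unfolding G_def
          by (rule segint_reverse, rule cont[OF _ S]) (use sub_hor[of m "n + 1"] edge(1)[of m "n + 1"] in auto)
        have 2: "G v (P m (n + 1)) (P m n) = - G v (P m n) (P m (n + 1))" unfolding G_def
          by (rule segint_reverse, rule cont[OF _ S]) (use sub_ver[of m n] edge(2)[of m n] in auto)
        show ?thesis using 1 2 unfolding sqint_def PS G_def by (simp only: add_uminus_conv_diff) (simp only: diff_add_eq add_diff_eq)
      qed
      define m0 n0 where "m0 = \<lfloor>Re v / d\<rfloor>" and "n0 = \<lfloor>Im v / d\<rfloor>"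
      have fl: "d * real_of_int m0 < Re v" "Re v < d * real_of_int m0 + d" "d * real_of_int n0 < Im v" "Im v < d * real_of_int n0 + d"
      proof -
        have "d * real_of_int m0 \<le> Re v" "Re v < d * real_of_int m0 + d" "d * real_of_int n0 \<le> Im v" "Im v < d * real_of_int n0 + d"
          using floor_divide_lower[OF d(1)] floor_divide_upper[OF d(1)] by (auto simp: m0_def n0_def algebra_simps)
        then show "d * real_of_int m0 < Re v" "Re v < d * real_of_int m0 + d" "d * real_of_int n0 < Im v" "Im v < d * real_of_int n0 + d"
          using v(2)[of m0] v(3)[of n0] by auto
      qed
      have inb: "v \<in> box (P m0 n0) (P m0 n0 + Complex d d)" using fl by (auto simp: P_def in_box_complex_iff)
      have vT: "v \<in> T" using v(1) NT closure_subset by blast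
      then have S0: "(m0, n0) \<in> S" using inb box_subset_cbox by (auto simp: S_def Q_def)
      have val: "sqint (P m n) d (\<lambda>\<zeta>. (1 / (\<zeta> - v)) *\<^sub>C F \<zeta>) = (if (m, n) = (m0, n0) then f v else 0)"
        if S: "(m, n) \<in> S" for m n
      proof (cases "(m, n) = (m0, n0)")
        case True
        let ?b = "ball (P m n + Complex (d / 2) (d / 2)) d"
        have "holo F ?b" by (rule holo_subset[OF F QV[OF S]]) simp
        then have "sqint (P m n) d (\<lambda>\<zeta>. (1 / (\<zeta> - v)) *\<^sub>C F \<zeta>) = (2 * of_real pi * \<i>) *\<^sub>C F v"
        proof (rule square_cauchy_formula[OF _ convex_ball d(1)])
          show "cbox (P m n) (P m n + Complex d d) \<subseteq> ?b" using Qball[of m n] by (simp add: Q_def)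
          show "v \<in> box (P m n) (P m n + Complex d d)" using inb True by simp
        qed
        then show ?thesis using True by (simp add: F_def scaleC_scaleC)
      next
        case False
        have "v \<notin> Q m n"
        proof
          assume "v \<in> Q m n"
          then have "d * real_of_int m \<le> Re v" "Re v \<le> d * real_of_int (m + 1)" "d * real_of_int n \<le> Im v" "Im v \<le> d * real_of_int (n + 1)"
            by (auto simp: Q_def P_def in_cbox_complex_iff algebra_simps)
          then have "d * real_of_int m \<le> Re v" "Re v < d * real_of_int (m + 1)" "d * real_of_int n \<le> Im v" "Im v < d * real_of_int (n + 1)"
            using v(2)[of "m + 1"] v(3)[of "n + 1"] by (auto simp: less_le)
          then have "\<lfloor>Re v / d\<rfloor> = m" "\<lfloor>Im v / d\<rfloor> = n"
            using d by (auto intro!: floor_unique simp: field_simps)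
          then show False using False by (simp add: m0_def n0_def)
        qed
        then obtain H where H: "open H" "convex H" "Q m n \<subseteq> H" "v \<notin> H"
          unfolding Q_def by (rule square_avoiding_halfplane)
        let ?b = "ball (P m n + Complex (d / 2) (d / 2)) d \<inter> H"
        have o: "open ?b" using H by blast
        have "holo (\<lambda>\<zeta>. (1 / (\<zeta> - v)) *\<^sub>C F \<zeta>) ?b"
          by (intro holo_scaleC holo_inverse(1)[OF o] holo_subset[OF F _ o]) (use QV[OF S] H in auto)
        then have "sqint (P m n) d (\<lambda>\<zeta>. (1 / (\<zeta> - v)) *\<^sub>C F \<zeta>) = 0"
        proof (rule square_cauchy_theorem[OF _ _ d(1)])
          show "convex ?b" by (intro convex_Int convex_ball H)
          show "cbox (P m n) (P m n + Complex d d) \<subseteq> ?b" using Qball[of m n] H(3) by (auto simp: Q_def)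
        qed
        then show ?thesis using False by (auto simp del: One_nat_def)
      qed
      have hs: "(\<Sum>(m, n)\<in>S. G v (P m (n + 1)) (P (m + 1) (n + 1))) = (\<Sum>(m, n)\<in>up. G v (P m n) (P (m + 1) n))"
      proof -
        have "inj_on (\<lambda>(m, n). (m, n + 1 :: int)) S" by (auto simp: inj_on_def)
        then show ?thesis unfolding up_def by (subst sum.reindex) (simp_all add: case_prod_beta)
      qed
      have vs: "(\<Sum>(m, n)\<in>S. G v (P (m + 1) n) (P (m + 1) (n + 1))) = (\<Sum>(m, n)\<in>right. G v (P m n) (P m (n + 1)))"
      proof -
        have "inj_on (\<lambda>(m, n). (m + 1 :: int, n)) S" by (auto simp: inj_on_def)
        then show ?thesis unfolding right_def by (subst sum.reindex) (simp_all add: case_prod_beta)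
      qed
      have "f v = (\<Sum>(m, n)\<in>S. sqint (P m n) d (\<lambda>\<zeta>. (1 / (\<zeta> - v)) *\<^sub>C F \<zeta>))"
      proof -
        have "(\<Sum>(m, n)\<in>S. sqint (P m n) d (\<lambda>\<zeta>. (1 / (\<zeta> - v)) *\<^sub>C F \<zeta>)) = (\<Sum>x\<in>S. if x = (m0, n0) then f v else 0)"
          by (rule sum.cong) (auto simp: val split: if_splits)
        then show ?thesis using finS S0 by simp
      qed
      also have "\<dots> = (\<Sum>(m, n)\<in>S. (G v (P m n) (P (m + 1) n) - G v (P m (n + 1)) (P (m + 1) (n + 1))) +
          (G v (P (m + 1) n) (P (m + 1) (n + 1)) - G v (P m n) (P m (n + 1))))"
        by (rule sum.cong) (auto simp: sq)
      also have "\<dots> = ((\<Sum>(m, n)\<in>S. G v (P m n) (P (m + 1) n)) - (\<Sum>(m, n)\<in>up. G v (P m n) (P (m + 1) n))) +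
          ((\<Sum>(m, n)\<in>right. G v (P m n) (P m (n + 1))) - (\<Sum>(m, n)\<in>S. G v (P m n) (P m (n + 1))))"
        unfolding hs[symmetric] vs[symmetric] by (simp add: case_prod_beta sum.distrib sum_subtractf)
      also have "\<dots> = ((\<Sum>(m, n)\<in>S - up. G v (P m n) (P (m + 1) n)) - (\<Sum>(m, n)\<in>up - S. G v (P m n) (P (m + 1) n))) +
          ((\<Sum>(m, n)\<in>right - S. G v (P m n) (P m (n + 1))) - (\<Sum>(m, n)\<in>S - right. G v (P m n) (P m (n + 1))))"
        unfolding sum_diff_swap[OF finS fin(1)] sum_diff_swap[OF fin(2) finS] ..
      also have "\<dots> = (\<Sum>(a, b)\<leftarrow>\<Gamma>. G v a b)"
      proof -
        have r2: "G v (P (m + 1) n) (P m n) = - G v (P m n) (P (m + 1) n)" if "(m, n) \<in> up - S" for m n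
          unfolding G_def
        proof (rule segint_reverse, rule cont)
          show "(m, n - 1) \<in> S" using that by (simp add: up_iff)
        qed (use sub_hor[of m n] edge(1)[of m n] in auto)
        have r4: "G v (P m (n + 1)) (P m n) = - G v (P m n) (P m (n + 1))" if "(m, n) \<in> S - right" for m n
          unfolding G_def
        proof (rule segint_reverse, rule cont)
          show "(m, n) \<in> S" using that by simp
        qed (use sub_ver[of m n] edge(2)[of m n] in auto)
        have "(\<Sum>(a, b)\<leftarrow>\<Gamma>. G v a b) = (\<Sum>(m, n)\<in>S - up. G v (P m n) (P (m + 1) n)) + (\<Sum>(m, n)\<in>up - S. G v (P (m + 1) n) (P m n))
          + (\<Sum>(m, n)\<in>right - S. G v (P m n) (P m (n + 1))) + (\<Sum>(m, n)\<in>S - right. G v (P m (n + 1)) (P m n))"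
          unfolding \<Gamma>_def
          by (simp add: o_def case_prod_beta hor_def ver_def sum_list_distinct_conv_sum_set l)
        also have "(\<Sum>(m, n)\<in>up - S. G v (P (m + 1) n) (P m n)) = (\<Sum>(m, n)\<in>up - S. - G v (P m n) (P (m + 1) n))"
          by (rule sum.cong) (auto simp: r2)
        also have "(\<Sum>(m, n)\<in>S - right. G v (P m (n + 1)) (P m n)) = (\<Sum>(m, n)\<in>S - right. - G v (P m n) (P m (n + 1)))"
          by (rule sum.cong) (auto simp: r4)
        finally show ?thesis by (simp add: split_def sum_negf algebra_simps)
      qed
      finally show ?thesis .
    qed
    have "closed_segment a b \<subseteq> V \<and> closed_segment a b \<inter> N = {}" if ab: "(a, b) \<in> set \<Gamma>" for a b
    proof
      show "closed_segment a b \<inter> N = {}" using \<Gamma>_good[OF ab] closure_subset by blast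
      have "\<exists>m n. (m, n) \<in> S \<and> closed_segment a b \<subseteq> Q m n"
      proof -
        consider m n where "(m, n) \<in> S - up" "(a, b) = (P m n, P (m + 1) n)"
          | m n where "(m, n) \<in> up - S" "(a, b) = (P (m + 1) n, P m n)"
          | m n where "(m, n) \<in> right - S" "(a, b) = (P m n, P m (n + 1))"
          | m n where "(m, n) \<in> S - right" "(a, b) = (P m (n + 1), P m n)"
          using ab unfolding \<Gamma>_def hor_def ver_def by (auto simp: l)
        then show ?thesis
        proof cases
          case (1 m n) then show ?thesis using sub_hor[of m n] by (intro exI[of _ m] exI[of _ n]) auto
        next
          case (2 m n) then show ?thesis using sub_hor[of m n]
            by (intro exI[of _ m] exI[of _ "n - 1"]) (auto simp: up_iff closed_segment_commute)
        next
          case (3 m n) then show ?thesis using sub_ver[of m n]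
            by (intro exI[of _ "m - 1"] exI[of _ n]) (auto simp: right_iff)
        next
          case (4 m n) then show ?thesis using sub_ver[of m n]
            by (intro exI[of _ m] exI[of _ n]) (auto simp: closed_segment_commute)
        qed
      qed
      then show "closed_segment a b \<subseteq> V" using QV Qball by blast
    qed
    note segs = this
    have "continuous_on N (\<lambda>v. G v a b)" if "(a, b) \<in> set \<Gamma>" for a b
    proof -
      have "continuous_on (closed_segment a b) F" using segs[OF that] continuous_on_subset[OF holo_continuous_on[OF F]] by blast
      from holo_continuous_on[OF cauchy_type_holo[OF this]] segs[OF that] show ?thesis
        unfolding G_def by (rule_tac continuous_on_subset) auto
    qed
    then have cG: "continuous_on N (\<lambda>v. \<Sum>(a, b)\<leftarrow>\<Gamma>. G v a b)"
      by (induction \<Gamma>) (auto simp: case_prod_beta intro!: continuous_intros)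
    have cf: "continuous_on N f"
      by (rule continuous_on_subset[OF holo_continuous_on[OF f]]) (use NT TV closure_subset in blast)
    \<comment> \<open>Points on grid lines are limits of points off the grid, and both sides are continuous.\<close>
    define D where "D v = f v - (\<Sum>(a, b)\<leftarrow>\<Gamma>. G v a b)" for v
    have cD: "isCont D w" unfolding D_def
      using continuous_on_diff[OF cf cG] w N(1) by (simp add: continuous_on_eq_continuous_at)
    define \<tau> where "\<tau> = min (d * (real_of_int \<lfloor>Re w / d\<rfloor> + 1) - Re w) (d * (real_of_int \<lfloor>Im w / d\<rfloor> + 1) - Im w)"
    have \<tau>: "\<tau> > 0" using floor_divide_upper[OF d(1)] by (auto simp: \<tau>_def algebra_simps)
    define v where "v k = w + Complex (\<tau> / real (k + 2)) (\<tau> / real (k + 2))" for k :: nat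
    have ng: "x + t \<noteq> d * real_of_int m" if "0 < t" "t < d * (real_of_int \<lfloor>x / d\<rfloor> + 1) - x" for x t m
    proof
      assume eq: "x + t = d * real_of_int m"
      have "d * real_of_int \<lfloor>x / d\<rfloor> \<le> x" using floor_divide_lower[OF d(1), of x] by (simp add: mult.commute)
      then have "d * real_of_int \<lfloor>x / d\<rfloor> < d * real_of_int m" "d * real_of_int m < d * (real_of_int \<lfloor>x / d\<rfloor> + 1)"
        using that eq by auto
      then have "real_of_int \<lfloor>x / d\<rfloor> < real_of_int m" "real_of_int m < real_of_int \<lfloor>x / d\<rfloor> + 1" using d(1) by simp_all
      then have "\<lfloor>x / d\<rfloor> < m" "m < \<lfloor>x / d\<rfloor> + 1" by (metis of_int_less_iff of_int_add of_int_1)+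
      then show False by simp
    qed
    have t: "0 < \<tau> / real (k + 2)" "\<tau> / real (k + 2) < \<tau>" for k
    proof -
      show "0 < \<tau> / real (k + 2)" using \<tau> by simp
      have "\<tau> / real (k + 2) < \<tau> / 1" using \<tau> by (intro divide_strict_left_mono) auto
      then show "\<tau> / real (k + 2) < \<tau>" by simp
    qed
    have vg: "Re (v k) \<noteq> d * real_of_int m" "Im (v k) \<noteq> d * real_of_int m" for k m
      using ng[OF t(1), of k "Re w" m] ng[OF t(1), of k "Im w" m] t(2)[of k] by (auto simp: v_def \<tau>_def)
    have "(\<lambda>k. \<tau> / real (k + 2)) \<longlonglongrightarrow> 0" by real_asymp
    then have "(\<lambda>k. w + Complex (\<tau> / real (k + 2)) (\<tau> / real (k + 2))) \<longlonglongrightarrow> w + Complex 0 0"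
      by (intro tendsto_intros tendsto_Complex)
    moreover have "w + Complex 0 0 = w" by (simp add: complex_eq_iff)
    ultimately have vw: "v \<longlonglongrightarrow> w" by (simp add: v_def[abs_def])
    then have "eventually (\<lambda>k. v k \<in> N) sequentially" using N(1) w by (rule topological_tendstoD)
    then have ev: "eventually (\<lambda>k. D (v k) = 0) sequentially"
      by eventually_elim (use off_grid vg in \<open>simp add: D_def\<close>)
    have "(\<lambda>k. D (v k)) \<longlonglongrightarrow> D w" by (rule isCont_tendsto_compose[OF cD vw])
    moreover have "(\<lambda>k. D (v k)) \<longlonglongrightarrow> 0" using ev by (rule tendsto_eventually)
    ultimately have "D w = 0" by (rule LIMSEQ_unique)
    then show ?thesis by (simp add: D_def G_def F_def)
  qed
  have "\<forall>(a, b)\<in>set \<Gamma>. (\<exists>x\<in>K. dist x a \<le> e) \<and> norm (b - a) \<le> \<epsilon> \<and> closed_segment a b \<inter> closure N = {}"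
    using \<Gamma>_good by blast
  moreover have "closure N \<subseteq> V" using NT TV by blast
  ultimately show ?thesis using N cN main by (intro exI[of _ \<Gamma>] exI[of _ N]) blast
qed

section \<open>Exact lifts with bounds\<close>

lemma holo_sum_list:
  "open S \<Longrightarrow> (\<And>x. x \<in> set xs \<Longrightarrow> holo (f x) S) \<Longrightarrow> holo (\<lambda>z. \<Sum>x\<leftarrow>xs. f x z) S"
  by (induction xs) (auto intro: holo_const holo_add)

lemma csubspace_sum_list: "csubspace Y \<Longrightarrow> (\<And>x. x \<in> set xs \<Longrightarrow> f x \<in> Y) \<Longrightarrow> (\<Sum>x\<leftarrow>xs. f x) \<in> Y"
  by (induction xs) (auto simp: csubspaceD)

text \<open>
  The integral is a limit of Riemann sums, which lie in \<open>Y\<close>.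
\<close>

lemma segint_in_closed_subspace:
  fixes g :: "complex \<Rightarrow> 'a::{complex_normed_vector,banach}"
  assumes Y: "csubspace Y" "closed Y" and g: "continuous_on (closed_segment a b) g"
    and gY: "\<And>\<zeta>. \<zeta> \<in> closed_segment a b \<Longrightarrow> g \<zeta> \<in> Y"
  shows "segint a b g \<in> Y"
proof -
  define F where "F t = (b - a) *\<^sub>C g (linepath a b t)" for t
  have I: "(F has_integral segint a b g) (cbox 0 1)"
    unfolding F_def segint_def using segint_integrable[OF g] by (simp add: integrable_integral)
  have FY: "F t \<in> Y" if "t \<in> cbox 0 1" for t
    unfolding F_def using gY linepath_in_path that by (intro csubspaceD(3)[OF Y(1)]) auto
  have "segint a b g \<in> closure Y" unfolding closure_approachable
  proof (intro allI impI)
    fix e :: real assume "e > 0"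
    from I[unfolded has_integral, rule_format, OF this] obtain \<gamma> where \<gamma>: "gauge \<gamma>"
      and fine: "\<And>D. D tagged_division_of cbox 0 1 \<and> \<gamma> fine D \<Longrightarrow>
        norm ((\<Sum>(x, k)\<in>D. measure lborel k *\<^sub>R F x) - segint a b g) < e"
      by (elim exE conjE) simp
    obtain D where D: "D tagged_division_of cbox (0::real) 1" "\<gamma> fine D"
      by (rule fine_division_exists[OF \<gamma>])
    have "(\<Sum>(x, k)\<in>D. measure lborel k *\<^sub>R F x) \<in> Y"
    proof (rule csubspace_sum[OF Y(1)])
      fix p assume p: "p \<in> D"
      obtain x k where xk: "p = (x, k)" by (cases p)
      then have "x \<in> cbox 0 1" using tagged_division_ofD(2,3)[OF D(1)] p by blast
      then show "(case p of (x, k) \<Rightarrow> measure lborel k *\<^sub>R F x) \<in> Y"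
        using FY csubspaceD(4)[OF Y(1)] by (simp add: xk)
    qed
    moreover have "dist (\<Sum>(x, k)\<in>D. measure lborel k *\<^sub>R F x) (segint a b g) < e"
      unfolding dist_norm using D by (intro fine conjI)
    ultimately show "\<exists>y\<in>Y. dist y (segint a b g) < e" by (rule bexI[rotated])
  qed
  then show ?thesis using Y(2) by simp
qed

lemma slope_sym: "slope g x y = slope g y x"
proof (cases "x = y")
  case False
  have "(1 / (y - x)) *\<^sub>C (g y - g x) = (1 / (x - y)) *\<^sub>C (g x - g y)"
  proof -
    have "1 / (y - x) = - (1 / (x - y))" by (metis minus_diff_eq minus_divide_right)
    then have "(1 / (y - x)) *\<^sub>C (g y - g x) = - ((1 / (x - y)) *\<^sub>C (g y - g x))" by (simp only: scaleC.minus_left)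
    also have "\<dots> = (1 / (x - y)) *\<^sub>C (- (g y - g x))" by (simp only: scaleC.minus_right)
    finally show ?thesis by simp
  qed
  then show ?thesis using False by (simp add: slope_def)
qed simp

context surj_family
begin

lemma slope_pi_apply:
  assumes "x \<in> U"
  shows "blinfun_apply (slope \<pi> x y) v = slope (\<lambda>z. blinfun_apply (\<pi> z) v) x y"
proof -
  have "cderiv (\<lambda>z. blinfun_apply (\<pi> z) v) x = blinfun_apply (cderiv \<pi> x) v"
    by (rule cderiv_linear[OF blinfun.bounded_linear_left _ holo_pi assms]) simp
  then show ?thesis by (simp add: slope_def blinfun.diff_left)
qed

lemma slope_pi_linear:
  assumes "x \<in> U" "y \<in> U"
  shows "blinfun_apply (slope \<pi> x y) (c *\<^sub>C v) = c *\<^sub>C blinfun_apply (slope \<pi> x y) v"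
proof -
  have hv: "holo (\<lambda>z. blinfun_apply (\<pi> z) v) U" by (rule holo_apply[OF holo_const[OF open_U]]) simp
  have "cderiv (\<lambda>z. blinfun_apply (\<pi> z) (c *\<^sub>C v)) x = cderiv (\<lambda>z. c *\<^sub>C blinfun_apply (\<pi> z) v) x"
    by (rule cderiv_cong[OF _ assms(1)]) (auto intro!: holo_scaleC holo_const[OF open_U] hv linear_pi)
  also have "\<dots> = c *\<^sub>C cderiv (\<lambda>z. blinfun_apply (\<pi> z) v) x"
    by (rule cderiv_linear[OF bounded_linear_scaleC _ hv assms(1)]) (simp add: scaleC_scaleC mult.commute)
  finally show ?thesis unfolding slope_pi_apply[OF assms(1)]
    using assms by (auto simp: slope_def linear_pi scaleC.diff_right scaleC_scaleC mult.commute)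
qed

text \<open>
  The difference quotient as a zero quotient with arbitrary pole \<open>x\<close>: far poles give no trouble, so the
  bound is uniform over the whole of \<open>K'\<close>.
\<close>

lemma slope_pi_bound:
  assumes K': "compact K'" "K' \<subseteq> U" and z: "z \<in> U"
  shows "\<exists>\<rho>>0. ball z \<rho> \<subseteq> U \<and> (\<exists>M\<ge>0. \<forall>x\<in>K'. \<forall>y\<in>ball z \<rho>. norm (slope \<pi> x y) \<le> M)"
proof -
  obtain R where R: "R > 0" "cball z R \<subseteq> U" using open_U z by (meson open_contains_cball)
  define \<rho> where "\<rho> = R / 4"
  have \<rho>: "\<rho> > 0" "ball z (4 * \<rho>) \<subseteq> cball z R" "ball z \<rho> \<subseteq> cball z R" using R by (auto simp: \<rho>_def)
  obtain A where A: "A > 0" "\<And>w. w \<in> cball z R \<Longrightarrow> norm (\<pi> w) \<le> A"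
    using holo_bounded_smaller_ball[OF holo_pi R(2)] by blast
  obtain B where B: "B \<ge> 0" "\<forall>w\<in>K'. norm (\<pi> w) \<le> B" using holo_bounded_compact[OF holo_pi K'] by blast
  have o: "ball z (4 * \<rho>) \<subseteq> U" using \<rho>(2) R(2) by blast
  have "norm (slope \<pi> x y) \<le> 2 * (A + B) / \<rho>" if x: "x \<in> K'" and y: "y \<in> ball z \<rho>" for x y
  proof -
    have xU: "x \<in> U" using x K' by blast
    have "norm (zero_quot (\<lambda>w. \<pi> w - \<pi> x) x y) \<le> 2 * (A + B) / \<rho>"
    proof (rule zero_quot_holo_bound(2)[OF _ \<rho>(1) _ _ y])
      show "holo (\<lambda>w. \<pi> w - \<pi> x) (ball z (4 * \<rho>))"
        by (intro holo_diff holo_const holo_subset[OF holo_pi o]) auto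
      show "norm (\<pi> w - \<pi> x) \<le> A + B" if "w \<in> ball z (4 * \<rho>)" for w
      proof -
        have "norm (\<pi> w) \<le> A" using A(2) \<rho>(2) that by blast
        then show ?thesis using B x norm_triangle_ineq4[of "\<pi> w" "\<pi> x"] by fastforce
      qed
    qed simp
    moreover have "cderiv (\<lambda>w. \<pi> w - \<pi> x) x = cderiv \<pi> x"
      using cderiv_diff[OF holo_pi holo_const[OF open_U] xU] by (simp add: cderiv_const)
    ultimately show ?thesis by (auto simp: zero_quot_def slope_def split: if_splits)
  qed
  moreover have "ball z \<rho> \<subseteq> U" using \<rho>(3) R(2) by blast
  moreover have "0 \<le> 2 * (A + B) / \<rho>" using A B \<rho> by simp
  ultimately show ?thesis using \<rho>(1) by blast
qed

text \<open>
  On the boundary edges \<open>H = \<pi> c\<close> with local lifts \<open>c\<close>. In Cauchy's formula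
  \<open>\<pi>(\<zeta>) c(\<zeta>) / (\<zeta> - w) = \<pi>(w) (c(\<zeta>) / (\<zeta> - w)) + s c(\<zeta>)\<close> with the difference quotient \<open>s\<close> of \<open>\<pi>\<close>
  between \<open>w\<close> and \<open>\<zeta>\<close>. The first term is lifted as it stands; the second is analytic in \<open>w\<close> on all of
  \<open>U\<close>, hence has approximate lifts near \<open>K'\<close>. What remains is small on \<open>K'\<close>, although the lift
  itself is bounded only near \<open>K\<close>: this is what makes the iteration in \<open>bounded_solution\<close> possible.
\<close>

lemma lift_up_to_small_error:
  assumes K: "compact K" "K \<subseteq> interior K'" and K': "compact K'" "K' \<subseteq> U"
    and H: "holo H (interior K')" and \<delta>: "\<delta> > 0"
  shows "\<exists>N G E C. open N \<and> K \<subseteq> N \<and> N \<subseteq> interior K' \<and> holo G N \<and> (\<forall>w\<in>N. norm (G w) \<le> C) \<and>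
    holo E (interior K') \<and> (\<forall>w\<in>interior K'. norm (E w) \<le> \<delta>) \<and>
    (\<forall>w\<in>N. H w = blinfun_apply (\<pi> w) (G w) + E w)"
proof -
  define V where "V = interior K'"
  have V: "open V" "V \<subseteq> K'" "V \<subseteq> U" using interior_subset[of K'] K' by (auto simp: V_def)
  have HV: "holo H V" using H by (simp add: V_def)
  obtain e where e: "e > 0" "(\<Union>x\<in>K. cball x e) \<subseteq> V"
    using compact_subset_open_imp_cball_epsilon_subset[OF K(1) V(1)] K(2) unfolding V_def by blast
  have eV: "y \<in> V" if "x \<in> K" "dist x y \<le> e" for x y
    using e(2) that by (meson UN_I mem_cball subsetD)
  define K2 where "K2 = {x + y | x y. x \<in> K \<and> y \<in> cball 0 e}"
  have K2: "compact K2" unfolding K2_def by (rule compact_sums[OF K(1) compact_cball])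
  have K2I: "y \<in> K2" if "x \<in> K" "dist x y \<le> e" for x y
    unfolding K2_def using that by (intro CollectI exI[of _ x] exI[of _ "y - x"]) (auto simp: dist_norm norm_minus_commute)
  have K2V: "K2 \<subseteq> V" unfolding K2_def using eV by (auto simp: dist_norm)
  have "\<forall>z\<in>K2. \<exists>r>0. ball z r \<subseteq> V \<and> (\<exists>c. holo c (ball z r) \<and> (\<forall>w\<in>ball z r. blinfun_apply (\<pi> w) (c w) = H w))"
  proof
    fix z assume "z \<in> K2"
    then obtain R where R: "R > 0" "ball z R \<subseteq> V" using K2V V(1) by (meson open_contains_ball subsetD)
    have "holo H (ball z R)" by (rule holo_subset[OF HV R(2)]) simp
    then obtain r c where r: "r > 0" "r \<le> R" "holo c (ball z r)" "\<forall>w\<in>ball z r. blinfun_apply (\<pi> w) (c w) = H w"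
      using local_lift[of R z] R V(3) by blast
    moreover have "ball z r \<subseteq> V" using R(2) r(2) subset_ball by blast
    ultimately show "\<exists>r>0. ball z r \<subseteq> V \<and> (\<exists>c. holo c (ball z r) \<and> (\<forall>w\<in>ball z r. blinfun_apply (\<pi> w) (c w) = H w))"
      by blast
  qed
  from bchoice[OF this] obtain r where r: "\<And>z. z \<in> K2 \<Longrightarrow> r z > 0" "\<And>z. z \<in> K2 \<Longrightarrow> ball z (r z) \<subseteq> V"
    "\<And>z. z \<in> K2 \<Longrightarrow> \<exists>c. holo c (ball z (r z)) \<and> (\<forall>w\<in>ball z (r z). blinfun_apply (\<pi> w) (c w) = H w)" by blast
  have "K2 \<subseteq> \<Union>((\<lambda>z. ball z (r z)) ` K2)"
  proof
    fix z assume "z \<in> K2"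
    then have "z \<in> ball z (r z)" using r(1) by simp
    then show "z \<in> \<Union>((\<lambda>z. ball z (r z)) ` K2)" using \<open>z \<in> K2\<close> by blast
  qed
  from Heine_Borel_lemma[OF K2 this] obtain \<epsilon> where \<epsilon>: "\<epsilon> > 0"
    and leb: "\<And>x. x \<in> K2 \<Longrightarrow> \<exists>G\<in>(\<lambda>z. ball z (r z)) ` K2. ball x \<epsilon> \<subseteq> G" by (metis (no_types, lifting) imageE open_ball)
  obtain \<Gamma> N where N: "open N" "K \<subseteq> N" "closure N \<subseteq> V" "compact (closure N)"
    and \<Gamma>: "\<forall>(a, b)\<in>set \<Gamma>. (\<exists>x\<in>K. dist x a \<le> e) \<and> norm (b - a) \<le> \<epsilon> / 2 \<and> closed_segment a b \<inter> closure N = {}"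
    and cauchy: "\<forall>f :: complex \<Rightarrow> 'b. holo f V \<longrightarrow> (\<forall>w\<in>N.
       f w = (\<Sum>(a, b)\<leftarrow>\<Gamma>. segint a b (\<lambda>\<zeta>. (1 / (\<zeta> - w)) *\<^sub>C ((1 / (2 * of_real pi * \<i>)) *\<^sub>C f \<zeta>))))"
    by (rule exE[OF grid_cauchy_formula[where 'a = 'b, OF K(1) e(1) eV half_gt_zero[OF \<epsilon>]]], assumption, assumption,
        elim exE conjE, rule that)
  have NN: "N \<subseteq> closure N" by (rule closure_subset)
  have "\<exists>c B. open B \<and> closed_segment a b \<subseteq> B \<and> B \<subseteq> V \<and> holo c B \<and> (\<forall>w\<in>B. blinfun_apply (\<pi> w) (c w) = H w)"
    if ab: "(a, b) \<in> set \<Gamma>" for a b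
  proof -
    have "a \<in> K2" using \<Gamma> ab K2I by blast
    then obtain z where z: "z \<in> K2" "ball a \<epsilon> \<subseteq> ball z (r z)" using leb by blast
    have "norm (b - a) \<le> \<epsilon> / 2" using \<Gamma> ab by blast
    then have "closed_segment a b \<subseteq> ball a \<epsilon>"
      using \<epsilon> by (intro closed_segment_subset) (auto simp: dist_norm norm_minus_commute)
    then have "closed_segment a b \<subseteq> ball z (r z)" using z(2) by blast
    then show ?thesis using r(2)[OF z(1)] r(3)[OF z(1)] open_ball by blast
  qed
  then have "\<forall>p\<in>set \<Gamma>. \<exists>c. \<exists>B. open B \<and> closed_segment (fst p) (snd p) \<subseteq> B \<and> B \<subseteq> V \<and> holo c B \<and> (\<forall>w\<in>B. blinfun_apply (\<pi> w) (c w) = H w)"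
    by auto
  from bchoice[OF this] obtain c where c: "\<And>a b. (a, b) \<in> set \<Gamma> \<Longrightarrow>
      \<exists>B. open B \<and> closed_segment a b \<subseteq> B \<and> B \<subseteq> V \<and> holo (c (a, b)) B \<and> (\<forall>w\<in>B. blinfun_apply (\<pi> w) (c (a, b) w) = H w)"
    by fastforce
  have cc: "continuous_on (closed_segment a b) (c (a, b))" "closed_segment a b \<subseteq> V"
      "\<And>\<zeta>. \<zeta> \<in> closed_segment a b \<Longrightarrow> blinfun_apply (\<pi> \<zeta>) (c (a, b) \<zeta>) = H \<zeta>" if ab: "(a, b) \<in> set \<Gamma>" for a b
    using c[OF ab] holo_continuous_on continuous_on_subset by blast+
  define \<kappa> where "\<kappa> = 1 / (2 * complex_of_real pi * \<i>)"
  define G1 where "G1 w = (\<Sum>(a, b)\<leftarrow>\<Gamma>. segint a b (\<lambda>\<zeta>. (1 / (\<zeta> - w)) *\<^sub>C (\<kappa> *\<^sub>C c (a, b) \<zeta>)))" for w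
  define O' where "O' = - (\<Union>(a, b)\<in>set \<Gamma>. closed_segment a b)"
  have O': "open O'" "closure N \<subseteq> O'"
  proof -
    have "closed (\<Union>(a, b)\<in>set \<Gamma>. closed_segment a b)" by (intro closed_UN) auto
    then show "open O'" unfolding O'_def by (rule open_Compl)
    show "closure N \<subseteq> O'" unfolding O'_def using \<Gamma> by blast
  qed
  have G1: "holo G1 O'"
    unfolding G1_def[abs_def] split_def
  proof (rule holo_sum_list[OF O'(1)])
    fix p assume p: "p \<in> set \<Gamma>"
    have "continuous_on (closed_segment (fst p) (snd p)) (\<lambda>\<zeta>. \<kappa> *\<^sub>C c (fst p, snd p) \<zeta>)"
      using cc(1)[of "fst p" "snd p"] p by (intro continuous_intros) simp
    from cauchy_type_holo[OF this]
    show "holo (\<lambda>w. segint (fst p) (snd p) (\<lambda>\<zeta>. (1 / (\<zeta> - w)) *\<^sub>C (\<kappa> *\<^sub>C c (fst p, snd p) \<zeta>))) O'"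
      by (rule holo_subset) (use p O'(1) in \<open>auto simp: O'_def\<close>)
  qed
  \<comment> \<open>With an empty first set, \<open>L.Y\<close> consists of limits of images of analytic maps.\<close>
  interpret L: lift_pair U \<pi> "{}" K' by unfold_locales (use K' in auto)
  define s where "s p \<zeta> w = blinfun_apply (slope \<pi> w \<zeta>) (c p \<zeta>)" for p \<zeta> w
  define Z where "Z p \<zeta> = L.res (L.both (\<lambda>w. 0) (s p \<zeta>))" for p \<zeta>
  have s_slope: "s p \<zeta> w = slope (\<lambda>z. blinfun_apply (\<pi> z) (c p \<zeta>)) \<zeta> w" if "w \<in> K'" for p \<zeta> w
    unfolding s_def using slope_pi_apply[of w] slope_sym that K'(2) by (metis subsetD)
  have hs: "holo (slope (\<lambda>z. blinfun_apply (\<pi> z) x) \<zeta>) U" for x \<zeta>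
    by (rule holo_slope[OF holo_apply[OF holo_const[OF open_U]]]) simp
  have sB: "\<exists>M\<ge>0. \<forall>w\<in>K'. norm (L.both (\<lambda>w. 0) (s p \<zeta>) w) \<le> M" for p \<zeta>
  proof (rule L.both_bounded)
    show "\<exists>M\<ge>0. \<forall>w\<in>K'. norm (s p \<zeta> w) \<le> M"
      using holo_bounded_compact[OF hs[of "c p \<zeta>" \<zeta>] K'] s_slope by simp
  qed auto
  have coordZ: "snd (coord (Z p \<zeta>) w) = s p \<zeta> w" if w: "w \<in> K'" for p \<zeta> w
  proof -
    obtain M where M: "\<forall>w\<in>K'. norm (L.both (\<lambda>w. 0) (s p \<zeta>) w) \<le> M" using sB by blast
    have "coord (Z p \<zeta>) w = (if w \<in> K' then L.both (\<lambda>w. 0) (s p \<zeta>) w else 0)"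
      unfolding Z_def by (rule L.coord_res) (use M in blast)
    then show ?thesis using w by (simp add: L.both_def)
  qed
  have ZY: "Z p \<zeta> \<in> L.Y" for p \<zeta>
  proof -
    have "Z p \<zeta> = L.res (L.both (\<lambda>w. 0) (slope (\<lambda>z. blinfun_apply (\<pi> z) (c p \<zeta>)) \<zeta>))"
      unfolding Z_def by (rule L.res_cong) (simp add: L.both_def s_slope)
    moreover have "\<exists>w. w \<notin> K'" using K'(1) compact_imp_bounded not_bounded_UNIV by (metis UNIV_eq_I)
    then have "L.res (L.both (\<lambda>w. 0) (slope (\<lambda>z. blinfun_apply (\<pi> z) (c p \<zeta>)) \<zeta>)) \<in> L.Y"
      by (intro L.pair_in_Y[where V = "{}"] hs) (auto intro: holo_const)
    ultimately show ?thesis by simp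
  qed
  have Zcont: "continuous_on (closed_segment a b) (Z (a, b))" if ab: "(a, b) \<in> set \<Gamma>" for a b
  proof (intro continuous_at_imp_continuous_on ballI)
    fix \<zeta>0 assume \<zeta>0: "\<zeta>0 \<in> closed_segment a b"
    obtain B where B: "open B" "closed_segment a b \<subseteq> B" "B \<subseteq> V" "holo (c (a, b)) B" using c[OF ab] by blast
    obtain R where R: "R > 0" "cball \<zeta>0 R \<subseteq> B" using B(1,2) \<zeta>0 by (meson open_contains_cball subsetD)
    obtain D where D: "D > 0" "\<And>\<zeta>. \<zeta> \<in> cball \<zeta>0 R \<Longrightarrow> norm (c (a, b) \<zeta>) \<le> D"
      using holo_bounded_smaller_ball[OF B(4) R(2)] by blast
    have "\<zeta>0 \<in> U" using \<zeta>0 B V by blast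
    then obtain \<rho> M where \<rho>: "\<rho> > 0" "ball \<zeta>0 \<rho> \<subseteq> U" "M \<ge> 0" "\<forall>x\<in>K'. \<forall>y\<in>ball \<zeta>0 \<rho>. norm (slope \<pi> x y) \<le> M"
      using slope_pi_bound[OF K'] by blast
    define t where "t = min R \<rho>"
    have t: "t > 0" "ball \<zeta>0 t \<subseteq> B" "ball \<zeta>0 t \<subseteq> ball \<zeta>0 \<rho>" "ball \<zeta>0 t \<subseteq> cball \<zeta>0 R" using R \<rho> by (auto simp: t_def)
    define f where "f w \<zeta> = (if w \<in> K' then L.both (\<lambda>w. 0) (s (a, b) \<zeta>) w else 0)" for w \<zeta>
    have hf: "holo (f w) (ball \<zeta>0 t)" for w
    proof (cases "w \<in> K'")
      case True
      have "holo (\<lambda>\<zeta>. blinfun_apply (slope \<pi> w \<zeta>) (c (a, b) \<zeta>)) (ball \<zeta>0 t)"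
      proof (rule holo_blinfun_apply)
        show "holo (slope \<pi> w) (ball \<zeta>0 t)" by (rule holo_subset[OF holo_slope[OF holo_pi]]) (use t \<rho> in auto)
        show "holo (c (a, b)) (ball \<zeta>0 t)" by (rule holo_subset[OF B(4) t(2)]) simp
        show "blinfun_apply (slope \<pi> w z) (k *\<^sub>C y) = k *\<^sub>C blinfun_apply (slope \<pi> w z) y" if "z \<in> ball \<zeta>0 t" for z k y
          by (rule slope_pi_linear) (use True K' that t \<rho> in auto)
      qed
      from holo_Pair[OF holo_const this, of "0 :: 'a"] show ?thesis
        using True by (simp add: f_def[abs_def] L.both_def s_def)
    qed (simp add: f_def[abs_def] holo_const)
    have fM: "norm (f w \<zeta>) \<le> M * D" if "\<zeta> \<in> ball \<zeta>0 t" for w \<zeta>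
    proof (cases "w \<in> K'")
      case True
      have "norm (blinfun_apply (slope \<pi> w \<zeta>) (c (a, b) \<zeta>)) \<le> norm (slope \<pi> w \<zeta>) * norm (c (a, b) \<zeta>)" by (rule norm_blinfun)
      also have "\<dots> \<le> M * D" using \<rho>(3,4) D True that t by (intro mult_mono) auto
      finally show ?thesis using True by (simp add: f_def L.both_def s_def norm_Pair)
    qed (use \<rho> D in \<open>simp add: f_def\<close>)
    have "\<exists>a. \<forall>w\<in>ball \<zeta>0 (t / 2). (\<lambda>k. (w - \<zeta>0) ^ k *\<^sub>C a k) sums family (\<lambda>i. f i w)"
      by (rule family_power_series[OF hf fM]) (use t in auto)
    then obtain u where "\<And>w. w \<in> ball \<zeta>0 (t / 2) \<Longrightarrow> (\<lambda>k. (w - \<zeta>0) ^ k *\<^sub>C u k) sums Z (a, b) w"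
      unfolding Z_def L.res_def f_def by blast
    from holo_continuous_on[OF power_series_holo[OF this]]
    have "\<forall>w\<in>ball \<zeta>0 (t / 2). isCont (Z (a, b)) w" unfolding continuous_on_eq_continuous_at[OF open_ball] .
    then show "isCont (Z (a, b)) \<zeta>0" using t(1) by simp
  qed
  define W where "W = (\<Sum>p\<leftarrow>\<Gamma>. segint (fst p) (snd p) (\<lambda>\<zeta>. \<kappa> *\<^sub>C Z p \<zeta>))"
  have WY: "W \<in> L.Y" unfolding W_def
  proof (rule csubspace_sum_list[OF L.Y(1)])
    fix p assume p: "p \<in> set \<Gamma>"
    show "segint (fst p) (snd p) (\<lambda>\<zeta>. \<kappa> *\<^sub>C Z p \<zeta>) \<in> L.Y"
      by (rule segint_in_closed_subspace[OF L.Y])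
        (use Zcont[of "fst p" "snd p"] p ZY csubspaceD(3)[OF L.Y(1)] in \<open>auto intro!: continuous_intros\<close>)
  qed
  define h where "h w = snd (coord W w)" for w
  have h_eq: "h w = (\<Sum>p\<leftarrow>\<Gamma>. segint (fst p) (snd p) (\<lambda>\<zeta>. \<kappa> *\<^sub>C s p \<zeta> w))" if w: "w \<in> K'" for w
  proof -
    let ?l = "\<lambda>x. snd (coord x w)"
    have bl: "bounded_linear ?l" by (rule bounded_linear_compose[OF bounded_linear_snd bounded_linear_coord])
    have "?l (\<Sum>p\<leftarrow>ps. F p) = (\<Sum>p\<leftarrow>ps. ?l (F p))" for ps :: "(complex \<times> complex) list" and F
      by (induction ps) (auto simp: bl linear_simps)
    then have "h w = (\<Sum>p\<leftarrow>\<Gamma>. ?l (segint (fst p) (snd p) (\<lambda>\<zeta>. \<kappa> *\<^sub>C Z p \<zeta>)))" by (simp add: h_def W_def)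
    also have "\<dots> = (\<Sum>p\<leftarrow>\<Gamma>. segint (fst p) (snd p) (\<lambda>\<zeta>. \<kappa> *\<^sub>C s p \<zeta> w))"
    proof (rule arg_cong[of _ _ sum_list], rule map_cong[OF refl])
      fix p assume p: "p \<in> set \<Gamma>"
      have "continuous_on (closed_segment (fst p) (snd p)) (\<lambda>\<zeta>. \<kappa> *\<^sub>C Z p \<zeta>)"
        using Zcont[of "fst p" "snd p"] p by (intro continuous_intros) simp
      from segint_linear[OF bl _ this]
      have "?l (segint (fst p) (snd p) (\<lambda>\<zeta>. \<kappa> *\<^sub>C Z p \<zeta>)) = segint (fst p) (snd p) (\<lambda>\<zeta>. ?l (\<kappa> *\<^sub>C Z p \<zeta>))" by simp
      then show "?l (segint (fst p) (snd p) (\<lambda>\<zeta>. \<kappa> *\<^sub>C Z p \<zeta>)) = segint (fst p) (snd p) (\<lambda>\<zeta>. \<kappa> *\<^sub>C s p \<zeta> w)"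
        using coordZ[OF w] by simp
    qed
    finally show ?thesis .
  qed
  have approx: "\<exists>X g. K' \<subseteq> X \<and> X \<subseteq> U \<and> holo g X \<and> (\<forall>w\<in>K'. norm (blinfun_apply (\<pi> w) (g w) - h w) < \<eta>)" if eta: "\<eta> > 0" for \<eta>
  proof -
    obtain X g where g: "K' \<subseteq> X" "X \<subseteq> U" "holo g X"
      "\<forall>w\<in>K'. norm (L.both g (\<lambda>w. blinfun_apply (\<pi> w) (g w)) w - coord W w) < \<eta>"
      using L.Y_approx[OF WY eta] by blast
    have "norm (blinfun_apply (\<pi> w) (g w) - h w) < \<eta>" if "w \<in> K'" for w
    proof -
      define p where "p = L.both g (\<lambda>w. blinfun_apply (\<pi> w) (g w)) w - coord W w"
      have "snd p = blinfun_apply (\<pi> w) (g w) - h w" by (simp add: p_def L.both_def h_def)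
      moreover have "norm (snd p) \<le> norm p" using norm_snd_le[of "snd p" "fst p"] by simp
      moreover have "norm p < \<eta>" using g(4) that by (simp add: p_def)
      ultimately show ?thesis by simp
    qed
    then show ?thesis using g by blast
  qed
  have hV: "holo h V"
  proof -
    have "\<forall>n. \<exists>X g. K' \<subseteq> X \<and> X \<subseteq> U \<and> holo g X \<and> (\<forall>w\<in>K'. norm (blinfun_apply (\<pi> w) (g w) - h w) < 1 / real (Suc n))"
      using approx by simp
    then obtain X g where g: "\<And>n. K' \<subseteq> X n" "\<And>n. X n \<subseteq> U" "\<And>n. holo (g n) (X n)"
      "\<And>n w. w \<in> K' \<Longrightarrow> norm (blinfun_apply (\<pi> w) (g n w) - h w) < 1 / real (Suc n)" by metis
    have ul: "uniform_limit V (\<lambda>n w. blinfun_apply (\<pi> w) (g n w)) h sequentially"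
    proof (rule uniform_limitI)
      fix \<eta> :: real assume "\<eta> > 0"
      then obtain m where m: "1 / real (Suc m) < \<eta>" using nat_approx_posE by blast
      show "\<forall>\<^sub>F n in sequentially. \<forall>w\<in>V. dist (blinfun_apply (\<pi> w) (g n w)) (h w) < \<eta>"
        unfolding eventually_sequentially
      proof (intro exI[of _ m] allI impI ballI)
        fix n w assume "m \<le> n" "w \<in> V"
        then have "norm (blinfun_apply (\<pi> w) (g n w) - h w) < 1 / real (Suc n)" using g(4) V(2) by blast
        also have "\<dots> \<le> 1 / real (Suc m)" using \<open>m \<le> n\<close> by (intro divide_left_mono) auto
        finally show "dist (blinfun_apply (\<pi> w) (g n w)) (h w) < \<eta>" using m by (simp add: dist_norm)
      qed
    qed
    have hn: "holo (\<lambda>w. blinfun_apply (\<pi> w) (g n w)) V" for n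
      by (rule holo_apply[OF holo_subset[OF g(3)]]) (use V g(1) in blast)+
    show ?thesis by (rule holo_uniform_limit[OF hn ul])
  qed
  obtain X G2 where G2: "K' \<subseteq> X" "X \<subseteq> U" "holo G2 X" "\<forall>w\<in>K'. norm (blinfun_apply (\<pi> w) (G2 w) - h w) < \<delta>"
    using approx[OF \<delta>] by blast
  define E where "E w = h w - blinfun_apply (\<pi> w) (G2 w)" for w
  define G where "G w = G1 w + G2 w" for w
  have NK': "closure N \<subseteq> K'" using N(3) V(2) by blast
  have "holo E V" unfolding E_def
    by (intro holo_diff hV holo_apply[OF holo_subset[OF G2(3)]]) (use V G2(1) in blast)+
  moreover have "norm (E w) \<le> \<delta>" if "w \<in> V" for w
    using G2(4) that V(2) by (auto simp: E_def norm_minus_commute less_imp_le)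
  moreover have "holo G N" unfolding G_def
    by (intro holo_add holo_subset[OF G1] holo_subset[OF G2(3)] N(1)) (use NN O'(2) NK' G2(1) in blast)+
  moreover have "\<exists>C. \<forall>w\<in>N. norm (G w) \<le> C"
  proof -
    obtain A B where A: "\<forall>w\<in>closure N. norm (G1 w) \<le> A" and B: "\<forall>w\<in>closure N. norm (G2 w) \<le> B"
      using holo_bounded_compact[OF G1 N(4) O'(2)] holo_bounded_compact[OF G2(3) N(4)] NK' G2(1) by blast
    have "norm (G w) \<le> A + B" if "w \<in> N" for w
    proof -
      have "w \<in> closure N" using that NN by blast
      then show ?thesis using A B norm_triangle_ineq[of "G1 w" "G2 w"] unfolding G_def by fastforce
    qed
    then show ?thesis by blast
  qed
  moreover have "H w = blinfun_apply (\<pi> w) (G w) + E w" if w: "w \<in> N" for w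
  proof -
    have wK': "w \<in> K'" and wU: "w \<in> U" using w NN NK' K'(2) by blast+
    have edge: "segint a b (\<lambda>\<zeta>. (1 / (\<zeta> - w)) *\<^sub>C (\<kappa> *\<^sub>C H \<zeta>)) =
        blinfun_apply (\<pi> w) (segint a b (\<lambda>\<zeta>. (1 / (\<zeta> - w)) *\<^sub>C (\<kappa> *\<^sub>C c (a, b) \<zeta>))) + segint a b (\<lambda>\<zeta>. \<kappa> *\<^sub>C s (a, b) \<zeta> w)"
      if ab: "(a, b) \<in> set \<Gamma>" for a b
    proof -
      have nw: "\<zeta> - w \<noteq> 0" if "\<zeta> \<in> closed_segment a b" for \<zeta> using \<Gamma> ab w NN that by fastforce
      have c1: "continuous_on (closed_segment a b) (\<lambda>\<zeta>. (1 / (\<zeta> - w)) *\<^sub>C (\<kappa> *\<^sub>C c (a, b) \<zeta>))"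
        using nw by (intro continuous_intros cc(1)[OF ab]) auto
      have c2: "continuous_on (closed_segment a b) (\<lambda>\<zeta>. blinfun_apply (\<pi> w) ((1 / (\<zeta> - w)) *\<^sub>C (\<kappa> *\<^sub>C c (a, b) \<zeta>)))"
        by (intro bounded_linear.continuous_on[OF blinfun.bounded_linear_right] c1)
      have cH: "continuous_on (closed_segment a b) H"
        using continuous_on_subset[OF holo_continuous_on[OF HV] cc(2)[OF ab]] .
      have pw: "\<kappa> *\<^sub>C s (a, b) \<zeta> w = (1 / (\<zeta> - w)) *\<^sub>C (\<kappa> *\<^sub>C H \<zeta>) - blinfun_apply (\<pi> w) ((1 / (\<zeta> - w)) *\<^sub>C (\<kappa> *\<^sub>C c (a, b) \<zeta>))"
        if \<zeta>: "\<zeta> \<in> closed_segment a b" for \<zeta>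
        using nw[OF \<zeta>] cc(3)[OF ab \<zeta>]
        by (simp add: s_def slope_def linear_pi[OF wU] blinfun.diff_left scaleC.diff_right scaleC_scaleC mult.commute)
      have c3: "continuous_on (closed_segment a b) (\<lambda>\<zeta>. \<kappa> *\<^sub>C s (a, b) \<zeta> w)"
        by (rule continuous_on_eq[OF _ pw[symmetric]])
          (use nw in \<open>auto intro!: continuous_intros cH c2\<close>)
      have "segint a b (\<lambda>\<zeta>. (1 / (\<zeta> - w)) *\<^sub>C (\<kappa> *\<^sub>C H \<zeta>)) =
          segint a b (\<lambda>\<zeta>. blinfun_apply (\<pi> w) ((1 / (\<zeta> - w)) *\<^sub>C (\<kappa> *\<^sub>C c (a, b) \<zeta>)) + \<kappa> *\<^sub>C s (a, b) \<zeta> w)"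
        by (rule segint_cong) (simp add: pw)
      also have "\<dots> = segint a b (\<lambda>\<zeta>. blinfun_apply (\<pi> w) ((1 / (\<zeta> - w)) *\<^sub>C (\<kappa> *\<^sub>C c (a, b) \<zeta>))) + segint a b (\<lambda>\<zeta>. \<kappa> *\<^sub>C s (a, b) \<zeta> w)"
        by (rule segint_add[OF c2 c3])
      also have "segint a b (\<lambda>\<zeta>. blinfun_apply (\<pi> w) ((1 / (\<zeta> - w)) *\<^sub>C (\<kappa> *\<^sub>C c (a, b) \<zeta>)))
          = blinfun_apply (\<pi> w) (segint a b (\<lambda>\<zeta>. (1 / (\<zeta> - w)) *\<^sub>C (\<kappa> *\<^sub>C c (a, b) \<zeta>)))"
        by (rule segint_linear[OF blinfun.bounded_linear_right linear_pi[OF wU] c1])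
      finally show ?thesis .
    qed
    have "H w = (\<Sum>p\<leftarrow>\<Gamma>. segint (fst p) (snd p) (\<lambda>\<zeta>. (1 / (\<zeta> - w)) *\<^sub>C (\<kappa> *\<^sub>C H \<zeta>)))"
      using cauchy HV w unfolding \<kappa>_def split_def by blast
    also have "\<dots> = (\<Sum>p\<leftarrow>\<Gamma>. blinfun_apply (\<pi> w) (segint (fst p) (snd p) (\<lambda>\<zeta>. (1 / (\<zeta> - w)) *\<^sub>C (\<kappa> *\<^sub>C c p \<zeta>))) + segint (fst p) (snd p) (\<lambda>\<zeta>. \<kappa> *\<^sub>C s p \<zeta> w))"
      by (rule arg_cong[of _ _ sum_list], rule map_cong[OF refl]) (use edge in force)
    also have "\<dots> = blinfun_apply (\<pi> w) (G1 w) + h w"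
      unfolding h_eq[OF wK'] G1_def split_def prod.collapse sum_list_addf
      by (induction \<Gamma>) (auto simp: blinfun.add_right)
    finally show ?thesis by (simp add: G_def E_def blinfun.add_right)
  qed
  ultimately have "open N \<and> K \<subseteq> N \<and> N \<subseteq> V \<and> holo G N \<and> (\<exists>C. \<forall>w\<in>N. norm (G w) \<le> C) \<and>
    holo E V \<and> (\<forall>w\<in>V. norm (E w) \<le> \<delta>) \<and> (\<forall>w\<in>N. H w = blinfun_apply (\<pi> w) (G w) + E w)"
    using N NN by blast
  then show ?thesis unfolding V_def by blast
qed

text \<open>
  Every \<open>f\<close> in the unit ball is a coordinate of one analytic map \<open>H\<close> into a space of bounded families.
  Applied to \<open>H\<close>, the previous lemma lifts all \<open>f\<close> at once, with one constant \<open>C\<close> and with errors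
  that are again in the unit ball after multiplication by two.
\<close>

theorem bounded_solution:
  assumes K: "compact K" "K \<subseteq> interior K'" and K': "compact K'" "K' \<subseteq> U"
  shows "\<exists>N C. open N \<and> K \<subseteq> N \<and> N \<subseteq> interior K' \<and> C \<ge> 0 \<and>
    (\<forall>f. holo f (interior K') \<longrightarrow> (\<forall>z\<in>interior K'. norm (f z) \<le> 1) \<longrightarrow>
      (\<exists>g. holo g N \<and> (\<forall>z\<in>N. norm (g z) \<le> C \<and> blinfun_apply (\<pi> z) (g z) = f z)))"
proof -
  define V where "V = interior K'"
  have V: "open V" "V \<subseteq> K'" "V \<subseteq> U" using interior_subset[of K'] K' by (auto simp: V_def)
  define I where "I = {f :: complex \<Rightarrow> 'b. holo f V \<and> (\<forall>z\<in>V. norm (f z) \<le> 1)}"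
  define \<Phi> :: "complex \<Rightarrow> (complex \<Rightarrow> 'b, 'a) linf \<Rightarrow>\<^sub>L (complex \<Rightarrow> 'b, 'b) linf" where "\<Phi> z = map_linf (\<pi> z)" for z
  interpret P: surj_family U \<Phi> unfolding \<Phi>_def[abs_def] by (rule surj_family_linf[OF surj_family_axioms])
  define u where "u f z = (if f \<in> I then f z else 0)" for f :: "complex \<Rightarrow> 'b" and z
  define H :: "complex \<Rightarrow> (complex \<Rightarrow> 'b, 'b) linf" where "H z = family (\<lambda>f. u f z)" for z
  have u1: "norm (u f z) \<le> 1" if "z \<in> V" for f z using that by (auto simp: u_def I_def)
  have cH: "coord (H z) f = u f z" if "z \<in> V" for f z unfolding H_def by (rule coord_family) (rule u1[OF that])
  have HV: "holo H V"
  proof (rule holo_local)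
    fix z assume "z \<in> V"
    then obtain R where R: "R > 0" "ball z R \<subseteq> V" using V(1) by (meson open_contains_ball)
    have "holo (u f) (ball z R)" for f
    proof (cases "f \<in> I")
      case True
      then have "holo f V" by (simp add: I_def)
      then have "holo f (ball z R)" by (rule holo_subset[OF _ R(2)]) simp
      then show ?thesis using True by (simp add: u_def[abs_def])
    qed (simp add: u_def[abs_def] holo_const)
    then have "\<exists>a. \<forall>w\<in>ball z (R / 2). (\<lambda>k. (w - z) ^ k *\<^sub>C a k) sums family (\<lambda>f. u f w)"
      by (rule family_power_series[where M = 1]) (use u1 R in auto)
    then obtain a where "\<And>w. w \<in> ball z (R / 2) \<Longrightarrow> (\<lambda>k. (w - z) ^ k *\<^sub>C a k) sums H w" unfolding H_def by blast
    from power_series_holo[OF this] have "holo H (ball z (R / 2))" .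
    moreover have "ball z (R / 2) \<subseteq> ball z R" using R(1) by (intro subset_ball) simp
    then have "ball z (R / 2) \<subseteq> V" using R(2) by blast
    moreover have "z \<in> ball z (R / 2)" using R(1) by simp
    ultimately show "\<exists>T. z \<in> T \<and> T \<subseteq> V \<and> holo H T" by blast
  qed
  obtain N G E C where N: "open N" "K \<subseteq> N" "N \<subseteq> V" and G: "holo G N" "\<And>w. w \<in> N \<Longrightarrow> norm (G w) \<le> C"
    and E: "holo E V" "\<And>w. w \<in> V \<Longrightarrow> norm (E w) \<le> 1 / 2"
    and HGE: "\<And>w. w \<in> N \<Longrightarrow> H w = blinfun_apply (\<Phi> w) (G w) + E w"
    using P.lift_up_to_small_error[OF K K' HV[unfolded V_def] half_gt_zero[OF zero_less_one]] unfolding V_def[symmetric]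
    by (elim exE conjE) (rule that, assumption+, erule bspec, assumption+, erule bspec, assumption, erule bspec)
  define D where "D = max C 0"
  have GD: "norm (coord (G w) f) \<le> D" if "w \<in> N" for w f
    using order_trans[OF norm_coord G(2)[OF that], of f] by (simp add: D_def)
  define step where "step f w = 2 *\<^sub>C coord (E w) f" for f :: "complex \<Rightarrow> 'b" and w
  have stepI: "step f \<in> I" for f
  proof -
    have "holo (\<lambda>w. coord (E w) f) V" by (rule holo_linear[OF bounded_linear_coord _ E(1)]) simp
    then have "holo (step f) V" unfolding step_def[abs_def] by (intro holo_scaleC holo_const[OF V(1)])
    moreover have "norm (step f w) \<le> 1" if "w \<in> V" for w
      using order_trans[OF norm_coord E(2)[OF that], of f] by (simp add: step_def norm_scaleC)
    ultimately show ?thesis by (simp add: I_def)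
  qed
  have rec: "blinfun_apply (\<pi> w) (coord (G w) f) = f w - (1 / 2) *\<^sub>C step f w" if "f \<in> I" "w \<in> N" for f w
  proof -
    have "w \<in> V" using that N by blast
    then have "f w = coord (H w) f" using that by (simp add: cH u_def)
    also have "\<dots> = blinfun_apply (\<pi> w) (coord (G w) f) + coord (E w) f"
      by (simp add: HGE[OF that(2)] \<Phi>_def)
    finally show ?thesis by (simp add: step_def scaleC_scaleC)
  qed
  have "\<exists>g. holo g N \<and> (\<forall>z\<in>N. norm (g z) \<le> 2 * D \<and> blinfun_apply (\<pi> z) (g z) = f z)" if f: "f \<in> I" for f
  proof -
    define F where "F n = (step ^^ n) f" for n
    have F: "F 0 = f" "F (Suc n) = step (F n)" "F n \<in> I" for n
      by (simp_all add: F_def) (induction n, auto simp: f stepI)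
    define t where "t n w = (1 / 2 :: complex) ^ n *\<^sub>C coord (G w) (F n)" for n w
    have tD: "norm (t n w) \<le> D * (1 / 2) ^ n" if "w \<in> N" for n w
      using GD[OF that, of "F n"] by (simp add: t_def norm_scaleC norm_power norm_divide power_divide mult.commute divide_right_mono)
    have geo: "(\<lambda>n. D * (1 / 2) ^ n) sums (D * (1 / (1 - 1 / 2)))" by (intro sums_mult geometric_sums) simp
    define g where "g w = (\<Sum>n. t n w)" for w
    have ul: "uniform_limit N (\<lambda>n w. \<Sum>i<n. t i w) g sequentially"
      unfolding g_def[abs_def] by (rule Weierstrass_m_test[OF tD sums_summable[OF geo]])
    have ht: "holo (t n) N" for n unfolding t_def[abs_def]
      by (intro holo_scaleC holo_const[OF N(1)] holo_linear[OF bounded_linear_coord _ G(1)]) simp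
    have "holo g N" by (rule holo_uniform_limit[OF _ ul]) (intro holo_sum N(1) ht)
    moreover have "norm (g w) \<le> 2 * D \<and> blinfun_apply (\<pi> w) (g w) = f w" if w: "w \<in> N" for w
    proof
      have summ: "summable (\<lambda>n. t n w)" by (rule summable_comparison_test'[OF sums_summable[OF geo] tD[OF w]])
      show "norm (g w) \<le> 2 * D"
        using norm_suminf_le[OF tD[OF w] sums_summable[OF geo]] sums_unique[OF geo] by (simp add: g_def)
      have wU: "w \<in> U" using w N V by blast
      have "(\<lambda>n. blinfun_apply (\<pi> w) (t n w)) sums blinfun_apply (\<pi> w) (g w)"
        unfolding g_def by (rule bounded_linear.sums[OF blinfun.bounded_linear_right summable_sums[OF summ]])
      moreover have "blinfun_apply (\<pi> w) (t n w) = (1 / 2) ^ n *\<^sub>C F n w - (1 / 2) ^ Suc n *\<^sub>C F (Suc n) w" for n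
        by (simp add: t_def linear_pi[OF wU] rec[OF F(3) w] F(2) scaleC.diff_right scaleC_scaleC mult.commute)
      moreover have "(\<lambda>n. (1 / 2) ^ n *\<^sub>C F n w - (1 / 2) ^ Suc n *\<^sub>C F (Suc n) w) sums ((1 / 2) ^ 0 *\<^sub>C F 0 w - 0)"
      proof (rule telescope_sums')
        have "norm ((1 / 2 :: complex) ^ n *\<^sub>C F n w) \<le> (1 / 2) ^ n" for n
          using F(3)[of n] w N by (auto simp: norm_scaleC norm_power norm_divide I_def power_divide intro!: divide_right_mono)
        moreover have "(\<lambda>n. (1 / 2 :: real) ^ n) \<longlonglongrightarrow> 0" by (intro LIMSEQ_power_zero) simp
        ultimately show "(\<lambda>n. (1 / 2 :: complex) ^ n *\<^sub>C F n w) \<longlonglongrightarrow> 0"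
          by (rule Lim_null_comparison[OF always_eventually[OF allI]])
      qed
      ultimately show "blinfun_apply (\<pi> w) (g w) = f w" using sums_unique2 by (fastforce simp: F(1))
    qed
    ultimately show ?thesis by blast
  qed
  then have "\<forall>f. holo f V \<longrightarrow> (\<forall>z\<in>V. norm (f z) \<le> 1) \<longrightarrow>
      (\<exists>g. holo g N \<and> (\<forall>z\<in>N. norm (g z) \<le> 2 * D \<and> blinfun_apply (\<pi> z) (g z) = f z))"
    by (simp add: I_def)
  moreover have "2 * D \<ge> 0" by (simp add: D_def)
  ultimately show ?thesis using N unfolding V_def by blast
qed

end

section \<open>Exhaustion and global lifts\<close>

text \<open>The first condition also makes the set with index \<open>0\<close> empty, where every construction can start.\<close>

definition exhaustion :: "complex set \<Rightarrow> nat \<Rightarrow> complex set" where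
  "exhaustion U n = {z. norm z + 1 \<le> real n \<and> ball z (1 / real (Suc n)) \<subseteq> U}"

lemma exhaustion_0: "exhaustion U 0 = {}"
proof -
  have "\<not> norm z + 1 \<le> real 0" for z :: complex using norm_ge_zero[of z] by (simp add: not_le add_nonneg_pos)
  then show ?thesis by (simp add: exhaustion_def)
qed

lemma exhaustion_subset: "exhaustion U n \<subseteq> U"
  by (force simp: exhaustion_def)

lemma compact_exhaustion: "compact (exhaustion U n)"
proof (rule compact_eq_bounded_closed[THEN iffD2], rule conjI)
  have "exhaustion U n \<subseteq> cball 0 (real n)" by (auto simp: exhaustion_def)
  then show "bounded (exhaustion U n)" using bounded_cball bounded_subset by blast
  have "exhaustion U n = cball 0 (real n - 1) \<inter> - (\<Union>w\<in>-U. ball w (1 / real (Suc n)))"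
    by (auto simp: exhaustion_def dist_commute)
  moreover have "open (\<Union>w\<in>-U. ball w (1 / real (Suc n)))" by (intro open_UN) simp
  ultimately show "closed (exhaustion U n)" by (metis closed_Compl closed_Int closed_cball)
qed

lemma exhaustion_interior: "exhaustion U n \<subseteq> interior (exhaustion U (Suc n))"
proof
  fix z assume z: "z \<in> exhaustion U n"
  define d where "d = 1 / real (Suc n) - 1 / real (Suc (Suc n))"
  have "1 / real (Suc (Suc n)) < 1 / real (Suc n)" by (simp add: divide_strict_left_mono)
  moreover have "1 / real (Suc n) \<le> 1" "1 / real (Suc (Suc n)) \<ge> 0" by simp_all
  ultimately have d: "d > 0" "d \<le> 1" unfolding d_def by linarith+
  have "ball z d \<subseteq> exhaustion U (Suc n)"
  proof
    fix y assume y: "y \<in> ball z d"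
    have "norm y \<le> norm z + dist z y" using norm_triangle_ineq[of z "y - z"] by (simp add: dist_norm norm_minus_commute)
    then have "norm y + 1 \<le> real (Suc n)" using y z d(2) by (simp add: exhaustion_def)
    moreover have "ball y (1 / real (Suc (Suc n))) \<subseteq> ball z (1 / real (Suc n))"
    proof
      fix x assume "x \<in> ball y (1 / real (Suc (Suc n)))"
      then show "x \<in> ball z (1 / real (Suc n))" using dist_triangle[of z x y] y unfolding d_def mem_ball by linarith
    qed
    ultimately show "y \<in> exhaustion U (Suc n)" using z by (auto simp: exhaustion_def)
  qed
  then show "z \<in> interior (exhaustion U (Suc n))" using d(1) by (meson centre_in_ball interiorI open_ball)
qed

lemma exhaustion_mono: "m \<le> n \<Longrightarrow> exhaustion U m \<subseteq> exhaustion U n"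
proof (induction n rule: dec_induct)
  case (step n)
  then show ?case using exhaustion_interior[of U n] interior_subset[of "exhaustion U (Suc n)"] by blast
qed simp

lemma exhaustion_covers:
  assumes "open U" "z \<in> U"
  shows "\<exists>n. z \<in> interior (exhaustion U n)"
proof -
  obtain e where e: "e > 0" "ball z e \<subseteq> U" using assms by (meson open_contains_ball)
  obtain k where k: "1 / real (Suc k) < e" using nat_approx_posE[OF e(1)] by blast
  obtain m where m: "norm z + 1 \<le> real m" using real_arch_simple by blast
  define n where "n = max k m"
  have "1 / real (Suc n) \<le> 1 / real (Suc k)" by (intro divide_left_mono) (auto simp: n_def)
  then have "ball z (1 / real (Suc n)) \<subseteq> ball z e" using k by (intro subset_ball) simp
  moreover have "real m \<le> real n" by (simp add: n_def)
  ultimately have "z \<in> exhaustion U n" using e(2) m by (auto simp: exhaustion_def)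
  then show ?thesis using exhaustion_interior by blast
qed

text \<open>
  A point outside \<open>exhaustion U n\<close> is too large, and then a radial segment leads away from all smaller
  points, or too near to a point of the complement of \<open>U\<close>, and then every point of the segment
  towards that point is as near to it.
\<close>

lemma exhaustion_hull:
  assumes \<mu>: "\<mu> \<in> exhaustion U m - exhaustion U n"
  shows "\<exists>w. w \<notin> exhaustion U m \<and> closed_segment \<mu> w \<inter> exhaustion U n = {}"
proof (cases "norm \<mu> + 1 \<le> real n")
  case True
  then obtain w where w: "w \<in> ball \<mu> (1 / real (Suc n))" "w \<notin> U" using \<mu> unfolding exhaustion_def by blast
  have "x \<notin> exhaustion U n" if "x \<in> closed_segment \<mu> w" for x
  proof -
    have "dist x w \<le> dist \<mu> w" using dist_in_closed_segment[OF that] by (simp add: dist_commute)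
    then have "w \<in> ball x (1 / real (Suc n))" using w(1) by simp
    then show ?thesis using w(2) by (auto simp: exhaustion_def)
  qed
  then show ?thesis using w(2) exhaustion_subset by blast
next
  case False
  show ?thesis
  proof (cases "\<mu> = 0")
    case True
    then have "n = 0" using False by (cases n) auto
    moreover have "complex_of_real (real m) \<notin> exhaustion U m" by (simp add: exhaustion_def)
    ultimately show ?thesis by (auto simp: exhaustion_0)
  next
    case \<mu>0: False
    define r where "r = real m / norm \<mu>"
    have r: "r \<ge> 0" "r * norm \<mu> = real m" using \<mu>0 by (auto simp: r_def)
    have "norm ((1 + r) *\<^sub>R \<mu>) = norm \<mu> + real m" using r unfolding norm_scaleR by (simp add: distrib_right)
    then have "\<not> norm ((1 + r) *\<^sub>R \<mu>) + 1 \<le> real m" using norm_ge_zero[of \<mu>] by linarith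
    then have "(1 + r) *\<^sub>R \<mu> \<notin> exhaustion U m" unfolding exhaustion_def by blast
    moreover have "x \<notin> exhaustion U n" if x: "x \<in> closed_segment \<mu> ((1 + r) *\<^sub>R \<mu>)" for x
    proof -
      obtain u where u: "0 \<le> u" "x = (1 - u) *\<^sub>R \<mu> + u *\<^sub>R (1 + r) *\<^sub>R \<mu>" using x by (auto simp: closed_segment_def)
      then have "x = (1 + u * r) *\<^sub>R \<mu>" by (simp add: algebra_simps)
      then have "norm x = (1 + u * r) * norm \<mu>" using u(1) r(1) by simp
      moreover have "1 * norm \<mu> \<le> (1 + u * r) * norm \<mu>" using u(1) r(1) by (intro mult_right_mono) auto
      ultimately show ?thesis using False by (simp add: exhaustion_def)
    qed
    ultimately show ?thesis by blast
  qed
qed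

context surj_family
begin

text \<open>
  One step of the exhaustion: an approximate lift on the larger set that is close to the given lift is made
  exact by \<open>bounded_solution\<close>, which costs a constant times the error of approximation.
\<close>

lemma next_lift:
  assumes h: "holo h U" and W: "exhaustion U n \<subseteq> W" "W \<subseteq> U" "holo k W"
    and kh: "\<And>z. z \<in> W \<Longrightarrow> blinfun_apply (\<pi> z) (k z) = h z" and \<eta>: "\<eta> > 0"
  shows "\<exists>N g. exhaustion U (Suc n) \<subseteq> N \<and> N \<subseteq> U \<and> holo g N \<and> (\<forall>z\<in>N. blinfun_apply (\<pi> z) (g z) = h z) \<and>
    (\<forall>z\<in>exhaustion U n. norm (g z - k z) \<le> \<eta>)"
proof -
  define K where "K = exhaustion U n"
  define K1 where "K1 = exhaustion U (Suc n)"
  define K2 where "K2 = exhaustion U (Suc (Suc n))"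
  have KU: "K \<subseteq> K1" "K1 \<subseteq> interior K2" "interior K2 \<subseteq> K2" "K2 \<subseteq> U"
    using exhaustion_interior[of U "Suc n"] exhaustion_mono[of n "Suc n" U] exhaustion_subset[of U "Suc (Suc n)"]
      interior_subset[of "exhaustion U (Suc (Suc n))"]
    unfolding K_def K1_def K2_def by auto
  obtain N C where N: "open N" "K1 \<subseteq> N" "N \<subseteq> interior K2" and C: "C \<ge> 0"
    and sol: "\<And>f. holo f (interior K2) \<Longrightarrow> \<forall>z\<in>interior K2. norm (f z) \<le> 1 \<Longrightarrow>
      \<exists>g. holo g N \<and> (\<forall>z\<in>N. norm (g z) \<le> C \<and> blinfun_apply (\<pi> z) (g z) = f z)"
    using bounded_solution[of K1 K2] KU compact_exhaustion unfolding K1_def K2_def by metis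
  define \<epsilon> where "\<epsilon> = \<eta> / (1 + C)"
  have \<epsilon>: "\<epsilon> > 0" "\<epsilon> + \<epsilon> * C = \<eta>"
  proof -
    show "\<epsilon> > 0" using \<eta> C by (simp add: \<epsilon>_def)
    have "\<epsilon> * (1 + C) = \<eta>" using C by (simp add: \<epsilon>_def)
    then show "\<epsilon> + \<epsilon> * C = \<eta>" by (simp add: distrib_left)
  qed
  obtain X g where g: "K2 \<subseteq> X" "X \<subseteq> U" "holo g X" "\<forall>z\<in>K. norm (g z - k z) < \<epsilon>"
    "\<forall>z\<in>K2. norm (blinfun_apply (\<pi> z) (g z) - h z) < \<epsilon>"
  proof -
    interpret L: lift_pair U \<pi> K K2
      by unfold_locales (use KU compact_exhaustion in \<open>auto simp: K_def K2_def\<close>)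
    show ?thesis
      using L.simultaneous_approximation[OF exhaustion_hull[where U = U and m = "Suc (Suc n)" and n = n, folded K_def K2_def]
          h W(1)[folded K_def] W(2,3) kh \<epsilon>(1)] that by auto
  qed
  define f where "f z = complex_of_real (1 / \<epsilon>) *\<^sub>C (h z - blinfun_apply (\<pi> z) (g z))" for z
  have NU: "N \<subseteq> U" "N \<subseteq> X" "interior K2 \<subseteq> X" "interior K2 \<subseteq> U" using N KU g by blast+
  have "holo f (interior K2)" unfolding f_def[abs_def]
    by (intro holo_scaleC holo_const holo_diff holo_subset[OF h] holo_apply[OF holo_subset[OF g(3)]]) (use NU in auto)
  moreover have "norm (f z) \<le> 1" if "z \<in> interior K2" for z
  proof -
    have "norm (h z - blinfun_apply (\<pi> z) (g z)) < \<epsilon>" using g(5) that KU(3) by (auto simp: norm_minus_commute)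
    then show ?thesis using \<epsilon>(1) by (simp add: f_def norm_scaleC norm_divide)
  qed
  ultimately obtain e where e: "holo e N" "\<forall>z\<in>N. norm (e z) \<le> C \<and> blinfun_apply (\<pi> z) (e z) = f z"
    using sol[of f] by blast
  define g' where "g' z = g z + complex_of_real \<epsilon> *\<^sub>C e z" for z
  have "holo g' N" unfolding g'_def[abs_def]
    by (intro holo_add holo_scaleC holo_const e(1) holo_subset[OF g(3)] N(1) NU)
  moreover have "\<forall>z\<in>N. blinfun_apply (\<pi> z) (g' z) = h z"
  proof
    fix z assume z: "z \<in> N"
    then have "z \<in> U" using NU by blast
    then have "blinfun_apply (\<pi> z) (g' z) = blinfun_apply (\<pi> z) (g z) + complex_of_real \<epsilon> *\<^sub>C f z"
      using e(2) z by (simp add: g'_def blinfun.add_right linear_pi)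
    also have "complex_of_real \<epsilon> *\<^sub>C f z = h z - blinfun_apply (\<pi> z) (g z)"
      using \<epsilon>(1) by (simp add: f_def scaleC_scaleC flip: of_real_mult of_real_inverse)
    finally show "blinfun_apply (\<pi> z) (g' z) = h z" by simp
  qed
  moreover have "\<forall>z\<in>K. norm (g' z - k z) \<le> \<eta>"
  proof
    fix z assume z: "z \<in> K"
    then have "norm (e z) \<le> C" using e(2) KU N by blast
    then have "norm (complex_of_real \<epsilon> *\<^sub>C e z) \<le> \<epsilon> * C" using \<epsilon>(1) by (simp add: norm_scaleC)
    moreover have eq: "g' z - k z = (g z - k z) + complex_of_real \<epsilon> *\<^sub>C e z" by (simp add: g'_def)
    moreover have "norm (g z - k z) < \<epsilon>" using g(4) z by blast
    ultimately show "norm (g' z - k z) \<le> \<eta>"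
      unfolding eq using norm_triangle_ineq[of "g z - k z" "complex_of_real \<epsilon> *\<^sub>C e z"] \<epsilon>(2) by linarith
  qed
  ultimately show ?thesis using N(2) NU(1) unfolding K_def K1_def by blast
qed

text \<open>
  Mittag-Leffler: lifts on larger and larger members of the exhaustion, with differences of norm at most
  \<open>2 ^ (-n)\<close> on the \<open>n\<close>-th member, converge locally uniformly.
\<close>

theorem global_lift:
  assumes h: "holo h U"
  shows "\<exists>c. holo c U \<and> (\<forall>z\<in>U. blinfun_apply (\<pi> z) (c z) = h z)"
proof -
  let ?X = "exhaustion U"
  define P where "P n p \<longleftrightarrow> ?X n \<subseteq> fst p \<and> fst p \<subseteq> U \<and> holo (snd p) (fst p) \<and> (\<forall>z\<in>fst p. blinfun_apply (\<pi> z) (snd p z) = h z)"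
    for n and p :: "complex set \<times> (complex \<Rightarrow> 'a)"
  define Q where "Q n p q \<longleftrightarrow> (\<forall>z\<in>?X n. norm (snd q z - snd p z) \<le> (1 / 2) ^ n)"
    for n and p q :: "complex set \<times> (complex \<Rightarrow> 'a)"
  have "\<exists>f. \<forall>n. P n (f n) \<and> Q n (f n) (f (Suc n))"
  proof (rule dependent_nat_choice)
    show "\<exists>p. P 0 p" by (rule exI[of _ "({}, \<lambda>z. 0)"]) (simp add: P_def exhaustion_0 holo_const)
    fix p n assume p: "P n p"
    have "\<exists>N g. ?X (Suc n) \<subseteq> N \<and> N \<subseteq> U \<and> holo g N \<and> (\<forall>z\<in>N. blinfun_apply (\<pi> z) (g z) = h z) \<and>
        (\<forall>z\<in>?X n. norm (g z - snd p z) \<le> (1 / 2) ^ n)"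
      by (rule next_lift[OF h, where W = "fst p"]) (use p in \<open>auto simp: P_def\<close>)
    then obtain N g where "P (Suc n) (N, g)" "Q n p (N, g)" unfolding P_def Q_def by auto
    then show "\<exists>q. P (Suc n) q \<and> Q n p q" by blast
  qed
  then obtain s where s: "\<And>n. P n (s n)" "\<And>n. Q n (s n) (s (Suc n))" by blast
  define g where "g n = snd (s n)" for n
  have step: "norm (g (Suc n) z - g n z) \<le> (1 / 2) ^ n" if "z \<in> ?X n" for n z
    using s(2)[of n] that by (simp add: Q_def g_def)
  have sX: "?X n \<subseteq> fst (s n)" and hg: "holo (g n) (fst (s n))" for n using s(1)[of n] by (auto simp: P_def g_def)
  have gh: "blinfun_apply (\<pi> z) (g n z) = h z" if "z \<in> ?X n" for n z
    using s(1)[of n] that by (auto simp: P_def g_def)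
  have tail: "norm (g j z - g i z) \<le> 2 * (1 / 2) ^ i - 2 * (1 / 2) ^ j" if "i \<le> j" "z \<in> ?X i" for i j z
    using that(1)
  proof (induction j rule: dec_induct)
    case (step j)
    have "z \<in> ?X j" using exhaustion_mono[OF step.hyps(1)] that(2) by blast
    from \<open>\<And>n z. z \<in> ?X n \<Longrightarrow> norm (g (Suc n) z - g n z) \<le> (1 / 2) ^ n\<close>[OF this]
    show ?case using norm_triangle_ineq[of "g (Suc j) z - g j z" "g j z - g i z"] step.IH by simp
  qed simp
  define c where "c z = lim (\<lambda>n. g n z)" for z
  have ul: "uniform_limit (?X m) g c sequentially" for m
  proof -
    have "uniformly_Cauchy_on (?X m) g" unfolding uniformly_Cauchy_on_def
    proof (intro allI impI)
      fix e :: real assume e: "e > 0"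
      obtain M where M: "(1 / 2 :: real) ^ M < e / 4" using real_arch_pow_inv[of "e / 4" "1 / 2"] e by auto
      define L where "L = max m M"
      have "(1 / 2 :: real) ^ L \<le> (1 / 2) ^ M" by (intro power_decreasing) (auto simp: L_def)
      then have L: "(1 / 2 :: real) ^ L < e / 4" using M by (rule le_less_trans)
      have d: "norm (g n z - g L z) < e / 2" if "z \<in> ?X m" "n \<ge> L" for n z
      proof -
        have "z \<in> ?X L" using exhaustion_mono[of m L U] that(1) by (auto simp: L_def)
        moreover have "(0 :: real) \<le> (1 / 2) ^ n" by simp
        ultimately show ?thesis using tail[OF that(2), of z] L by linarith
      qed
      have "dist (g n1 z) (g n2 z) < e" if "z \<in> ?X m" "n1 \<ge> L" "n2 \<ge> L" for z n1 n2
        by (rule dist_triangle_half_l[where y = "g L z"]) (use d that in \<open>simp_all add: dist_norm\<close>)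
      then show "\<exists>M. \<forall>x\<in>?X m. \<forall>n\<ge>M. \<forall>k\<ge>M. dist (g n x) (g k x) < e" by blast
    qed
    then show ?thesis unfolding c_def[abs_def]
      by (simp add: Cauchy_uniformly_convergent flip: uniformly_convergent_uniform_limit_iff)
  qed
  have "holo c U"
  proof (rule holo_local)
    fix z assume "z \<in> U"
    then obtain m where m: "z \<in> interior (?X m)" using exhaustion_covers[OF open_U] by blast
    have IX: "interior (?X m) \<subseteq> ?X m" by (rule interior_subset)
    have ul2: "uniform_limit (interior (?X m)) (\<lambda>n. g (n + m)) c sequentially"
      by (rule filterlim_compose[OF uniform_limit_on_subset[OF ul IX] filterlim_add_const_nat_at_top])
    have "holo (g (n + m)) (interior (?X m))" for n
    proof (rule holo_subset[OF hg])
      show "interior (?X m) \<subseteq> fst (s (n + m))"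
        using IX exhaustion_mono[of m "n + m" U] sX[of "n + m"] by (meson le_add2 order_trans)
    qed simp
    then have "holo c (interior (?X m))" by (rule holo_uniform_limit[OF _ ul2])
    moreover have "interior (?X m) \<subseteq> U" using IX exhaustion_subset by blast
    ultimately show "\<exists>T. z \<in> T \<and> T \<subseteq> U \<and> holo c T" using m by blast
  qed
  moreover have "blinfun_apply (\<pi> z) (c z) = h z" if zU: "z \<in> U" for z
  proof -
    obtain m where m: "z \<in> ?X m" using exhaustion_covers[OF open_U zU] interior_subset by blast
    have "(\<lambda>n. blinfun_apply (\<pi> z) (g n z)) \<longlonglongrightarrow> blinfun_apply (\<pi> z) (c z)"
      by (rule bounded_linear.tendsto[OF blinfun.bounded_linear_right tendsto_uniform_limitI[OF ul m]])
    moreover have "(\<lambda>n. blinfun_apply (\<pi> z) (g n z)) \<longlonglongrightarrow> h z"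
    proof (rule tendsto_eventually)
      show "\<forall>\<^sub>F n in sequentially. blinfun_apply (\<pi> z) (g n z) = h z"
        unfolding eventually_sequentially
        by (rule exI[of _ m]) (use gh m exhaustion_mono in blast)
    qed
    ultimately show ?thesis by (rule LIMSEQ_unique)
  qed
  ultimately show ?thesis by blast
qed

end

section \<open>Quasinilpotent elements\<close>

lemma two_sided_inverse_unique:
  fixes x :: "'a::monoid_mult"
  assumes "u * x = 1" "x * v = 1"
  shows "u = v"
  by (metis assms mult.assoc mult_1_left mult_1_right)

lemma geometric_power_series:
  fixes d :: "'a::complex_banach_algebra_1"
  assumes "norm (c *\<^sub>C d) < 1"
  shows "(\<lambda>k. c ^ k *\<^sub>C d ^ k) sums (\<Sum>k. c ^ k *\<^sub>C d ^ k)"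
    "(1 - c *\<^sub>C d) * (\<Sum>k. c ^ k *\<^sub>C d ^ k) = 1" "(\<Sum>k. c ^ k *\<^sub>C d ^ k) * (1 - c *\<^sub>C d) = 1"
proof -
  let ?u = "c *\<^sub>C d"
  have pow: "c ^ k *\<^sub>C d ^ k = ?u ^ k" for k
  proof (induction k)
    case (Suc k)
    show ?case by (simp add: mult_scaleC_left mult_scaleC_right scaleC_scaleC mult.commute[of "c ^ k" c] flip: Suc.IH)
  qed simp
  have s: "summable (\<lambda>k. ?u ^ k)" using assms by (rule complete_algebra_summable_geometric)
  show "(\<lambda>k. c ^ k *\<^sub>C d ^ k) sums (\<Sum>k. c ^ k *\<^sub>C d ^ k)" unfolding pow by (rule summable_sums[OF s])
  have shift: "(\<Sum>k. ?u ^ k) = 1 + (\<Sum>k. ?u ^ Suc k)" using suminf_split_head[OF s] by simp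
  have "?u * (\<Sum>k. ?u ^ k) = (\<Sum>k. ?u ^ Suc k)" using suminf_mult[OF s, of ?u] by simp
  then show "(1 - ?u) * (\<Sum>k. c ^ k *\<^sub>C d ^ k) = 1" unfolding pow left_diff_distrib using shift by simp
  have "(\<Sum>k. ?u ^ k) * ?u = (\<Sum>k. ?u ^ Suc k)"
    using suminf_mult2[OF s, of ?u] by (simp add: power_commutes)
  then show "(\<Sum>k. c ^ k *\<^sub>C d ^ k) * (1 - ?u) = 1" unfolding pow right_diff_distrib using shift by simp
qed

text \<open>
  The map \<open>z \<mapsto> (1 - z n)\<^sup>-\<^sup>1\<close> is entire, and its Taylor coefficients at \<open>0\<close> are the powers of \<open>n\<close>.
  So these satisfy Cauchy's estimates on every disc.
\<close>

lemma quasinilpotent_power_bound: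
  fixes n :: "'a::complex_banach_algebra_1"
  assumes n: "algebra_spectrum n = {0}" and r: "r > 0"
  shows "\<exists>M. \<forall>k. norm (n ^ k) \<le> M / r ^ k"
proof -
  have ex: "\<exists>x. x * (1 - z *\<^sub>C n) = 1 \<and> (1 - z *\<^sub>C n) * x = 1" for z
  proof (cases "z = 0")
    case False
    have "1 / z \<notin> algebra_spectrum n" using n False by simp
    then obtain x where x: "x * ((1 / z) *\<^sub>C 1 - n) = 1" "((1 / z) *\<^sub>C 1 - n) * x = 1"
      unfolding algebra_spectrum_def by blast
    have "1 - z *\<^sub>C n = z *\<^sub>C ((1 / z) *\<^sub>C 1 - n)" using False by (simp add: scaleC.diff_right scaleC_scaleC)
    then show ?thesis using x False
      by (intro exI[of _ "(1 / z) *\<^sub>C x"]) (simp add: mult_scaleC_left mult_scaleC_right scaleC_scaleC)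
  qed (auto intro: exI[of _ 1])
  define R where "R z = (SOME x. x * (1 - z *\<^sub>C n) = 1 \<and> (1 - z *\<^sub>C n) * x = 1)" for z
  have R: "R z * (1 - z *\<^sub>C n) = 1" "(1 - z *\<^sub>C n) * R z = 1" for z
    using someI_ex[OF ex[of z]] unfolding R_def by blast+
  have ps: "(\<lambda>k. (w - z) ^ k *\<^sub>C ((R z * n) ^ k * R z)) sums R w" if w: "norm ((w - z) *\<^sub>C (R z * n)) < 1" for w z
  proof -
    define S where "S = (\<Sum>k. (w - z) ^ k *\<^sub>C (R z * n) ^ k)"
    note S = geometric_power_series[OF w, folded S_def]
    have fac: "1 - w *\<^sub>C n = (1 - z *\<^sub>C n) * (1 - (w - z) *\<^sub>C (R z * n))"
    proof -
      have "(1 - z *\<^sub>C n) * ((w - z) *\<^sub>C (R z * n)) = (w - z) *\<^sub>C ((1 - z *\<^sub>C n) * R z * n)"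
        by (simp only: mult_scaleC_right mult.assoc)
      also have "\<dots> = (w - z) *\<^sub>C n" by (simp only: R mult_1_left)
      finally show ?thesis by (simp add: right_diff_distrib scaleC.diff_left)
    qed
    have "R w = S * R z"
    proof (rule two_sided_inverse_unique[OF R(1)])
      have "(1 - w *\<^sub>C n) * (S * R z) = (1 - z *\<^sub>C n) * ((1 - (w - z) *\<^sub>C (R z * n)) * S) * R z"
        unfolding fac by (simp only: mult.assoc)
      then show "(1 - w *\<^sub>C n) * (S * R z) = 1" by (simp add: S(2) R(2))
    qed
    moreover have "(\<lambda>k. (w - z) ^ k *\<^sub>C (R z * n) ^ k * R z) sums (S * R z)" by (rule sums_mult2[OF S(1)])
    ultimately show ?thesis by (simp add: mult_scaleC_left)
  qed
  have near: "\<exists>e>0. \<forall>w\<in>ball z e. norm ((w - z) *\<^sub>C (R z * n)) < 1" for z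
  proof -
    define e where "e = 1 / (norm (R z * n) + 1)"
    have p: "norm (R z * n) + 1 > 0" by (simp add: add_nonneg_pos)
    have "norm ((w - z) *\<^sub>C (R z * n)) < 1" if "w \<in> ball z e" for w
    proof -
      have "norm (w - z) < e" using that by (simp add: dist_norm norm_minus_commute)
      then have "norm (w - z) * (norm (R z * n) + 1) < 1" using p by (simp add: e_def field_simps)
      moreover have "norm (w - z) * norm (R z * n) \<le> norm (w - z) * (norm (R z * n) + 1)" by (intro mult_left_mono) auto
      ultimately show ?thesis by (simp only: norm_scaleC)
    qed
    then show ?thesis using p by (intro exI[of _ e]) (simp add: e_def)
  qed
  have hU: "holo R UNIV"
  proof (rule holo_local)
    fix z :: complex
    obtain e where e: "e > 0" "\<And>w. w \<in> ball z e \<Longrightarrow> norm ((w - z) *\<^sub>C (R z * n)) < 1" using near[of z] by blast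
    have "holo R (ball z e)" by (rule power_series_holo[OF ps[OF e(2)]])
    then show "\<exists>T. z \<in> T \<and> T \<subseteq> UNIV \<and> holo R T" using e(1) by (intro exI[of _ "ball z e"]) simp
  qed
  have hR: "holo R (ball 0 (2 * r))" by (rule holo_subset[OF hU]) auto
  obtain M where M: "\<forall>z\<in>cball 0 (2 * r). norm (R z) \<le> M"
    using holo_bounded_compact[OF hU, of "cball 0 (2 * r)"] by auto
  have Mb: "norm (R z) \<le> M" if "z \<in> ball 0 (2 * r)" for z using M that by simp
  obtain a where a: "\<forall>k. norm (a k) \<le> 2 * M / r ^ k" "\<forall>w\<in>ball 0 r. (\<lambda>k. (w - 0) ^ k *\<^sub>C a k) sums R w"
    using taylor[OF hR r order_refl Mb] by blast
  have R0: "R 0 = 1" using R(1)[of 0] by simp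
  obtain e where e: "e > 0" "\<And>w. w \<in> ball 0 e \<Longrightarrow> norm ((w - 0) *\<^sub>C (R 0 * n)) < 1" using near[of 0] by blast
  define s where "s = min e r"
  have s: "s > 0" using e r by (simp add: s_def)
  have Y: "csubspace {0 :: 'a}" by (simp add: csubspace_def)
  have diff: "(\<lambda>k. (w - 0) ^ k *\<^sub>C (a k - n ^ k)) sums 0" if "w \<in> ball 0 s" for w
  proof -
    have "w \<in> ball 0 e" "w \<in> ball 0 r" using that by (auto simp: s_def)
    from sums_diff[OF bspec[OF a(2) this(2)] ps[OF e(2)[OF this(1)]]]
    show ?thesis by (simp add: R0 scaleC.diff_right)
  qed
  have "a k - n ^ k \<in> {0}" for k
  proof (rule identity_mod_subspace(1)[OF Y closed_singleton s, where F = "\<lambda>_. 0" and z = 0])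
    show "(\<lambda>k. (w - 0) ^ k *\<^sub>C (a k - n ^ k)) sums 0" if "w \<in> ball 0 s" for w by (rule diff[OF that])
    show "\<exists>w\<in>ball (0 :: complex) d. w \<noteq> 0 \<and> (0 :: 'a) \<in> {0}" if "d > 0" for d :: real
      using that by (intro bexI[of _ "complex_of_real (d / 2)"]) auto
  qed
  then have "n ^ k = a k" for k by simp
  then show ?thesis using a(1) by (intro exI[of _ "2 * M"]) simp
qed

section \<open>Idempotents near elements that are idempotent up to a quasinilpotent\<close>

definition inv_sqrt_coeff :: "nat \<Rightarrow> real" where
  "inv_sqrt_coeff k = 4 ^ k * ((- 1 / 2) gchoose k)"

text \<open>The binomial series of \<open>(1 + 4 n)\<^sup>-\<^sup>1\<^sup>/\<^sup>2\<close>.\<close>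

definition inv_sqrt :: "'a::real_normed_algebra_1 \<Rightarrow> 'a" where
  "inv_sqrt n = (\<Sum>k. inv_sqrt_coeff k *\<^sub>R n ^ k)"

lemma inv_sqrt_coeff_bound: "\<bar>inv_sqrt_coeff k\<bar> \<le> 4 ^ k"
proof -
  have "\<bar>(- 1 / 2 :: real) gchoose k\<bar> \<le> 1"
  proof (induction k)
    case (Suc k)
    have "real (Suc k) * ((- 1 / 2) gchoose Suc k) = (- 1 / 2 - real k) * ((- 1 / 2) gchoose k)"
      using gbinomial_absorb_comp[of "- 1 / 2 :: real" k] gbinomial_absorption[of k "- 1 / 2 :: real"] by simp
    then have "real (Suc k) * \<bar>(- 1 / 2) gchoose Suc k\<bar> = \<bar>- 1 / 2 - real k\<bar> * \<bar>(- 1 / 2 :: real) gchoose k\<bar>"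
      by (metis abs_mult abs_of_nat)
    also have "\<dots> \<le> real (Suc k) * 1" by (intro mult_mono Suc) auto
    finally show ?case by simp
  qed simp
  then show ?thesis by (simp add: inv_sqrt_coeff_def abs_mult)
qed

text \<open>
  Vandermonde's identity with \<open>-1/2 - 1/2 = -1\<close>: the square of the binomial series is the geometric
  series of \<open>- 4 n\<close>.
\<close>

lemma inv_sqrt_coeff_convolution: "(\<Sum>i\<le>k. inv_sqrt_coeff i * inv_sqrt_coeff (k - i)) = (- 4) ^ k"
proof -
  have "(\<Sum>i\<le>k. inv_sqrt_coeff i * inv_sqrt_coeff (k - i)) =
      (\<Sum>i\<le>k. 4 ^ k * (((- 1 / 2) gchoose i) * ((- 1 / 2) gchoose (k - i))))"
    by (rule sum.cong) (auto simp: inv_sqrt_coeff_def simp flip: power_add)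
  also have "\<dots> = 4 ^ k * ((- 1 / 2 + - 1 / 2 :: real) gchoose k)"
    unfolding gbinomial_Vandermonde[symmetric] by (simp only: sum_distrib_left atMost_atLeast0)
  also have "(- 1 / 2 + - 1 / 2 :: real) gchoose k = (- 1) ^ k"
    using gbinomial_minus[of "1 :: real" k] binomial_gbinomial[of k k, where 'a = real] by simp
  finally show ?thesis by (simp flip: power_mult_distrib)
qed

context
  fixes n :: "'a::{real_normed_algebra_1,banach}"
  assumes abs_summable: "summable (\<lambda>k. norm (inv_sqrt_coeff k *\<^sub>R n ^ k))"
begin

lemma inv_sqrt_sums: "(\<lambda>k. inv_sqrt_coeff k *\<^sub>R n ^ k) sums inv_sqrt n"
  unfolding inv_sqrt_def by (rule summable_sums[OF summable_norm_cancel[OF abs_summable]])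

lemma inv_sqrt_square: "(1 + 4 *\<^sub>R n) * (inv_sqrt n * inv_sqrt n) = 1"
proof -
  have "(\<lambda>k. \<Sum>i\<le>k. (inv_sqrt_coeff i *\<^sub>R n ^ i) * (inv_sqrt_coeff (k - i) *\<^sub>R n ^ (k - i))) sums (inv_sqrt n * inv_sqrt n)"
    unfolding inv_sqrt_def by (rule Cauchy_product_sums[OF abs_summable abs_summable])
  moreover have "(\<Sum>i\<le>k. (inv_sqrt_coeff i *\<^sub>R n ^ i) * (inv_sqrt_coeff (k - i) *\<^sub>R n ^ (k - i))) = ((- 4) *\<^sub>R n) ^ k" for k
  proof -
    have "(\<Sum>i\<le>k. (inv_sqrt_coeff i *\<^sub>R n ^ i) * (inv_sqrt_coeff (k - i) *\<^sub>R n ^ (k - i))) =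
        (\<Sum>i\<le>k. (inv_sqrt_coeff i * inv_sqrt_coeff (k - i)) *\<^sub>R n ^ k)"
      by (rule sum.cong) (auto simp flip: power_add)
    also have "\<dots> = (- 4) ^ k *\<^sub>R n ^ k" by (simp only: scaleR_sum_left[symmetric] inv_sqrt_coeff_convolution)
    finally show ?thesis by (simp only: scaleR_power)
  qed
  ultimately have S: "(\<lambda>k. ((- 4) *\<^sub>R n) ^ k) sums (inv_sqrt n * inv_sqrt n)" by simp
  have "(\<lambda>k. ((- 4) *\<^sub>R n) * ((- 4) *\<^sub>R n) ^ k) sums ((- 4) *\<^sub>R n * (inv_sqrt n * inv_sqrt n))" by (rule sums_mult[OF S])
  moreover have "(\<lambda>k. ((- 4) *\<^sub>R n) ^ Suc k) sums (inv_sqrt n * inv_sqrt n - 1)"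
    using S by (subst sums_Suc_iff) simp
  ultimately have "inv_sqrt n * inv_sqrt n - 1 = (- 4) *\<^sub>R n * (inv_sqrt n * inv_sqrt n)"
    unfolding power_Suc by (rule sums_unique2[symmetric])
  then show ?thesis by (simp add: distrib_right algebra_simps)
qed

lemma inv_sqrt_commute:
  assumes "y * n = n * y"
  shows "y * inv_sqrt n = inv_sqrt n * y"
proof -
  have "y * n ^ k = n ^ k * y" for k using assms by (induction k) (simp, metis mult.assoc power_Suc)
  then have "(\<lambda>k. y * (inv_sqrt_coeff k *\<^sub>R n ^ k)) = (\<lambda>k. inv_sqrt_coeff k *\<^sub>R n ^ k * y)" by simp
  then show ?thesis using sums_mult[OF inv_sqrt_sums, of y] sums_mult2[OF inv_sqrt_sums, of y] sums_unique2 by metis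
qed

end

text \<open>
  If \<open>x\<^sup>2 - x = n\<close> then \<open>(x - 1/2)\<^sup>2 = (1 + 4 n) / 4\<close>. Division by the square root of \<open>1 + 4 n\<close>
  therefore turns \<open>x - 1/2\<close> into an element with square \<open>1/4\<close>.
\<close>

definition idem :: "'a::real_normed_algebra_1 \<Rightarrow> 'a" where
  "idem x = (1 / 2) *\<^sub>R 1 + (x - (1 / 2) *\<^sub>R 1) * inv_sqrt (x * x - x)"

lemma quasinilpotent_abs_summable:
  fixes n :: "'a::complex_banach_algebra_1"
  assumes "algebra_spectrum n = {0}"
  shows "summable (\<lambda>k. norm (inv_sqrt_coeff k *\<^sub>R n ^ k))"
proof -
  obtain M where M: "\<forall>k. norm (n ^ k) \<le> M / 8 ^ k" using quasinilpotent_power_bound[OF assms, of 8] by auto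
  have "norm (norm (inv_sqrt_coeff k *\<^sub>R n ^ k)) \<le> M * (1 / 2) ^ k" for k
  proof -
    have "\<bar>inv_sqrt_coeff k\<bar> * norm (n ^ k) \<le> 4 ^ k * (M / 8 ^ k)" using M by (intro mult_mono inv_sqrt_coeff_bound) auto
    also have "(8 :: real) ^ k = 4 ^ k * 2 ^ k" by (simp flip: power_mult_distrib)
    finally show ?thesis by (simp add: power_divide)
  qed
  then show ?thesis by (intro summable_comparison_test'[OF summable_mult[OF summable_geometric]]) auto
qed

context
  fixes x :: "'a::complex_banach_algebra_1"
  assumes qn: "algebra_spectrum (x * x - x) = {0}"
begin

lemma idem_commute:
  assumes "y * x = x * y"
  shows "y * idem x = idem x * y"
proof -
  define h where "h = x - (1 / 2) *\<^sub>R 1"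
  have "y * (x * x) = x * x * y" using assms by (metis mult.assoc)
  then have "y * (x * x - x) = (x * x - x) * y" using assms by (simp add: left_diff_distrib right_diff_distrib)
  from inv_sqrt_commute[OF quasinilpotent_abs_summable[OF qn] this]
  have R: "y * inv_sqrt (x * x - x) = inv_sqrt (x * x - x) * y" .
  have "y * h = h * y" using assms by (simp add: h_def left_diff_distrib right_diff_distrib)
  then have "y * (h * inv_sqrt (x * x - x)) = h * (y * inv_sqrt (x * x - x))" by (simp only: mult.assoc[symmetric])
  then have "y * (h * inv_sqrt (x * x - x)) = h * inv_sqrt (x * x - x) * y" by (simp only: R mult.assoc)
  then show ?thesis by (simp add: idem_def h_def[symmetric] distrib_left distrib_right)
qed

lemma idem_idempotent: "idem x * idem x = idem x"
proof -
  define n where "n = x * x - x"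
  define h where "h = x - (1 / 2) *\<^sub>R 1"
  define R where "R = inv_sqrt n"
  note s = quasinilpotent_abs_summable[OF qn, folded n_def]
  have half: "(1 / 2) *\<^sub>R y + (1 / 2) *\<^sub>R y = y" for y :: 'a by (simp flip: scaleR_left_distrib)
  have "h * n = n * h"
    by (simp add: h_def n_def left_diff_distrib right_diff_distrib scaleR_right_diff_distrib mult.assoc)
  from inv_sqrt_commute[OF s this] have hR: "h * R = R * h" by (simp add: R_def)
  have hh: "h * h = (1 / 4) *\<^sub>R (1 + 4 *\<^sub>R n)"
  proof -
    have "h * h = x * x - ((1 / 2) *\<^sub>R x + (1 / 2) *\<^sub>R x) + (1 / 4) *\<^sub>R 1"
      by (simp add: h_def left_diff_distrib right_diff_distrib scaleR_right_diff_distrib)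
    then show ?thesis unfolding half by (simp add: n_def scaleR_right_distrib)
  qed
  have "(h * R) * (h * R) = (h * h) * (R * R)" using hR by (metis mult.assoc)
  also have "\<dots> = (1 / 4) *\<^sub>R ((1 + 4 *\<^sub>R n) * (R * R))" by (simp add: hh)
  also have "\<dots> = (1 / 4) *\<^sub>R 1" by (simp add: R_def inv_sqrt_square[OF s])
  finally have q: "(h * R) * (h * R) = (1 / 4) *\<^sub>R 1" .
  have I: "idem x = (1 / 2) *\<^sub>R 1 + h * R" by (simp add: idem_def h_def R_def n_def)
  have "idem x * idem x = (1 / 4) *\<^sub>R 1 + ((1 / 2) *\<^sub>R (h * R) + (1 / 2) *\<^sub>R (h * R)) + (h * R) * (h * R)"
    unfolding I by (simp add: distrib_left distrib_right scaleR_right_distrib)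
  also have "\<dots> = ((1 / 4) *\<^sub>R 1 + (1 / 4) *\<^sub>R 1) + h * R" unfolding q half by (simp only: ac_simps)
  also have "\<dots> = idem x" unfolding I scaleR_left_distrib[symmetric] by simp
  finally show ?thesis .
qed

text \<open>
  Modulo the kernel \<open>n = 0\<close> and \<open>inv_sqrt 0 = 1\<close>, so \<open>idem x\<close> and \<open>x\<close> have the same image.
\<close>

lemma idem_hom:
  assumes f: "algebra_hom f" "blinfun_apply f 1 = 1" and k: "blinfun_apply f (x * x - x) = 0"
  shows "blinfun_apply f (idem x) = blinfun_apply f x"
proof -
  have mult: "blinfun_apply f (u * v) = blinfun_apply f u * blinfun_apply f v" for u v using f(1) by (simp add: algebra_hom_def)
  have pow: "blinfun_apply f (u ^ k) = blinfun_apply f u ^ k" for u k by (induction k) (simp_all add: f(2) mult)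
  have "(\<lambda>k. blinfun_apply f (inv_sqrt_coeff k *\<^sub>R (x * x - x) ^ k)) sums blinfun_apply f (inv_sqrt (x * x - x))"
    by (rule bounded_linear.sums[OF blinfun.bounded_linear_right inv_sqrt_sums[OF quasinilpotent_abs_summable[OF qn]]])
  moreover have "blinfun_apply f (inv_sqrt_coeff k *\<^sub>R (x * x - x) ^ k) = (if k = 0 then 1 else 0)" for k
    by (simp add: blinfun.scaleR_right pow k inv_sqrt_coeff_def power_0_left)
  ultimately have "(\<lambda>k. if k = 0 then 1 else 0) sums blinfun_apply f (inv_sqrt (x * x - x))" by simp
  moreover have "(\<lambda>k. if k = 0 then 1 else (0 :: 'b)) sums 1" using sums_single[of 0 "\<lambda>_. 1 :: 'b"] by simp
  ultimately have "blinfun_apply f (inv_sqrt (x * x - x)) = 1" by (rule sums_unique2)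
  then show ?thesis by (simp add: idem_def mult f(2) blinfun.add_right blinfun.diff_right blinfun.scaleR_right)
qed

end

text \<open>
  If \<open>norm (n(z\<^sub>0) ^ m) < 16 ^ (-m)\<close> for one \<open>m\<close>, the same holds near \<open>z\<^sub>0\<close>, and division of the exponent by \<open>m\<close>
  gives the uniform bound \<open>16 ^ (-k)\<close>, up to a factor, for the \<open>k\<close>-th power. This beats the growth
  \<open>4 ^ k\<close> of the coefficients.
\<close>

lemma holo_inv_sqrt:
  fixes n :: "complex \<Rightarrow> 'a::complex_banach_algebra_1"
  assumes n: "holo n U" and qn: "\<And>z. z \<in> U \<Longrightarrow> algebra_spectrum (n z) = {0}"
  shows "holo (\<lambda>z. inv_sqrt (n z)) U"
proof (rule holo_local)
  fix z0 assume z0: "z0 \<in> U"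
  obtain M where M: "\<forall>k. norm (n z0 ^ k) \<le> M / 32 ^ k" using quasinilpotent_power_bound[OF qn[OF z0], of 32] by auto
  obtain m' where m': "M < 2 ^ m'" using real_arch_pow[of 2 M] by auto
  define m where "m = Suc m'"
  have "(2 :: real) ^ m' \<le> 2 ^ m" by (simp add: m_def)
  then have m: "M < 2 ^ m" using m' by linarith
  have m0: "m > 0" by (simp add: m_def)
  have "norm (n z0 ^ m) \<le> M / 32 ^ m" using M by blast
  also have "\<dots> < 2 ^ m / 32 ^ m" using m by (intro divide_strict_right_mono) auto
  also have "\<dots> = (1 / 16) ^ m" by (simp flip: power_divide)
  finally have small: "norm (n z0 ^ m) < (1 / 16) ^ m" .
  have oU: "open U" using holoD(1)[OF n] .
  have "continuous_on U (\<lambda>z. norm (n z ^ m))" by (intro continuous_intros holo_continuous_on[OF n])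
  then have "isCont (\<lambda>z. norm (n z ^ m)) z0" using oU z0 by (simp add: continuous_on_eq_continuous_at)
  from order_tendstoD(2)[OF this[unfolded isCont_def] small]
  obtain d where d: "d > 0" "\<forall>z. z \<noteq> z0 \<and> dist z z0 < d \<longrightarrow> norm (n z ^ m) < (1 / 16) ^ m"
    unfolding eventually_at by blast
  obtain R where R: "R > 0" "cball z0 R \<subseteq> U" using oU z0 by (meson open_contains_cball)
  obtain A0 where A0: "A0 > 0" "\<And>w. w \<in> cball z0 R \<Longrightarrow> norm (n w) \<le> A0" using holo_bounded_smaller_ball[OF n R(2)] by blast
  define A where "A = max A0 1"
  define B where "B = ball z0 (min d R)"
  have B: "open B" "z0 \<in> B" "B \<subseteq> cball z0 R" using d R by (auto simp: B_def)
  have nm: "norm (n z ^ m) \<le> (1 / 16) ^ m" if "z \<in> B" for z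
    using d(2) small that by (cases "z = z0") (auto simp: B_def dist_commute intro: less_imp_le)
  have nA: "norm (n z) \<le> A" "A \<ge> 1" if "z \<in> B" for z using A0(2)[of z] that B(3) by (auto simp: A_def)
  have bound: "norm (inv_sqrt_coeff k *\<^sub>R n z ^ k) \<le> (16 * A) ^ m * (1 / 4) ^ k" if z: "z \<in> B" for k z
  proof -
    define q s where "q = k div m" and "s = k mod m"
    have k: "k = m * q + s" "s \<le> m" using m0 by (auto simp: q_def s_def less_imp_le)
    have "norm (n z ^ k) \<le> norm ((n z ^ m) ^ q) * norm (n z ^ s)"
      unfolding k(1) power_add power_mult by (rule norm_mult_ineq)
    also have "\<dots> \<le> ((1 / 16) ^ m) ^ q * A ^ s"
    proof (rule mult_mono)
      show "norm ((n z ^ m) ^ q) \<le> ((1 / 16) ^ m) ^ q"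
        by (rule order_trans[OF norm_power_ineq power_mono[OF nm[OF z] norm_ge_zero]])
      show "norm (n z ^ s) \<le> A ^ s"
        by (rule order_trans[OF norm_power_ineq power_mono[OF nA(1)[OF z] norm_ge_zero]])
    qed auto
    also have "\<dots> = (16 * A) ^ s * (1 / 16) ^ k" unfolding k(1) power_add power_mult
      by (simp add: power_mult_distrib power_divide)
    also have "\<dots> \<le> (16 * A) ^ m * (1 / 16) ^ k" using nA[OF z] k(2) by (intro mult_right_mono power_increasing) auto
    finally have "\<bar>inv_sqrt_coeff k\<bar> * norm (n z ^ k) \<le> 4 ^ k * ((16 * A) ^ m * (1 / 16) ^ k)"
      by (intro mult_mono inv_sqrt_coeff_bound) auto
    also have "\<dots> = (16 * A) ^ m * (4 * (1 / 16)) ^ k" unfolding power_mult_distrib[of 4 "1 / 16"] by simp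
    finally show ?thesis by simp
  qed
  have summ: "summable (\<lambda>k. (16 * A) ^ m * (1 / 4 :: real) ^ k)" by (intro summable_mult summable_geometric) simp
  have ul: "uniform_limit B (\<lambda>N z. \<Sum>k<N. inv_sqrt_coeff k *\<^sub>R n z ^ k) (\<lambda>z. inv_sqrt (n z)) sequentially"
    unfolding inv_sqrt_def by (rule Weierstrass_m_test[OF bound summ])
  have BU: "B \<subseteq> U" using B(3) R(2) by blast
  have "holo (\<lambda>z. inv_sqrt (n z)) B"
  proof (rule holo_uniform_limit[OF _ ul])
    have "holo (\<lambda>z. inv_sqrt_coeff k *\<^sub>R n z ^ k) B" for k
      unfolding scaleC_of_real[symmetric]
      by (intro holo_scaleC holo_const[OF B(1)] holo_power holo_subset[OF n BU] B(1))
    then show "holo (\<lambda>z. \<Sum>k<N. inv_sqrt_coeff k *\<^sub>R n z ^ k) B" for N by (intro holo_sum B(1))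
  qed
  then show "\<exists>T. z0 \<in> T \<and> T \<subseteq> U \<and> holo (\<lambda>z. inv_sqrt (n z)) T" using B(2) BU by blast
qed

lemma holo_idem:
  fixes x :: "complex \<Rightarrow> 'a::complex_banach_algebra_1"
  assumes x: "holo x U" and qn: "\<And>z. z \<in> U \<Longrightarrow> algebra_spectrum (x z * x z - x z) = {0}"
  shows "holo (\<lambda>z. idem (x z)) U"
  unfolding idem_def
  by (intro holo_add holo_mult holo_diff holo_inv_sqrt holo_const x qn holoD(1)[OF x])

text \<open>
  The element \<open>1 - e\<close> is invertible, and it annihilates \<open>e\<close>.
\<close>

lemma idempotent_quasinilpotent_eq_0:
  fixes e :: "'a::complex_banach_algebra_1"
  assumes "e * e = e" "algebra_spectrum e = {0}"
  shows "e = 0"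
proof -
  have "1 \<notin> algebra_spectrum e" using assms(2) by simp
  then obtain y where "y * (1 - e) = 1" unfolding algebra_spectrum_def by auto
  then have "e = y * ((1 - e) * e)" by (metis mult.assoc mult_1_left)
  also have "(1 - e) * e = 0" using assms(1) by (simp add: left_diff_distrib)
  finally show ?thesis by simp
qed

section \<open>Polynomials in elements of an algebra\<close>

lemma poly_eval_sum_degree:
  assumes "degree p \<le> N"
  shows "poly_eval p a = (\<Sum>i\<le>N. coeff p i *\<^sub>C a ^ i)"
  unfolding poly_eval_def
  by (rule sum.mono_neutral_left) (use assms in \<open>auto simp: coeff_eq_0\<close>)

lemma poly_eval_0 [simp]: "poly_eval 0 a = 0"
  by (simp add: poly_eval_def)

lemma poly_eval_pCons [simp]: "poly_eval (pCons c p) a = c *\<^sub>C 1 + a * poly_eval p a"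
proof -
  have "poly_eval (pCons c p) a = (\<Sum>i\<le>Suc (degree p). coeff (pCons c p) i *\<^sub>C a ^ i)"
    by (rule poly_eval_sum_degree) (rule degree_pCons_le)
  also have "\<dots> = c *\<^sub>C 1 + (\<Sum>i\<le>degree p. coeff p i *\<^sub>C (a * a ^ i))"
    by (subst sum.atMost_Suc_shift) simp
  finally show ?thesis by (simp add: poly_eval_def sum_distrib_left mult_scaleC_right)
qed

lemma poly_eval_add: "poly_eval (p + q) a = poly_eval p a + poly_eval q a"
  by (induction p q rule: poly_induct2) (simp_all add: scaleC_add_left distrib_left)

lemma poly_eval_smult: "poly_eval (smult c p) a = c *\<^sub>C poly_eval p a"
  by (induction p) (simp_all add: scaleC_add_right scaleC_scaleC mult_scaleC_right)

lemma poly_eval_diff: "poly_eval (p - q) a = poly_eval p a - poly_eval q a"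
  using poly_eval_add[of "p - q" q a] by simp

lemma poly_eval_mult: "poly_eval (p * q) a = poly_eval p a * poly_eval q a"
  by (induction p) (simp_all add: poly_eval_add poly_eval_smult distrib_right mult_scaleC_left mult.assoc)

lemma poly_eval_1 [simp]: "poly_eval 1 a = 1"
  by (simp add: one_pCons)

lemma poly_eval_sum: "poly_eval (\<Sum>i\<in>I. p i) a = (\<Sum>i\<in>I. poly_eval (p i) a)"
  by (induction I rule: infinite_finite_induct) (simp_all add: poly_eval_add)

lemma poly_eval_commute:
  assumes "y * a = a * y"
  shows "y * poly_eval p a = poly_eval p a * y"
proof (induction p)
  case (pCons c p)
  have "y * (a * poly_eval p a) = a * poly_eval p a * y" using assms pCons.IH by (metis mult.assoc)
  then show ?case by (simp add: distrib_left distrib_right mult_scaleC_left mult_scaleC_right)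
qed simp

lemma poly_eval_hom:
  assumes "algebra_hom f" "blinfun_apply f 1 = 1"
  shows "blinfun_apply f (poly_eval p a) = poly_eval p (blinfun_apply f a)"
  using assms by (induction p) (simp_all add: algebra_hom_def blinfun.add_right)

lemma holo_poly_eval: "holo c U \<Longrightarrow> holo (\<lambda>z. poly_eval p (c z)) U"
  unfolding poly_eval_def by (intro holo_sum holo_scaleC holo_const holo_power) (auto dest: holoD(1))

lemma root_product_dvd:
  fixes q :: "complex poly"
  assumes "finite I" "inj_on \<alpha> I" "\<And>i. i \<in> I \<Longrightarrow> poly q (\<alpha> i) = 0"
  shows "(\<Prod>i\<in>I. [:- \<alpha> i, 1:]) dvd q"
  using assms
proof (induction I rule: finite_induct)
  case (insert j I)
  then obtain k where k: "q = (\<Prod>i\<in>I. [:- \<alpha> i, 1:]) * k" by (auto elim: dvdE)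
  have "poly (\<Prod>i\<in>I. [:- \<alpha> i, 1:]) (\<alpha> j) \<noteq> 0" using insert.hyps insert.prems(1) by (auto simp: poly_prod)
  then have "poly k (\<alpha> j) = 0" using insert.prems(2)[of j] by (simp add: k)
  then have "[:- \<alpha> j, 1:] dvd k" by (simp add: poly_eq_0_iff_dvd)
  then have "[:- \<alpha> j, 1:] * (\<Prod>i\<in>I. [:- \<alpha> i, 1:]) dvd k * (\<Prod>i\<in>I. [:- \<alpha> i, 1:])" by (rule mult_dvd_mono) simp
  then show ?case unfolding k prod.insert[OF insert.hyps] mult.commute[of k] .
qed simp

lemma poly_eval_eq_0:
  assumes "inj_on \<alpha> {1..n}" "b \<in> algebraic_elements (root_poly n \<alpha>)" "\<And>i. i \<in> {1..n} \<Longrightarrow> poly q (\<alpha> i) = 0"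
  shows "poly_eval q b = 0"
proof -
  have "root_poly n \<alpha> dvd q" unfolding root_poly_def by (rule root_product_dvd[OF _ assms(1,3)]) auto
  then obtain k where "q = root_poly n \<alpha> * k" by (auto elim: dvdE)
  then show ?thesis using assms(2) by (simp add: poly_eval_mult algebraic_elements_def)
qed

definition lagrange :: "nat \<Rightarrow> (nat \<Rightarrow> complex) \<Rightarrow> nat \<Rightarrow> complex poly" where
  "lagrange n \<alpha> i = smult (1 / (\<Prod>j\<in>{1..n} - {i}. \<alpha> i - \<alpha> j)) (\<Prod>j\<in>{1..n} - {i}. [:- \<alpha> j, 1:])"

lemma poly_lagrange:
  assumes "inj_on \<alpha> {1..n}" "i \<in> {1..n}" "j \<in> {1..n}"
  shows "poly (lagrange n \<alpha> i) (\<alpha> j) = (if i = j then 1 else 0)"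
proof (cases "i = j")
  case True
  have "(\<Prod>k\<in>{1..n} - {j}. \<alpha> j - \<alpha> k) \<noteq> 0" using inj_onD[OF assms(1)] assms(3) by (auto simp: prod_zero_iff)
  then show ?thesis using True by (simp add: lagrange_def poly_prod)
next
  case False
  have "(\<Prod>k\<in>{1..n} - {i}. \<alpha> j - \<alpha> k) = 0" using False assms(3) by (intro prod_zero) auto
  then show ?thesis using False by (simp add: lagrange_def poly_prod)
qed

section \<open>Lifting of algebraic elements\<close>

text \<open>
  The spectral idempotents of \<open>b\<close> are values of the Lagrange polynomials. Their lifts by these
  polynomials in a linear lift \<open>c\<close> are idempotent up to the kernel, hence can be made idempotent.
  Products of two of them and the defect of their sum are idempotents in the kernel, hence
  vanish.
\<close>

lemma lift_of_algebraic_element: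
  fixes f :: "'a::complex_banach_algebra_1 \<Rightarrow>\<^sub>L 'b::complex_banach_algebra_1"
  assumes f: "algebra_hom f" "blinfun_apply f 1 = 1"
    and qn: "\<And>x. blinfun_apply f x = 0 \<Longrightarrow> algebra_spectrum x = {0}"
    and \<alpha>: "inj_on \<alpha> {1..n}" and c: "blinfun_apply f c \<in> algebraic_elements (root_poly n \<alpha>)"
  defines "x \<equiv> \<lambda>i. poly_eval (lagrange n \<alpha> i) c"
  defines "a \<equiv> (\<Sum>i\<in>{1..n}. \<alpha> i *\<^sub>C idem (x i))"
  shows "\<And>i. i \<in> {1..n} \<Longrightarrow> algebra_spectrum (x i * x i - x i) = {0}"
    "a \<in> algebraic_elements (root_poly n \<alpha>)" "blinfun_apply f a = blinfun_apply f c"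
proof -
  have hom: "blinfun_apply f (u * v) = blinfun_apply f u * blinfun_apply f v"
      "blinfun_apply f (k *\<^sub>C u) = k *\<^sub>C blinfun_apply f u" for u v k
    using f(1) by (simp_all add: algebra_hom_def)
  have van: "poly_eval q (blinfun_apply f c) = 0" if "\<And>i. i \<in> {1..n} \<Longrightarrow> poly q (\<alpha> i) = 0" for q
    by (rule poly_eval_eq_0[OF \<alpha> c that])
  have ker: "blinfun_apply f (x i * x i - x i) = 0" if i: "i \<in> {1..n}" for i
  proof -
    have "x i * x i - x i = poly_eval (lagrange n \<alpha> i * lagrange n \<alpha> i - lagrange n \<alpha> i) c"
      by (simp add: x_def poly_eval_mult poly_eval_diff)
    then show ?thesis by (simp add: poly_eval_hom[OF f]) (rule van, simp add: poly_lagrange[OF \<alpha> i])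
  qed
  show sp: "algebra_spectrum (x i * x i - x i) = {0}" if "i \<in> {1..n}" for i by (rule qn[OF ker[OF that]])
  define e where "e i = idem (x i)" for i
  have fe: "blinfun_apply f (e i) = poly_eval (lagrange n \<alpha> i) (blinfun_apply f c)" if i: "i \<in> {1..n}" for i
    unfolding e_def idem_hom[OF sp[OF i] f ker[OF i]] by (simp add: x_def poly_eval_hom[OF f])
  have comm: "y * e i = e i * y" if "i \<in> {1..n}" "y * c = c * y" for y i
    unfolding e_def by (rule idem_commute[OF sp[OF that(1)]]) (simp add: x_def poly_eval_commute[OF that(2)])
  have idem: "e i * e i = e i" if "i \<in> {1..n}" for i unfolding e_def by (rule idem_idempotent[OF sp[OF that]])
  have orth: "e i * e j = (if i = j then e i else 0)" if ij: "i \<in> {1..n}" "j \<in> {1..n}" for i j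
  proof (cases "i = j")
    case False
    have "e i * e j = e j * e i" using comm[OF ij(2), of "e i"] comm[OF ij(1), of c] by simp
    then have "(e i * e j) * (e i * e j) = (e i * e i) * (e j * e j)" by (metis mult.assoc)
    then have "(e i * e j) * (e i * e j) = e i * e j" using idem ij by simp
    moreover have "blinfun_apply f (e i * e j) = 0"
      unfolding hom(1) fe[OF ij(1)] fe[OF ij(2)] poly_eval_mult[symmetric]
      by (rule van) (use False in \<open>auto simp: poly_lagrange[OF \<alpha> ij(1)] poly_lagrange[OF \<alpha> ij(2)]\<close>)
    ultimately show ?thesis using idempotent_quasinilpotent_eq_0 qn False by auto
  next
    case True
    then show ?thesis using idem[OF ij(1)] by simp
  qed
  define E where "E = (\<Sum>i\<in>{1..n}. e i)"
  have scaled: "(\<Sum>i\<in>{1..n}. k i *\<^sub>C e i) * (\<Sum>i\<in>{1..n}. l i *\<^sub>C e i) = (\<Sum>i\<in>{1..n}. (k i * l i) *\<^sub>C e i)" for k l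
  proof -
    have "(\<Sum>i\<in>{1..n}. k i *\<^sub>C e i) * (\<Sum>i\<in>{1..n}. l i *\<^sub>C e i)
        = (\<Sum>i\<in>{1..n}. \<Sum>j\<in>{1..n}. if i = j then (k i * l i) *\<^sub>C e i else 0)"
      unfolding sum_product
      by (intro sum.cong refl) (simp add: mult_scaleC_left mult_scaleC_right orth scaleC_scaleC mult.commute)
    then show ?thesis by (simp add: sum.delta)
  qed
  have EE: "E * E = E" using scaled[of "\<lambda>_. 1" "\<lambda>_. 1"] by (simp add: E_def)
  have E1: "E = 1"
  proof -
    have "(1 - E) * (1 - E) = 1 - E" using EE by (simp add: left_diff_distrib right_diff_distrib)
    moreover have "blinfun_apply f (1 - E) = 0"
    proof -
      have "blinfun_apply f E = poly_eval (\<Sum>i\<in>{1..n}. lagrange n \<alpha> i) (blinfun_apply f c)"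
        unfolding E_def blinfun.sum_right poly_eval_sum by (rule sum.cong) (simp_all add: fe)
      moreover have "poly_eval (1 - (\<Sum>i\<in>{1..n}. lagrange n \<alpha> i)) (blinfun_apply f c) = 0"
        by (rule van) (simp add: poly_sum poly_lagrange[OF \<alpha>] sum.delta)
      ultimately show ?thesis by (simp add: blinfun.diff_right f(2) poly_eval_diff)
    qed
    ultimately have "1 - E = 0" using idempotent_quasinilpotent_eq_0 qn by blast
    then show ?thesis by simp
  qed
  have ae: "a = (\<Sum>i\<in>{1..n}. \<alpha> i *\<^sub>C e i)" by (simp add: a_def e_def)
  have "poly_eval q a = (\<Sum>i\<in>{1..n}. poly q (\<alpha> i) *\<^sub>C e i)" for q
  proof (induction q)
    case (pCons k q)
    have "k *\<^sub>C 1 = (\<Sum>i\<in>{1..n}. k *\<^sub>C e i)" unfolding E1[symmetric] E_def by (rule scaleC.sum_right)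
    moreover have "a * poly_eval q a = (\<Sum>i\<in>{1..n}. (\<alpha> i * poly q (\<alpha> i)) *\<^sub>C e i)"
      unfolding pCons.IH unfolding ae by (rule scaled)
    ultimately show ?case by (simp add: scaleC_add_left sum.distrib)
  qed simp
  moreover have "poly (root_poly n \<alpha>) (\<alpha> i) = 0" if "i \<in> {1..n}" for i
    using that unfolding root_poly_def poly_prod by (intro prod_zero) auto
  ultimately have "poly_eval (root_poly n \<alpha>) a = 0" by simp
  then show "a \<in> algebraic_elements (root_poly n \<alpha>)" by (simp add: algebraic_elements_def)
  have "blinfun_apply f a = poly_eval (\<Sum>i\<in>{1..n}. smult (\<alpha> i) (lagrange n \<alpha> i)) (blinfun_apply f c)"
    unfolding ae blinfun.sum_right poly_eval_sum by (rule sum.cong) (simp_all add: fe hom poly_eval_smult)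
  moreover have "poly_eval ([:0, 1:] - (\<Sum>i\<in>{1..n}. smult (\<alpha> i) (lagrange n \<alpha> i))) (blinfun_apply f c) = 0"
    by (rule van) (simp add: poly_sum poly_lagrange[OF \<alpha>] sum.delta if_distrib[of "(*) _"] cong: if_cong)
  ultimately show "blinfun_apply f a = blinfun_apply f c" by (simp add: poly_eval_diff)
qed

theorem theorem19:
  fixes n :: nat
    and \<alpha> :: "nat \<Rightarrow> complex"
    and U :: "complex set"
    and \<pi> :: "complex \<Rightarrow> 'a::complex_banach_algebra_1 \<Rightarrow>\<^sub>L 'b::complex_banach_algebra_1"
    and b :: "complex \<Rightarrow> 'b"
  assumes "n \<ge> 2"
    and "inj_on \<alpha> {1..n}"
    and "open U"
    and "banach_analytic_on \<pi> U"
    and "\<And>z. z \<in> U \<Longrightarrow> algebra_hom (\<pi> z)"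
    and "\<And>z. z \<in> U \<Longrightarrow> blinfun_apply (\<pi> z) 1 = 1"
    and "\<And>z. z \<in> U \<Longrightarrow> surj (blinfun_apply (\<pi> z))"
    and "\<And>z x. z \<in> U \<Longrightarrow> x \<in> blinfun_kernel (\<pi> z) \<Longrightarrow> algebra_spectrum x = {0}"
    and "banach_analytic_on b U"
    and "\<And>z. z \<in> U \<Longrightarrow> b z \<in> algebraic_elements (root_poly n \<alpha>)"
  shows "\<exists>a :: complex \<Rightarrow> 'a. banach_analytic_on a U \<and>
           (\<forall>z\<in>U. a z \<in> algebraic_elements (root_poly n \<alpha>)) \<and>
           (\<forall>z\<in>U. blinfun_apply (\<pi> z) (a z) = b z)"
proof -
  interpret surj_family U \<pi>
    by unfold_locales
      (use assms in \<open>auto simp: algebra_hom_def intro: banach_analytic_on_imp_holo\<close>)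
  obtain c where c: "holo c U" "\<And>z. z \<in> U \<Longrightarrow> blinfun_apply (\<pi> z) (c z) = b z"
    using global_lift[OF banach_analytic_on_imp_holo[OF assms(9,3)]] by blast
  define x where "x i z = poly_eval (lagrange n \<alpha> i) (c z)" for i z
  define a where "a z = (\<Sum>i\<in>{1..n}. \<alpha> i *\<^sub>C idem (x i z))" for z
  have qn: "algebra_spectrum y = {0}" if "z \<in> U" "blinfun_apply (\<pi> z) y = 0" for z y
    using assms(8) that by (simp add: blinfun_kernel_def)
  have alg: "blinfun_apply (\<pi> z) (c z) \<in> algebraic_elements (root_poly n \<alpha>)" if "z \<in> U" for z
    using assms(10) c(2) that by simp
  have lift: "\<And>i. i \<in> {1..n} \<Longrightarrow> algebra_spectrum (x i z * x i z - x i z) = {0}"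
      "a z \<in> algebraic_elements (root_poly n \<alpha>)" "blinfun_apply (\<pi> z) (a z) = blinfun_apply (\<pi> z) (c z)"
    if z: "z \<in> U" for z
    using lift_of_algebraic_element[OF assms(5,6)[OF z] qn[OF z] assms(2) alg[OF z]] unfolding x_def a_def by blast+
  have "holo a U" unfolding a_def[abs_def] x_def[abs_def]
    by (intro holo_sum holo_scaleC holo_const assms(3) holo_idem holo_poly_eval c(1) lift(1)[unfolded x_def])
  then have "banach_analytic_on a U" by (rule holo_imp_banach_analytic_on)
  then show ?thesis using lift(2,3) c(2) by (intro exI[of _ a]) auto
qed

end
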